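(* Let $(\mathscr{C},\mathbf{W})$ satisfy conditions (BF). Then the construction of $\mathscr{C}[\mathbf{W}^{-1}]$ depends only on the set of choices $\mathrm{C}(\mathbf{W})$. That is, for any fixed set of choices $\mathrm{C}(\mathbf{W})$, any two sets of choices $\mathrm{D}(\mathbf{W})$ give the same bicategory of fractions (the same objects, morphisms, 2-morphisms, unitors, composition of 1-morphisms, vertical and horizontal compositions of 2-morphisms and associators), and not merely equivalent ones.
   Context: Conventions. $\mathscr{C}$ is a bicategory and $\mathbf{W}$ a class of 1-morphisms in it. $\circ$ denotes composition of 1-morphisms and whiskering; $\bullet$ denotes vertical composition of 2-morphisms ($\beta\bullet\alpha$ means first $\alpha$, then $\beta$). Associators and unitors of $\mathscr{C}$ are omitted from the notation (by coherence they can be inserted unambiguously). Conditions (BF): (BF1) every $\mathrm{id}_A$ is in $\mathbf{W}$. (BF2) $\mathbf{W}$ is closed under composition. (BF3) For every $w:A\to B$ in $\mathbf{W}$ and every $f:C\to B$ there are an object $D$, $w':D\to C$ in $\mathbf{W}$, $f':D\to A$ and an invertible 2-morphism $f\circ w'\Rightarrow w\circ f'$. (BF4a) For every $w:B\to A$ in $\mathbf{W}$, $f^1,f^2:C\to B$ and $\alpha:w\circ f^1\Rightarrow w\circ f^2$ there are an object $D$, $v:D\to C$ in $\mathbf{W}$ and $\beta:f^1\circ v\Rightarrow f^2\circ v$ with $\alpha\circ v=w\circ\beta$. (BF4b) If $\alpha$ in (BF4a) is invertible, so is $\beta$. (BF4c) If $(D',v',\beta')$ is another triple with the same properties as $(D,v,\beta)$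 in (BF4a), there are an object $E$, $u:E\to D$, $u':E\to D'$ and an invertible $\zeta:v\circ u\Rightarrow v'\circ u'$ with $v\circ u\in\mathbf{W}$ and $(\beta'\circ u')\bullet(f^1\circ\zeta)=(f^2\circ\zeta)\bullet(\beta\circ u)$. (BF5) If $w:A\to B$ is in $\mathbf{W}$ and there is an invertible $v\Rightarrow w$, then $v\in\mathbf{W}$. Choices. $\mathrm{C}(\mathbf{W})$: for every $f:A'\to B$ and every $v:B'\to B$ in $\mathbf{W}$, a chosen $(A'',v',f',\rho)$ with $v':A''\to A'$ in $\mathbf{W}$, $f':A''\to B'$ and $\rho:f\circ v'\Rightarrow v\circ f'$ invertible (possible by (BF3)). $\mathrm{D}(\mathbf{W})$: for every $w:B\to A$ in $\mathbf{W}$, $f^1,f^2:C\to B$ and $\alpha:w\circ f^1\Rightarrow w\circ f^2$, a chosen $v:D\to C$ in $\mathbf{W}$ and $\beta:f^1\circ v\Rightarrow f^2\circ v$ with $\alpha\circ v=w\circ\beta$ (possible by (BF4a)). Pronk's bicategory of fractions $\mathscr{C}[\mathbf{W}^{-1}]$. Objects: those of $\mathscr{C}$. A morphism $A\to B$ is a triple $(A',w,f)$ with $w:A'\to A$ in $\mathbf{W}$, $f:A'\to B$. Composition: $(B',v,g)\circ(A',w,f):=(A'',w\circ v',g\circ f')$ with $(A'',v',f',\rho)$ the choice in $\mathrm{C}(\mathbf{W})$ for $(f,v)$. A 2-morphism $(A^1,w^1,f^1)\Rightarrow(A^2,w^2,f^2)$ is a class $[A^3,v^1,v^2,\alpha,\beta]$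 with $v^m:A^3\to A^m$, $w^1\circ v^1\in\mathbf{W}$, $\alpha:w^1\circ v^1\Rightarrow w^2\circ v^2$ invertible, $\beta:f^1\circ v^1\Rightarrow f^2\circ v^2$; data $(A^3,v^1,v^2,\alpha,\beta)$ and $(A'^3,v'^1,v'^2,\alpha',\beta')$ are equivalent iff there are $z:A^4\to A^3$, $z':A^4\to A'^3$ and invertible $\sigma^1:v'^1\circ z'\Rightarrow v^1\circ z$, $\sigma^2:v^2\circ z\Rightarrow v'^2\circ z'$ with $w^1\circ v^1\circ z\in\mathbf{W}$, $(w^2\circ\sigma^2)\bullet(\alpha\circ z)\bullet(w^1\circ\sigma^1)=\alpha'\circ z'$ and $(f^2\circ\sigma^2)\bullet(\beta\circ z)\bullet(f^1\circ\sigma^1)=\beta'\circ z'$. Unitors are induced by those of $\mathscr{C}$ and do not involve $\mathrm{D}(\mathbf{W})$. The remaining structure is obtained as follows; in each case Pronk uses one particular set of auxiliary data of the indicated kind, selected by means of $\mathrm{C}(\mathbf{W})$ and $\mathrm{D}(\mathbf{W})$ (so that a priori the result depends on $\mathrm{D}(\mathbf{W})$), and the result does not depend on the representatives of the 2-morphisms being composed. Vertical composition of $\Gamma^1=[A^4,u^1,u^2,\alpha^1,\beta^1]:(A^1,w^1,f^1)\Rightarrow(A^2,w^2,f^2)$ and $\Gamma^2=[A^5,u^3,u^4,\alpha^2,\beta^2]:(A^2,w^2,f^2)\Rightarrow(A^3,w^3,f^3)$: data $t^1:C\to A^4$ in $\mathbf{W}$, $t^2:C\to A^5$, $\rho:u^2\circ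 t^1\Rightarrow u^3\circ t^2$ invertible; $\Gamma^2\circ\Gamma^1$ is the class of $(C,u^1\circ t^1,u^4\circ t^2,(\alpha^2\circ t^2)\bullet(w^2\circ\rho)\bullet(\alpha^1\circ t^1),(\beta^2\circ t^2)\bullet(f^2\circ\rho)\bullet(\beta^1\circ t^1))$. Composition $\Delta\circ\underline f$ for $\underline f=(A',w,f):A\to B$ and $\Delta=[B^3,u^1,u^2,\alpha,\beta]:(B^1,v^1,g^1)\Rightarrow(B^2,v^2,g^2)$ (both $B\to C$): let $(D^m,w^m,f^m,\rho^m)$ be the choice in $\mathrm{C}(\mathbf{W})$ for $(f,v^m)$. Data: $t^1:D^3\to D^1$, $t^2:D^4\to D^2$ in $\mathbf{W}$, $h^1:D^3\to B^3$, $h^2:D^4\to B^3$, invertible $\sigma^m:f^m\circ t^m\Rightarrow u^m\circ h^m$; $t^3:D^5\to D^3$ in $\mathbf{W}$, $t^4:D^5\to D^4$, invertible $\varphi:w^1\circ t^1\circ t^3\Rightarrow w^2\circ t^2\circ t^4$; invertible $\delta:h^1\circ t^3\Rightarrow h^2\circ t^4$ with $v^1\circ u^1\circ\delta=(\alpha^{-1}\circ h^2\circ t^4)\bullet(v^2\circ\sigma^2\circ t^4)\bullet(\rho^2\circ t^2\circ t^4)\bullet(f\circ\varphi)\bullet((\rho^1)^{-1}\circ t^1\circ t^3)\bullet(v^1\circ(\sigma^1)^{-1}\circ t^3)$. Then $\Delta\circ\underline f$ is the class of $(D^5,t^1\circ t^3,t^2\circ t^4,w\circ\varphi,\xi)$,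 $\xi=(g^2\circ(\sigma^2)^{-1}\circ t^4)\bullet(\beta\circ h^2\circ t^4)\bullet(g^1\circ u^1\circ\delta)\bullet(g^1\circ\sigma^1\circ t^3)$. Composition $\underline g\circ\Gamma$ for $\underline g=(B',u,g):B\to C$ and $\Gamma=[A^3,v^1,v^2,\alpha,\beta]:(A^1,w^1,f^1)\Rightarrow(A^2,w^2,f^2)$ (both $A\to B$): let $(D^m,u^m,h^m,\rho^m)$ be the choice for $(f^m,u)$. Data: $u^3:D^3\to A^3$, $u^5:D^4\to A^3$ in $\mathbf{W}$, $u^4:D^3\to D^1$, $u^6:D^4\to D^2$, invertible $\eta^1:v^1\circ u^3\Rightarrow u^1\circ u^4$, $\eta^2:v^2\circ u^5\Rightarrow u^2\circ u^6$; $u^7:D^5\to D^3$ in $\mathbf{W}$, $u^8:D^5\to D^4$, invertible $\eta^3:u^3\circ u^7\Rightarrow u^5\circ u^8$; $\lambda:h^1\circ u^4\circ u^7\Rightarrow h^2\circ u^6\circ u^8$ with $u\circ\lambda=(\rho^2\circ u^6\circ u^8)\bullet(f^2\circ\eta^2\circ u^8)\bullet(f^2\circ v^2\circ\eta^3)\bullet(\beta\circ u^3\circ u^7)\bullet(f^1\circ(\eta^1)^{-1}\circ u^7)\bullet((\rho^1)^{-1}\circ u^4\circ u^7)$. Then $\underline g\circ\Gamma$ is the class of $(D^5,u^4\circ u^7,u^6\circ u^8,\mu,g\circ\lambda)$, $\mu=(w^2\circ\eta^2\circ u^8)\bullet(w^2\circ v^2\circ\eta^3)\bullet(\alpha\circ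 u^3\circ u^7)\bullet(w^1\circ(\eta^1)^{-1}\circ u^7)$. Horizontal compositions of 2-morphisms are obtained by combining these three operations: for $\Gamma:\underline f^1\Rightarrow\underline f^2$, $\Delta:\underline g^1\Rightarrow\underline g^2$ composable, $\Delta\circ\Gamma$ is the vertical composite of $\underline g^1\circ\Gamma$ followed by $\Delta\circ\underline f^2$. Associator for $\underline f=(A',u,f):A\to B$, $\underline g=(B',v,g):B\to C$, $\underline h=(C',w,h):C\to D$: let $(A^1,u^1,f^1,\delta)$, $(A^2,u^2,l,\sigma)$, $(B^2,v^1,g^1,\xi)$, $(A^3,u^3,f^2,\eta)$ be the choices in $\mathrm{C}(\mathbf{W})$ for $(f,v)$, $(g\circ f^1,w)$, $(g,w)$, $(f,v\circ v^1)$. Data: $u^4:A^4\to A^2$ with $u\circ u^1\circ u^2\circ u^4\in\mathbf{W}$, $u^5:A^4\to A^3$, invertible $\gamma:u^1\circ u^2\circ u^4\Rightarrow u^3\circ u^5$, $\omega:f^1\circ u^2\circ u^4\Rightarrow v^1\circ f^2\circ u^5$, $\rho:l\circ u^4\Rightarrow g^1\circ f^2\circ u^5$ with $v\circ\omega=(\eta\circ u^5)\bullet(f\circ\gamma)\bullet(\delta^{-1}\circ u^2\circ u^4)$ and $w\circ\rho=(\xi\circ f^2\circ u^5)\bullet(g\circ\omega)\bullet(\sigma^{-1}\circ u^4)$. The associator $\underline h\circ(\underline g\circ\underline f)\Rightarrow(\underline h\circ\underline g)\circ\underline f$ is the class of $(A^4,u^4,u^5,u\circ\gamma,h\circ\rho)$.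 *)

theory Defs
  imports Main
begin

section \<open>Bicategories\<close>

text \<open>
  Compositions are written in applicative order: \<open>g \<star> f\<close> is "first \<open>f\<close>, then \<open>g\<close>", and likewise for
  the vertical composition \<open>\<bullet>\<close> and the horizontal composition \<open>\<diamondop>\<close> of 2-morphisms.
  The associator goes \<open>h \<star> (g \<star> f) \<Rightarrow> (h \<star> g) \<star> f\<close>.
\<close>

record ('o, 'a, 'c) bicat =
  Obj :: "'o set"
  Arr :: "'a set"
  Dom :: "'a \<Rightarrow> 'o"
  Cod :: "'a \<Rightarrow> 'o"
  Cell :: "'c set"
  Src :: "'c \<Rightarrow> 'a"
  Tgt :: "'c \<Rightarrow> 'a"
  Id1 :: "'o \<Rightarrow> 'a"
  Comp1 :: "'a \<Rightarrow> 'a \<Rightarrow> 'a" (infixr "\<star>\<index>" 70)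
  Id2 :: "'a \<Rightarrow> 'c"
  VComp :: "'c \<Rightarrow> 'c \<Rightarrow> 'c" (infixr "\<bullet>\<index>" 60)
  HComp :: "'c \<Rightarrow> 'c \<Rightarrow> 'c" (infixr "\<diamondop>\<index>" 65)
  Assoc :: "'a \<Rightarrow> 'a \<Rightarrow> 'a \<Rightarrow> 'c"
  LUnit :: "'a \<Rightarrow> 'c"
  RUnit :: "'a \<Rightarrow> 'c"

definition in_hom1 :: "('o, 'a, 'c, 'm) bicat_scheme \<Rightarrow> 'a \<Rightarrow> 'o \<Rightarrow> 'o \<Rightarrow> bool"
    ("\<guillemotleft>_ : _ \<rightarrow>\<index> _\<guillemotright>") where
  "in_hom1 C f A B \<longleftrightarrow> f \<in> Arr C \<and> Dom C f = A \<and> Cod C f = B"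

definition in_hom2 :: "('o, 'a, 'c, 'm) bicat_scheme \<Rightarrow> 'c \<Rightarrow> 'a \<Rightarrow> 'a \<Rightarrow> bool"
    ("\<guillemotleft>_ : _ \<Rightarrow>\<index> _\<guillemotright>") where
  "in_hom2 C x f g \<longleftrightarrow> x \<in> Cell C \<and> Src C x = f \<and> Tgt C x = g"

definition inverse2 :: "('o, 'a, 'c, 'm) bicat_scheme \<Rightarrow> 'c \<Rightarrow> 'c \<Rightarrow> bool" where
  "inverse2 C x y \<longleftrightarrow> in_hom2 C y (Tgt C x) (Src C x)
     \<and> VComp C y x = Id2 C (Src C x) \<and> VComp C x y = Id2 C (Tgt C x)"

definition iso2 :: "('o, 'a, 'c, 'm) bicat_scheme \<Rightarrow> 'c \<Rightarrow> bool" where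
  "iso2 C x \<longleftrightarrow> x \<in> Cell C \<and> (\<exists>y. inverse2 C x y)"

definition inv2 :: "('o, 'a, 'c, 'm) bicat_scheme \<Rightarrow> 'c \<Rightarrow> 'c" where
  "inv2 C x = (THE y. inverse2 C x y)"

abbreviation iso_in_hom2 :: "('o, 'a, 'c, 'm) bicat_scheme \<Rightarrow> 'c \<Rightarrow> 'a \<Rightarrow> 'a \<Rightarrow> bool"
    ("\<guillemotleft>_ : _ \<cong>\<index> _\<guillemotright>") where
  "iso_in_hom2 C x f g \<equiv> in_hom2 C x f g \<and> iso2 C x"

locale bicategory =
  fixes C :: "('o, 'a, 'c, 'm) bicat_scheme" (structure)
  assumes arr_obj: "f \<in> Arr C \<Longrightarrow> Dom C f \<in> Obj C \<and> Cod C f \<in> Obj C"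
    and cell_arr: "x \<in> Cell C \<Longrightarrow> Src C x \<in> Arr C \<and> Tgt C x \<in> Arr C
      \<and> Dom C (Src C x) = Dom C (Tgt C x) \<and> Cod C (Src C x) = Cod C (Tgt C x)"
    and id1: "A \<in> Obj C \<Longrightarrow> \<guillemotleft>Id1 C A : A \<rightarrow> A\<guillemotright>"
    and comp1: "\<guillemotleft>f : A \<rightarrow> B\<guillemotright> \<Longrightarrow> \<guillemotleft>g : B \<rightarrow> D\<guillemotright> \<Longrightarrow> \<guillemotleft>g \<star> f : A \<rightarrow> D\<guillemotright>"
    and id2: "f \<in> Arr C \<Longrightarrow> \<guillemotleft>Id2 C f : f \<Rightarrow> f\<guillemotright>"
    and vcomp: "\<guillemotleft>x : f \<Rightarrow> g\<guillemotright> \<Longrightarrow> \<guillemotleft>y : g \<Rightarrow> h\<guillemotright> \<Longrightarrow> \<guillemotleft>y \<bullet> x : f \<Rightarrow> h\<guillemotright>"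
    and vcomp_id: "\<guillemotleft>x : f \<Rightarrow> g\<guillemotright> \<Longrightarrow> x \<bullet> Id2 C f = x"
    and id_vcomp: "\<guillemotleft>x : f \<Rightarrow> g\<guillemotright> \<Longrightarrow> Id2 C g \<bullet> x = x"
    and vcomp_assoc: "\<guillemotleft>x : f \<Rightarrow> g\<guillemotright> \<Longrightarrow> \<guillemotleft>y : g \<Rightarrow> h\<guillemotright> \<Longrightarrow> \<guillemotleft>z : h \<Rightarrow> k\<guillemotright>
      \<Longrightarrow> (z \<bullet> y) \<bullet> x = z \<bullet> (y \<bullet> x)"
    and hcomp: "\<guillemotleft>x : f \<Rightarrow> f'\<guillemotright> \<Longrightarrow> \<guillemotleft>y : g \<Rightarrow> g'\<guillemotright> \<Longrightarrow> Cod C f = Dom C g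
      \<Longrightarrow> \<guillemotleft>y \<diamondop> x : g \<star> f \<Rightarrow> g' \<star> f'\<guillemotright>"
    and hcomp_id: "\<guillemotleft>f : A \<rightarrow> B\<guillemotright> \<Longrightarrow> \<guillemotleft>g : B \<rightarrow> D\<guillemotright> \<Longrightarrow> Id2 C g \<diamondop> Id2 C f = Id2 C (g \<star> f)"
    and interchange: "\<guillemotleft>x : f \<Rightarrow> f'\<guillemotright> \<Longrightarrow> \<guillemotleft>x' : f' \<Rightarrow> f''\<guillemotright> \<Longrightarrow> \<guillemotleft>y : g \<Rightarrow> g'\<guillemotright> \<Longrightarrow> \<guillemotleft>y' : g' \<Rightarrow> g''\<guillemotright>
      \<Longrightarrow> Cod C f = Dom C g \<Longrightarrow> (y' \<bullet> y) \<diamondop> (x' \<bullet> x) = (y' \<diamondop> x') \<bullet> (y \<diamondop> x)"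
    and assoc: "\<guillemotleft>f : A \<rightarrow> B\<guillemotright> \<Longrightarrow> \<guillemotleft>g : B \<rightarrow> D\<guillemotright> \<Longrightarrow> \<guillemotleft>h : D \<rightarrow> E\<guillemotright>
      \<Longrightarrow> \<guillemotleft>Assoc C h g f : h \<star> (g \<star> f) \<cong> (h \<star> g) \<star> f\<guillemotright>"
    and assoc_natural: "\<guillemotleft>x : f \<Rightarrow> f'\<guillemotright> \<Longrightarrow> \<guillemotleft>y : g \<Rightarrow> g'\<guillemotright> \<Longrightarrow> \<guillemotleft>z : h \<Rightarrow> h'\<guillemotright>
      \<Longrightarrow> Cod C f = Dom C g \<Longrightarrow> Cod C g = Dom C h
      \<Longrightarrow> Assoc C h' g' f' \<bullet> (z \<diamondop> (y \<diamondop> x)) = ((z \<diamondop> y) \<diamondop> x) \<bullet> Assoc C h g f"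
    and lunit: "\<guillemotleft>f : A \<rightarrow> B\<guillemotright> \<Longrightarrow> \<guillemotleft>LUnit C f : Id1 C B \<star> f \<cong> f\<guillemotright>"
    and lunit_natural: "\<guillemotleft>x : f \<Rightarrow> g\<guillemotright>
      \<Longrightarrow> LUnit C g \<bullet> (Id2 C (Id1 C (Cod C f)) \<diamondop> x) = x \<bullet> LUnit C f"
    and runit: "\<guillemotleft>f : A \<rightarrow> B\<guillemotright> \<Longrightarrow> \<guillemotleft>RUnit C f : f \<star> Id1 C A \<cong> f\<guillemotright>"
    and runit_natural: "\<guillemotleft>x : f \<Rightarrow> g\<guillemotright>
      \<Longrightarrow> RUnit C g \<bullet> (x \<diamondop> Id2 C (Id1 C (Dom C f))) = x \<bullet> RUnit C f"
    and pentagon: "\<guillemotleft>f : A \<rightarrow> B\<guillemotright> \<Longrightarrow> \<guillemotleft>g : B \<rightarrow> D\<guillemotright> \<Longrightarrow> \<guillemotleft>h : D \<rightarrow> E\<guillemotright> \<Longrightarrow> \<guillemotleft>k : E \<rightarrow> F\<guillemotright>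
      \<Longrightarrow> (Assoc C k h g \<diamondop> Id2 C f) \<bullet> Assoc C k (h \<star> g) f \<bullet> (Id2 C k \<diamondop> Assoc C h g f)
        = Assoc C (k \<star> h) g f \<bullet> Assoc C k h (g \<star> f)"
    and triangle: "\<guillemotleft>f : A \<rightarrow> B\<guillemotright> \<Longrightarrow> \<guillemotleft>g : B \<rightarrow> D\<guillemotright>
      \<Longrightarrow> (RUnit C g \<diamondop> Id2 C f) \<bullet> Assoc C g (Id1 C B) f = Id2 C g \<diamondop> LUnit C f"


section \<open>Inserting the associators\<close>

text \<open>
  Formulas in which associators are omitted are read in the strictification of the bicategory.
  A 1-morphism of the strictification is a nonempty list of composable 1-morphisms, standing for its
  right-bracketed composite \<open>path\<close>; a 2-morphism from \<open>p\<close> to \<open>q\<close> is a triple \<open>(p, x, q)\<close> with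
  \<open>x : path p \<Rightarrow> path q\<close>. The operations \<open>fs \<lhd> X\<close> and \<open>X \<rhd> gs\<close> (whiskering by \<open>fs\<close> on the
  left and by \<open>gs\<close> on the right) and \<open>Y \<odot> X\<close> (vertical composition) insert the coherence
  isomorphisms, which are composites of associators only. A composite \<open>path fs\<close> occurring as a
  single entry of a list is opened and closed with \<open>split fs\<close> and \<open>join fs\<close>; for instance
  \<open>split [g, f] \<rhd> [k]\<close> is the coherence isomorphism \<open>(g \<star> f) \<star> k \<Rightarrow> g \<star> (f \<star> k)\<close>.
\<close>

type_synonym ('a, 'c) scell = "'a list \<times> 'c \<times> 'a list"

abbreviation the_cell :: "('a, 'c) scell \<Rightarrow> 'c" where
  "the_cell X \<equiv> fst (snd X)"

context
  fixes C :: "('o, 'a, 'c, 'm) bicat_scheme" (structure)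
begin

fun path :: "'a list \<Rightarrow> 'a" where
  "path [f] = f"
| "path (f # g # fs) = f \<star> path (g # fs)"

text \<open>\<open>coh fs gs : path fs \<star> path gs \<Rightarrow> path (fs @ gs)\<close>\<close>

fun coh :: "'a list \<Rightarrow> 'a list \<Rightarrow> 'c" where
  "coh [f] gs = Id2 C (f \<star> path gs)"
| "coh (f # g # fs) gs =
     (Id2 C f \<diamondop> coh (g # fs) gs) \<bullet> inv2 C (Assoc C f (path (g # fs)) (path gs))"

fun svcomp :: "('a, 'c) scell \<Rightarrow> ('a, 'c) scell \<Rightarrow> ('a, 'c) scell" where
  "svcomp (q', y, r) (p, x, q) = (p, y \<bullet> x, r)"

fun slwhisk :: "'a list \<Rightarrow> ('a, 'c) scell \<Rightarrow> ('a, 'c) scell" where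
  "slwhisk fs (p, x, q) = (fs @ p, foldr (\<lambda>f y. Id2 C f \<diamondop> y) fs x, fs @ q)"

fun srwhisk :: "('a, 'c) scell \<Rightarrow> 'a list \<Rightarrow> ('a, 'c) scell" where
  "srwhisk (p, x, q) gs =
     (p @ gs, coh q gs \<bullet> (x \<diamondop> Id2 C (path gs)) \<bullet> inv2 C (coh p gs), q @ gs)"

fun sinv :: "('a, 'c) scell \<Rightarrow> ('a, 'c) scell" where
  "sinv (p, x, q) = (q, inv2 C x, p)"

definition split :: "'a list \<Rightarrow> ('a, 'c) scell" where
  "split fs = ([path fs], Id2 C (path fs), fs)"

definition join :: "'a list \<Rightarrow> ('a, 'c) scell" where
  "join fs = (fs, Id2 C (path fs), [path fs])"

end

notation svcomp (infixr "\<odot>\<index>" 60)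
notation slwhisk (infixr "\<lhd>\<index>" 66)
notation srwhisk (infixl "\<rhd>\<index>" 67)


section \<open>The conditions (BF) and the sets of choices\<close>

type_synonym ('o, 'a, 'c) choiceC = "'a \<Rightarrow> 'a \<Rightarrow> 'o \<times> 'a \<times> 'a \<times> 'c"
type_synonym ('o, 'a, 'c) choiceD = "'a \<Rightarrow> 'a \<Rightarrow> 'a \<Rightarrow> 'c \<Rightarrow> 'o \<times> 'a \<times> 'c"

context
  fixes C :: "('o, 'a, 'c, 'm) bicat_scheme" (structure)
    and W :: "'a set"
begin

text \<open>\<open>(D, w', f', \<rho>)\<close> completes the cospan formed by \<open>f\<close> and \<open>w\<close>.\<close>

fun BF3_square :: "'a \<Rightarrow> 'a \<Rightarrow> 'o \<times> 'a \<times> 'a \<times> 'c \<Rightarrow> bool" where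
  "BF3_square f w (D, w', f', \<rho>) \<longleftrightarrow>
     w' \<in> W \<and> \<guillemotleft>w' : D \<rightarrow> Dom C f\<guillemotright> \<and> \<guillemotleft>f' : D \<rightarrow> Dom C w\<guillemotright> \<and> \<guillemotleft>\<rho> : f \<star> w' \<cong> w \<star> f'\<guillemotright>"

fun BF4_triple :: "'a \<Rightarrow> 'a \<Rightarrow> 'a \<Rightarrow> 'c \<Rightarrow> 'o \<times> 'a \<times> 'c \<Rightarrow> bool" where
  "BF4_triple w f1 f2 \<alpha> (D, v, \<beta>) \<longleftrightarrow>
     v \<in> W \<and> \<guillemotleft>v : D \<rightarrow> Dom C f1\<guillemotright> \<and> \<guillemotleft>\<beta> : f1 \<star> v \<Rightarrow> f2 \<star> v\<guillemotright> \<and>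
     ([w, f1], \<alpha>, [w, f2]) \<rhd> [v] = [w] \<lhd> ([f1, v], \<beta>, [f2, v])"

definition BF4_input :: "'a \<Rightarrow> 'a \<Rightarrow> 'a \<Rightarrow> 'c \<Rightarrow> bool" where
  "BF4_input w f1 f2 \<alpha> \<longleftrightarrow> w \<in> W \<and>
     (\<exists>A. \<guillemotleft>f1 : A \<rightarrow> Dom C w\<guillemotright> \<and> \<guillemotleft>f2 : A \<rightarrow> Dom C w\<guillemotright>) \<and> \<guillemotleft>\<alpha> : w \<star> f1 \<Rightarrow> w \<star> f2\<guillemotright>"

definition BF1 :: bool where
  "BF1 \<longleftrightarrow> (\<forall>A \<in> Obj C. Id1 C A \<in> W)"

definition BF2 :: bool where
  "BF2 \<longleftrightarrow> (\<forall>v \<in> W. \<forall>w \<in> W. Cod C v = Dom C w \<longrightarrow> w \<star> v \<in> W)"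

definition BF3 :: bool where
  "BF3 \<longleftrightarrow> (\<forall>w \<in> W. \<forall>f \<in> Arr C. Cod C f = Cod C w \<longrightarrow> (\<exists>s. BF3_square f w s))"

definition BF4a :: bool where
  "BF4a \<longleftrightarrow> (\<forall>w f1 f2 \<alpha>. BF4_input w f1 f2 \<alpha> \<longrightarrow> (\<exists>t. BF4_triple w f1 f2 \<alpha> t))"

text \<open>
  For invertible \<open>\<alpha>\<close>, the triple of (BF4a) can be found with \<open>\<beta>\<close> invertible. This is weaker than
  asking that \<open>\<beta>\<close> be invertible in every triple.
\<close>

definition BF4b :: bool where
  "BF4b \<longleftrightarrow> (\<forall>w f1 f2 \<alpha>. BF4_input w f1 f2 \<alpha> \<and> iso2 C \<alpha> \<longrightarrow>
     (\<exists>D v \<beta>. BF4_triple w f1 f2 \<alpha> (D, v, \<beta>) \<and> iso2 C \<beta>))"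

definition BF4c :: bool where
  "BF4c \<longleftrightarrow> (\<forall>w f1 f2 \<alpha> D v \<beta> D' v' \<beta>'.
     BF4_input w f1 f2 \<alpha> \<and> BF4_triple w f1 f2 \<alpha> (D, v, \<beta>) \<and> BF4_triple w f1 f2 \<alpha> (D', v', \<beta>') \<longrightarrow>
     (\<exists>E u u' \<zeta>. \<guillemotleft>u : E \<rightarrow> D\<guillemotright> \<and> \<guillemotleft>u' : E \<rightarrow> D'\<guillemotright> \<and> \<guillemotleft>\<zeta> : v \<star> u \<cong> v' \<star> u'\<guillemotright> \<and> v \<star> u \<in> W \<and>
       (([f1, v'], \<beta>', [f2, v']) \<rhd> [u']) \<odot> ([f1] \<lhd> ([v, u], \<zeta>, [v', u']))
       = ([f2] \<lhd> ([v, u], \<zeta>, [v', u'])) \<odot> (([f1, v], \<beta>, [f2, v]) \<rhd> [u])))"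

definition BF5 :: bool where
  "BF5 \<longleftrightarrow> (\<forall>w \<in> W. \<forall>v \<alpha>. \<guillemotleft>\<alpha> : v \<cong> w\<guillemotright> \<longrightarrow> v \<in> W)"

definition BF :: bool where
  "BF \<longleftrightarrow> BF1 \<and> BF2 \<and> BF3 \<and> BF4a \<and> BF4b \<and> BF4c \<and> BF5"

definition is_choiceC :: "('o, 'a, 'c) choiceC \<Rightarrow> bool" where
  "is_choiceC ch \<longleftrightarrow> (\<forall>f \<in> Arr C. \<forall>v \<in> W. Cod C f = Cod C v \<longrightarrow> BF3_square f v (ch f v))"

definition is_choiceD :: "('o, 'a, 'c) choiceD \<Rightarrow> bool" where
  "is_choiceD d \<longleftrightarrow> (\<forall>w f1 f2 \<alpha>. BF4_input w f1 f2 \<alpha> \<longrightarrow> BF4_triple w f1 f2 \<alpha> (d w f1 f2 \<alpha>))"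

end


section \<open>Morphisms and 2-morphisms of the bicategory of fractions\<close>

type_synonym ('o, 'a) frac = "'o \<times> 'a \<times> 'a"
type_synonym ('o, 'a, 'c) frac2 = "'o \<times> 'a \<times> 'a \<times> 'c \<times> 'c"

context
  fixes C :: "('o, 'a, 'c, 'm) bicat_scheme" (structure)
    and W :: "'a set"
begin

fun frac_dom :: "('o, 'a) frac \<Rightarrow> 'o" where
  "frac_dom (A', w, f) = Cod C w"

fun frac_cod :: "('o, 'a) frac \<Rightarrow> 'o" where
  "frac_cod (A', w, f) = Cod C f"

definition frac_arr :: "('o, 'a) frac set" where
  "frac_arr = {(A', w, f). w \<in> W \<and> f \<in> Arr C \<and> Dom C w = A' \<and> Dom C f = A'}"

fun frac_comp :: "('o, 'a, 'c) choiceC \<Rightarrow> ('o, 'a) frac \<Rightarrow> ('o, 'a) frac \<Rightarrow> ('o, 'a) frac" where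
  "frac_comp ch (B', v, g) (A', w, f) =
     (case ch f v of (A'', v', f', \<rho>) \<Rightarrow> (A'', w \<star> v', g \<star> f'))"

definition frac_id :: "'o \<Rightarrow> ('o, 'a) frac" where
  "frac_id A = (A, Id1 C A, Id1 C A)"

fun is_frac2 :: "('o, 'a) frac \<Rightarrow> ('o, 'a) frac \<Rightarrow> ('o, 'a, 'c) frac2 \<Rightarrow> bool" where
  "is_frac2 (A1, w1, f1) (A2, w2, f2) (A3, v1, v2, \<alpha>, \<beta>) \<longleftrightarrow>
     \<guillemotleft>v1 : A3 \<rightarrow> A1\<guillemotright> \<and> \<guillemotleft>v2 : A3 \<rightarrow> A2\<guillemotright> \<and> w1 \<star> v1 \<in> W \<and>
     \<guillemotleft>\<alpha> : w1 \<star> v1 \<cong> w2 \<star> v2\<guillemotright> \<and> \<guillemotleft>\<beta> : f1 \<star> v1 \<Rightarrow> f2 \<star> v2\<guillemotright>"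

fun equiv_frac2 ::
    "('o, 'a) frac \<Rightarrow> ('o, 'a) frac \<Rightarrow> ('o, 'a, 'c) frac2 \<Rightarrow> ('o, 'a, 'c) frac2 \<Rightarrow> bool" where
  "equiv_frac2 (A1, w1, f1) (A2, w2, f2) (A3, v1, v2, \<alpha>, \<beta>) (A3', v1', v2', \<alpha>', \<beta>') \<longleftrightarrow>
     (\<exists>A4 z z' \<sigma>1 \<sigma>2. \<guillemotleft>z : A4 \<rightarrow> A3\<guillemotright> \<and> \<guillemotleft>z' : A4 \<rightarrow> A3'\<guillemotright> \<and>
        \<guillemotleft>\<sigma>1 : v1' \<star> z' \<cong> v1 \<star> z\<guillemotright> \<and> \<guillemotleft>\<sigma>2 : v2 \<star> z \<cong> v2' \<star> z'\<guillemotright> \<and> w1 \<star> v1 \<star> z \<in> W \<and>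
        ([w2] \<lhd> ([v2, z], \<sigma>2, [v2', z'])) \<odot> (([w1, v1], \<alpha>, [w2, v2]) \<rhd> [z])
            \<odot> ([w1] \<lhd> ([v1', z'], \<sigma>1, [v1, z]))
          = ([w1, v1'], \<alpha>', [w2, v2']) \<rhd> [z'] \<and>
        ([f2] \<lhd> ([v2, z], \<sigma>2, [v2', z'])) \<odot> (([f1, v1], \<beta>, [f2, v2]) \<rhd> [z])
            \<odot> ([f1] \<lhd> ([v1', z'], \<sigma>1, [v1, z]))
          = ([f1, v1'], \<beta>', [f2, v2']) \<rhd> [z'])"

definition frac2_data :: "('o, 'a) frac \<Rightarrow> ('o, 'a) frac \<Rightarrow> ('o, 'a, 'c) frac2 set" where
  "frac2_data F1 F2 = {d. is_frac2 F1 F2 d}"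

definition frac2_rel :: "('o, 'a) frac \<Rightarrow> ('o, 'a) frac \<Rightarrow> ('o, 'a, 'c) frac2 rel" where
  "frac2_rel F1 F2 = {(d, d'). is_frac2 F1 F2 d \<and> is_frac2 F1 F2 d' \<and> equiv_frac2 F1 F2 d d'}"

definition frac2_class :: "('o, 'a) frac \<Rightarrow> ('o, 'a) frac \<Rightarrow> ('o, 'a, 'c) frac2 \<Rightarrow> ('o, 'a, 'c) frac2 set" where
  "frac2_class F1 F2 d = frac2_rel F1 F2 `` {d}"

definition frac_cell :: "(('o, 'a) frac \<times> ('o, 'a) frac \<times> ('o, 'a, 'c) frac2 set) set" where
  "frac_cell = {(F1, F2, X). F1 \<in> frac_arr \<and> F2 \<in> frac_arr \<and>
     frac_dom F1 = frac_dom F2 \<and> frac_cod F1 = frac_cod F2 \<and> X \<in> frac2_data F1 F2 // frac2_rel F1 F2}"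

fun frac_id2 :: "('o, 'a) frac \<Rightarrow> ('o, 'a, 'c) frac2" where
  "frac_id2 (A', w, f) =
     (A', Id1 C A', Id1 C A', Id2 C (w \<star> Id1 C A'), Id2 C (f \<star> Id1 C A'))"

text \<open>Representatives of the unitors \<open>id \<circ> F \<Rightarrow> F\<close> and \<open>F \<circ> id \<Rightarrow> F\<close>.\<close>

fun frac_lunit :: "('o, 'a, 'c) choiceC \<Rightarrow> ('o, 'a) frac \<Rightarrow> ('o, 'a, 'c) frac2" where
  "frac_lunit ch (A', w, f) =
     (let B = Cod C f; (A'', v', f', \<rho>) = ch f (Id1 C B)
      in (A'', Id1 C A'', v', RUnit C (w \<star> v'), inv2 C \<rho> \<bullet> RUnit C (Id1 C B \<star> f')))"

fun frac_runit :: "('o, 'a, 'c) choiceC \<Rightarrow> ('o, 'a) frac \<Rightarrow> ('o, 'a, 'c) frac2" where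
  "frac_runit ch (A', w, f) =
     (let A = Cod C w; (A'', v', f', \<rho>) = ch (Id1 C A) w
      in (A'', Id1 C A'', f', \<rho> \<bullet> RUnit C (Id1 C A \<star> v'), RUnit C (f \<star> f')))"

end


section \<open>Auxiliary data for the remaining structure\<close>

text \<open>
  For each operation, \<open>_aux\<close> says which auxiliary data are admissible, and \<open>_rep\<close> is the
  representative of the result computed from representatives of the arguments and such data.
\<close>

type_synonym ('o, 'a, 'c) vcomp_aux = "'o \<times> 'a \<times> 'a \<times> 'c"
type_synonym ('o, 'a, 'c) precomp_aux =
  "'o \<times> 'o \<times> 'o \<times> 'a \<times> 'a \<times> 'a \<times> 'a \<times> 'c \<times> 'c \<times> 'a \<times> 'a \<times> 'c \<times> 'c"
type_synonym ('o, 'a, 'c) postcomp_aux =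
  "'o \<times> 'o \<times> 'o \<times> 'a \<times> 'a \<times> 'a \<times> 'a \<times> 'c \<times> 'c \<times> 'a \<times> 'a \<times> 'c \<times> 'c"
type_synonym ('o, 'a, 'c) assoc_aux = "'o \<times> 'a \<times> 'a \<times> 'c \<times> 'c \<times> 'c"

context
  fixes C :: "('o, 'a, 'c, 'm) bicat_scheme" (structure)
    and W :: "'a set"
    and ch :: "('o, 'a, 'c) choiceC"
begin

subsection \<open>Vertical composition\<close>

fun vcomp_aux :: "('o, 'a, 'c) frac2 \<Rightarrow> ('o, 'a, 'c) frac2 \<Rightarrow> ('o, 'a, 'c) vcomp_aux \<Rightarrow> bool" where
  "vcomp_aux (A4, u1, u2, \<alpha>1, \<beta>1) (A5, u3, u4, \<alpha>2, \<beta>2) (E, t1, t2, \<rho>) \<longleftrightarrow>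
     t1 \<in> W \<and> \<guillemotleft>t1 : E \<rightarrow> A4\<guillemotright> \<and> \<guillemotleft>t2 : E \<rightarrow> A5\<guillemotright> \<and> \<guillemotleft>\<rho> : u2 \<star> t1 \<cong> u3 \<star> t2\<guillemotright>"

fun vcomp_rep :: "('o, 'a) frac \<Rightarrow> ('o, 'a) frac \<Rightarrow> ('o, 'a) frac \<Rightarrow>
    ('o, 'a, 'c) frac2 \<Rightarrow> ('o, 'a, 'c) frac2 \<Rightarrow> ('o, 'a, 'c) vcomp_aux \<Rightarrow> ('o, 'a, 'c) frac2" where
  "vcomp_rep (A1, w1, f1) (A2, w2, f2) (A3, w3, f3)
     (A4, u1, u2, \<alpha>1, \<beta>1) (A5, u3, u4, \<alpha>2, \<beta>2) (E, t1, t2, \<rho>) =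
     (E, u1 \<star> t1, u4 \<star> t2,
      the_cell ((([w2, u3], \<alpha>2, [w3, u4]) \<rhd> [t2])
        \<odot> ([w2] \<lhd> ([u2, t1], \<rho>, [u3, t2]))
        \<odot> (([w1, u1], \<alpha>1, [w2, u2]) \<rhd> [t1])),
      the_cell ((([f2, u3], \<beta>2, [f3, u4]) \<rhd> [t2])
        \<odot> ([f2] \<lhd> ([u2, t1], \<rho>, [u3, t2]))
        \<odot> (([f1, u1], \<beta>1, [f2, u2]) \<rhd> [t1])))"

subsection \<open>Composition of a 2-morphism with a morphism on the right\<close>

fun precomp_aux :: "('o, 'a) frac \<Rightarrow> ('o, 'a) frac \<Rightarrow> ('o, 'a) frac \<Rightarrow>
    ('o, 'a, 'c) frac2 \<Rightarrow> ('o, 'a, 'c) precomp_aux \<Rightarrow> bool" where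
  "precomp_aux (A', w, f) (B1, v1, g1) (B2, v2, g2) (B3, u1, u2, \<alpha>, \<beta>)
     (D3, D4, D5, t1, t2, h1, h2, \<sigma>1, \<sigma>2, t3, t4, \<phi>, \<delta>) \<longleftrightarrow>
     (case (ch f v1, ch f v2) of ((D1, w1, f1, \<rho>1), (D2, w2, f2, \<rho>2)) \<Rightarrow>
        t1 \<in> W \<and> \<guillemotleft>t1 : D3 \<rightarrow> D1\<guillemotright> \<and> t2 \<in> W \<and> \<guillemotleft>t2 : D4 \<rightarrow> D2\<guillemotright> \<and>
        \<guillemotleft>h1 : D3 \<rightarrow> B3\<guillemotright> \<and> \<guillemotleft>h2 : D4 \<rightarrow> B3\<guillemotright> \<and>
        \<guillemotleft>\<sigma>1 : f1 \<star> t1 \<cong> u1 \<star> h1\<guillemotright> \<and> \<guillemotleft>\<sigma>2 : f2 \<star> t2 \<cong> u2 \<star> h2\<guillemotright> \<and>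
        t3 \<in> W \<and> \<guillemotleft>t3 : D5 \<rightarrow> D3\<guillemotright> \<and> \<guillemotleft>t4 : D5 \<rightarrow> D4\<guillemotright> \<and>
        \<guillemotleft>\<phi> : w1 \<star> t1 \<star> t3 \<cong> w2 \<star> t2 \<star> t4\<guillemotright> \<and> \<guillemotleft>\<delta> : h1 \<star> t3 \<cong> h2 \<star> t4\<guillemotright> \<and>
        [v1, u1] \<lhd> ([h1, t3], \<delta>, [h2, t4])
        = (sinv C ([v1, u1], \<alpha>, [v2, u2]) \<rhd> [h2, t4])
          \<odot> ([v2] \<lhd> ([f2, t2], \<sigma>2, [u2, h2]) \<rhd> [t4])
          \<odot> (([f, w2], \<rho>2, [v2, f2]) \<rhd> [t2, t4])
          \<odot> ([f] \<lhd> ([w1, t1, t3], \<phi>, [w2, t2, t4]))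
          \<odot> (sinv C ([f, w1], \<rho>1, [v1, f1]) \<rhd> [t1, t3])
          \<odot> ([v1] \<lhd> sinv C ([f1, t1], \<sigma>1, [u1, h1]) \<rhd> [t3]))"

fun precomp_rep :: "('o, 'a) frac \<Rightarrow> ('o, 'a) frac \<Rightarrow> ('o, 'a) frac \<Rightarrow>
    ('o, 'a, 'c) frac2 \<Rightarrow> ('o, 'a, 'c) precomp_aux \<Rightarrow> ('o, 'a, 'c) frac2" where
  "precomp_rep (A', w, f) (B1, v1, g1) (B2, v2, g2) (B3, u1, u2, \<alpha>, \<beta>)
     (D3, D4, D5, t1, t2, h1, h2, \<sigma>1, \<sigma>2, t3, t4, \<phi>, \<delta>) =
     (case (ch f v1, ch f v2) of ((D1, w1, f1, \<rho>1), (D2, w2, f2, \<rho>2)) \<Rightarrow>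
       (D5, t1 \<star> t3, t2 \<star> t4,
        the_cell ((join C [w, w2] \<rhd> [t2, t4])
          \<odot> ([w] \<lhd> ([w1, t1, t3], \<phi>, [w2, t2, t4]))
          \<odot> (split C [w, w1] \<rhd> [t1, t3])),
        the_cell ((join C [g2, f2] \<rhd> [t2, t4])
          \<odot> ([g2] \<lhd> sinv C ([f2, t2], \<sigma>2, [u2, h2]) \<rhd> [t4])
          \<odot> (([g1, u1], \<beta>, [g2, u2]) \<rhd> [h2, t4])
          \<odot> ([g1, u1] \<lhd> ([h1, t3], \<delta>, [h2, t4]))
          \<odot> ([g1] \<lhd> ([f1, t1], \<sigma>1, [u1, h1]) \<rhd> [t3])
          \<odot> (split C [g1, f1] \<rhd> [t1, t3]))))"

subsection \<open>Composition of a 2-morphism with a morphism on the left\<close>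

fun postcomp_aux :: "('o, 'a) frac \<Rightarrow> ('o, 'a) frac \<Rightarrow> ('o, 'a) frac \<Rightarrow>
    ('o, 'a, 'c) frac2 \<Rightarrow> ('o, 'a, 'c) postcomp_aux \<Rightarrow> bool" where
  "postcomp_aux (B', u, g) (A1, w1, f1) (A2, w2, f2) (A3, v1, v2, \<alpha>, \<beta>)
     (D3, D4, D5, u3, u4, u5, u6, \<eta>1, \<eta>2, u7, u8, \<eta>3, lam) \<longleftrightarrow>
     (case (ch f1 u, ch f2 u) of ((D1, u1, h1, \<rho>1), (D2, u2, h2, \<rho>2)) \<Rightarrow>
        u3 \<in> W \<and> \<guillemotleft>u3 : D3 \<rightarrow> A3\<guillemotright> \<and> u5 \<in> W \<and> \<guillemotleft>u5 : D4 \<rightarrow> A3\<guillemotright> \<and>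
        \<guillemotleft>u4 : D3 \<rightarrow> D1\<guillemotright> \<and> \<guillemotleft>u6 : D4 \<rightarrow> D2\<guillemotright> \<and>
        \<guillemotleft>\<eta>1 : v1 \<star> u3 \<cong> u1 \<star> u4\<guillemotright> \<and> \<guillemotleft>\<eta>2 : v2 \<star> u5 \<cong> u2 \<star> u6\<guillemotright> \<and>
        u7 \<in> W \<and> \<guillemotleft>u7 : D5 \<rightarrow> D3\<guillemotright> \<and> \<guillemotleft>u8 : D5 \<rightarrow> D4\<guillemotright> \<and> \<guillemotleft>\<eta>3 : u3 \<star> u7 \<cong> u5 \<star> u8\<guillemotright> \<and>
        \<guillemotleft>lam : h1 \<star> u4 \<star> u7 \<Rightarrow> h2 \<star> u6 \<star> u8\<guillemotright> \<and>
        [u] \<lhd> ([h1, u4, u7], lam, [h2, u6, u8])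
        = (([f2, u2], \<rho>2, [u, h2]) \<rhd> [u6, u8])
          \<odot> ([f2] \<lhd> ([v2, u5], \<eta>2, [u2, u6]) \<rhd> [u8])
          \<odot> ([f2, v2] \<lhd> ([u3, u7], \<eta>3, [u5, u8]))
          \<odot> (([f1, v1], \<beta>, [f2, v2]) \<rhd> [u3, u7])
          \<odot> ([f1] \<lhd> sinv C ([v1, u3], \<eta>1, [u1, u4]) \<rhd> [u7])
          \<odot> (sinv C ([f1, u1], \<rho>1, [u, h1]) \<rhd> [u4, u7]))"

fun postcomp_rep :: "('o, 'a) frac \<Rightarrow> ('o, 'a) frac \<Rightarrow> ('o, 'a) frac \<Rightarrow>
    ('o, 'a, 'c) frac2 \<Rightarrow> ('o, 'a, 'c) postcomp_aux \<Rightarrow> ('o, 'a, 'c) frac2" where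
  "postcomp_rep (B', u, g) (A1, w1, f1) (A2, w2, f2) (A3, v1, v2, \<alpha>, \<beta>)
     (D3, D4, D5, u3, u4, u5, u6, \<eta>1, \<eta>2, u7, u8, \<eta>3, lam) =
     (case (ch f1 u, ch f2 u) of ((D1, u1, h1, \<rho>1), (D2, u2, h2, \<rho>2)) \<Rightarrow>
       (D5, u4 \<star> u7, u6 \<star> u8,
        the_cell ((join C [w2, u2] \<rhd> [u6, u8])
          \<odot> ([w2] \<lhd> ([v2, u5], \<eta>2, [u2, u6]) \<rhd> [u8])
          \<odot> ([w2, v2] \<lhd> ([u3, u7], \<eta>3, [u5, u8]))
          \<odot> (([w1, v1], \<alpha>, [w2, v2]) \<rhd> [u3, u7])
          \<odot> ([w1] \<lhd> sinv C ([v1, u3], \<eta>1, [u1, u4]) \<rhd> [u7])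
          \<odot> (split C [w1, u1] \<rhd> [u4, u7])),
        the_cell ((join C [g, h2] \<rhd> [u6, u8])
          \<odot> ([g] \<lhd> ([h1, u4, u7], lam, [h2, u6, u8]))
          \<odot> (split C [g, h1] \<rhd> [u4, u7]))))"

subsection \<open>Associator\<close>

fun assoc_aux :: "('o, 'a) frac \<Rightarrow> ('o, 'a) frac \<Rightarrow> ('o, 'a) frac \<Rightarrow>
    ('o, 'a, 'c) assoc_aux \<Rightarrow> bool" where
  "assoc_aux (C', w, h) (B', v, g) (A', u, f) (A4, u4, u5, \<gamma>, \<omega>, \<rho>) \<longleftrightarrow>
     (case ch f v of (A1, u1, f1, \<delta>) \<Rightarrow>
      case ch (g \<star> f1) w of (A2, u2, l, \<sigma>) \<Rightarrow>
      case ch g w of (B2, v1, g1, \<xi>) \<Rightarrow>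
      case ch f (v \<star> v1) of (A3, u3, f2, \<eta>) \<Rightarrow>
        \<guillemotleft>u4 : A4 \<rightarrow> A2\<guillemotright> \<and> u \<star> u1 \<star> u2 \<star> u4 \<in> W \<and> \<guillemotleft>u5 : A4 \<rightarrow> A3\<guillemotright> \<and>
        \<guillemotleft>\<gamma> : u1 \<star> u2 \<star> u4 \<cong> u3 \<star> u5\<guillemotright> \<and>
        \<guillemotleft>\<omega> : f1 \<star> u2 \<star> u4 \<cong> v1 \<star> f2 \<star> u5\<guillemotright> \<and>
        \<guillemotleft>\<rho> : l \<star> u4 \<cong> g1 \<star> f2 \<star> u5\<guillemotright> \<and>
        [v] \<lhd> ([f1, u2, u4], \<omega>, [v1, f2, u5])
        = (split C [v, v1] \<rhd> [f2, u5])
          \<odot> (([f, u3], \<eta>, [v \<star> v1, f2]) \<rhd> [u5])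
          \<odot> ([f] \<lhd> ([u1, u2, u4], \<gamma>, [u3, u5]))
          \<odot> (sinv C ([f, u1], \<delta>, [v, f1]) \<rhd> [u2, u4]) \<and>
        [w] \<lhd> ([l, u4], \<rho>, [g1, f2, u5])
        = (([g, v1], \<xi>, [w, g1]) \<rhd> [f2, u5])
          \<odot> ([g] \<lhd> ([f1, u2, u4], \<omega>, [v1, f2, u5]))
          \<odot> (split C [g, f1] \<rhd> [u2, u4])
          \<odot> (sinv C ([g \<star> f1, u2], \<sigma>, [w, l]) \<rhd> [u4]))"

fun assoc_rep :: "('o, 'a) frac \<Rightarrow> ('o, 'a) frac \<Rightarrow> ('o, 'a) frac \<Rightarrow>
    ('o, 'a, 'c) assoc_aux \<Rightarrow> ('o, 'a, 'c) frac2" where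
  "assoc_rep (C', w, h) (B', v, g) (A', u, f) (A4, u4, u5, \<gamma>, \<omega>, \<rho>) =
     (case ch f v of (A1, u1, f1, \<delta>) \<Rightarrow>
      case ch (g \<star> f1) w of (A2, u2, l, \<sigma>) \<Rightarrow>
      case ch g w of (B2, v1, g1, \<xi>) \<Rightarrow>
      case ch f (v \<star> v1) of (A3, u3, f2, \<eta>) \<Rightarrow>
       (A4, u4, u5,
        the_cell ((join C [u, u3] \<rhd> [u5])
          \<odot> ([u] \<lhd> ([u1, u2, u4], \<gamma>, [u3, u5]))
          \<odot> (split C [u, u1] \<rhd> [u2, u4])
          \<odot> (split C [u \<star> u1, u2] \<rhd> [u4])),
        the_cell ((join C [h \<star> g1, f2] \<rhd> [u5])
          \<odot> (join C [h, g1] \<rhd> [f2, u5])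
          \<odot> ([h] \<lhd> ([l, u4], \<rho>, [g1, f2, u5]))
          \<odot> (split C [h, l] \<rhd> [u4]))))"

end


section \<open>The bicategory of fractions\<close>

text \<open>
  A selection fixes the auxiliary data used by each operation. Selecting them by means of \<open>C(W)\<close> and
  \<open>D(W)\<close> is a rule that turns any two such sets of choices into a selection of admissible data;
  the rule is a parameter of the construction, and no property of it beyond admissibility is used.
\<close>

record ('o, 'a, 'c) selection =
  sel_vcomp :: "('o, 'a) frac \<Rightarrow> ('o, 'a) frac \<Rightarrow> ('o, 'a) frac \<Rightarrow>
    ('o, 'a, 'c) frac2 \<Rightarrow> ('o, 'a, 'c) frac2 \<Rightarrow> ('o, 'a, 'c) vcomp_aux"
  sel_precomp :: "('o, 'a) frac \<Rightarrow> ('o, 'a) frac \<Rightarrow> ('o, 'a) frac \<Rightarrow>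
    ('o, 'a, 'c) frac2 \<Rightarrow> ('o, 'a, 'c) precomp_aux"
  sel_postcomp :: "('o, 'a) frac \<Rightarrow> ('o, 'a) frac \<Rightarrow> ('o, 'a) frac \<Rightarrow>
    ('o, 'a, 'c) frac2 \<Rightarrow> ('o, 'a, 'c) postcomp_aux"
  sel_assoc :: "('o, 'a) frac \<Rightarrow> ('o, 'a) frac \<Rightarrow> ('o, 'a) frac \<Rightarrow> ('o, 'a, 'c) assoc_aux"

type_synonym ('o, 'a, 'c) selection_rule =
  "('o, 'a, 'c) choiceC \<Rightarrow> ('o, 'a, 'c) choiceD \<Rightarrow> ('o, 'a, 'c) selection"

context
  fixes C :: "('o, 'a, 'c, 'm) bicat_scheme" (structure)
    and W :: "'a set"
begin

definition is_selection :: "('o, 'a, 'c) choiceC \<Rightarrow> ('o, 'a, 'c) selection \<Rightarrow> bool" where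
  "is_selection ch S \<longleftrightarrow>
     (\<forall>F1 \<in> frac_arr C W. \<forall>F2 \<in> frac_arr C W. \<forall>F3 \<in> frac_arr C W.
        \<forall>d1 \<in> frac2_data C W F1 F2. \<forall>d2 \<in> frac2_data C W F2 F3.
        vcomp_aux C W d1 d2 (sel_vcomp S F1 F2 F3 d1 d2)) \<and>
     (\<forall>F \<in> frac_arr C W. \<forall>G1 \<in> frac_arr C W. \<forall>G2 \<in> frac_arr C W.
        \<forall>d \<in> frac2_data C W G1 G2. frac_cod C F = frac_dom C G1 \<longrightarrow>
        precomp_aux C W ch F G1 G2 d (sel_precomp S F G1 G2 d)) \<and>
     (\<forall>G \<in> frac_arr C W. \<forall>F1 \<in> frac_arr C W. \<forall>F2 \<in> frac_arr C W.
        \<forall>d \<in> frac2_data C W F1 F2. frac_cod C F1 = frac_dom C G \<longrightarrow>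
        postcomp_aux C W ch G F1 F2 d (sel_postcomp S G F1 F2 d)) \<and>
     (\<forall>H \<in> frac_arr C W. \<forall>G \<in> frac_arr C W. \<forall>F \<in> frac_arr C W.
        frac_cod C F = frac_dom C G \<and> frac_cod C G = frac_dom C H \<longrightarrow>
        assoc_aux C W ch H G F (sel_assoc S H G F))"

definition is_selection_rule :: "('o, 'a, 'c) selection_rule \<Rightarrow> bool" where
  "is_selection_rule R \<longleftrightarrow>
     (\<forall>ch d. is_choiceC C W ch \<and> is_choiceD C W d \<longrightarrow> is_selection ch (R ch d))"

text \<open>
  Operations on classes are obtained from operations on representatives by taking the union of the
  resulting classes over all representatives, as in \<^theory>\<open>HOL.Equiv_Relations\<close>.
\<close>

definition class_vcomp :: "('o, 'a, 'c) selection \<Rightarrow>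
    ('o, 'a) frac \<Rightarrow> ('o, 'a) frac \<Rightarrow> ('o, 'a) frac \<Rightarrow>
    ('o, 'a, 'c) frac2 set \<Rightarrow> ('o, 'a, 'c) frac2 set \<Rightarrow> ('o, 'a, 'c) frac2 set" where
  "class_vcomp S F1 F2 F3 Y X =
     (\<Union>d2 \<in> Y. \<Union>d1 \<in> X. frac2_class C W F1 F3
        (vcomp_rep C F1 F2 F3 d1 d2 (sel_vcomp S F1 F2 F3 d1 d2)))"

definition class_precomp :: "('o, 'a, 'c) choiceC \<Rightarrow> ('o, 'a, 'c) selection \<Rightarrow>
    ('o, 'a) frac \<Rightarrow> ('o, 'a) frac \<Rightarrow> ('o, 'a) frac \<Rightarrow>
    ('o, 'a, 'c) frac2 set \<Rightarrow> ('o, 'a, 'c) frac2 set" where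
  "class_precomp ch S F G1 G2 Y =
     (\<Union>d \<in> Y. frac2_class C W (frac_comp C ch G1 F) (frac_comp C ch G2 F)
        (precomp_rep C ch F G1 G2 d (sel_precomp S F G1 G2 d)))"

definition class_postcomp :: "('o, 'a, 'c) choiceC \<Rightarrow> ('o, 'a, 'c) selection \<Rightarrow>
    ('o, 'a) frac \<Rightarrow> ('o, 'a) frac \<Rightarrow> ('o, 'a) frac \<Rightarrow>
    ('o, 'a, 'c) frac2 set \<Rightarrow> ('o, 'a, 'c) frac2 set" where
  "class_postcomp ch S G F1 F2 X =
     (\<Union>d \<in> X. frac2_class C W (frac_comp C ch G F1) (frac_comp C ch G F2)
        (postcomp_rep C ch G F1 F2 d (sel_postcomp S G F1 F2 d)))"

definition class_hcomp :: "('o, 'a, 'c) choiceC \<Rightarrow> ('o, 'a, 'c) selection \<Rightarrow>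
    ('o, 'a) frac \<Rightarrow> ('o, 'a) frac \<Rightarrow> ('o, 'a) frac \<Rightarrow> ('o, 'a) frac \<Rightarrow>
    ('o, 'a, 'c) frac2 set \<Rightarrow> ('o, 'a, 'c) frac2 set \<Rightarrow> ('o, 'a, 'c) frac2 set" where
  "class_hcomp ch S G1 G2 F1 F2 Y X =
     class_vcomp S (frac_comp C ch G1 F1) (frac_comp C ch G1 F2) (frac_comp C ch G2 F2)
       (class_precomp ch S F2 G1 G2 Y) (class_postcomp ch S G1 F1 F2 X)"

definition class_assoc :: "('o, 'a, 'c) choiceC \<Rightarrow> ('o, 'a, 'c) selection \<Rightarrow>
    ('o, 'a) frac \<Rightarrow> ('o, 'a) frac \<Rightarrow> ('o, 'a) frac \<Rightarrow> ('o, 'a, 'c) frac2 set" where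
  "class_assoc ch S H G F =
     frac2_class C W (frac_comp C ch H (frac_comp C ch G F)) (frac_comp C ch (frac_comp C ch H G) F)
       (assoc_rep C ch H G F (sel_assoc S H G F))"

text \<open>
  A 2-morphism carries its source and target. The operations that use the auxiliary data are
  \<open>undefined\<close> on arguments that are not composable, so that equality of records compares them
  exactly where they are meaningful.
\<close>

definition fractions_of_selection :: "('o, 'a, 'c) choiceC \<Rightarrow> ('o, 'a, 'c) selection \<Rightarrow>
    ('o, ('o, 'a) frac, ('o, 'a) frac \<times> ('o, 'a) frac \<times> ('o, 'a, 'c) frac2 set) bicat" where
  "fractions_of_selection ch S = \<lparr>
     Obj = Obj C,
     Arr = frac_arr C W,
     Dom = frac_dom C,
     Cod = frac_cod C,
     Cell = frac_cell C W,
     Src = (\<lambda>(F1, F2, X). F1),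
     Tgt = (\<lambda>(F1, F2, X). F2),
     Id1 = frac_id C,
     Comp1 = frac_comp C ch,
     Id2 = (\<lambda>F. (F, F, frac2_class C W F F (frac_id2 C F))),
     VComp = (\<lambda>(F2', F3, Y) (F1, F2, X).
       if (F1, F2, X) \<in> frac_cell C W \<and> (F2', F3, Y) \<in> frac_cell C W \<and> F2 = F2'
       then (F1, F3, class_vcomp S F1 F2 F3 Y X) else undefined),
     HComp = (\<lambda>(G1, G2, Y) (F1, F2, X).
       if (F1, F2, X) \<in> frac_cell C W \<and> (G1, G2, Y) \<in> frac_cell C W
          \<and> frac_cod C F1 = frac_dom C G1
       then (frac_comp C ch G1 F1, frac_comp C ch G2 F2, class_hcomp ch S G1 G2 F1 F2 Y X)
       else undefined),
     Assoc = (\<lambda>H G F.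
       if F \<in> frac_arr C W \<and> G \<in> frac_arr C W \<and> H \<in> frac_arr C W
          \<and> frac_cod C F = frac_dom C G \<and> frac_cod C G = frac_dom C H
       then (frac_comp C ch H (frac_comp C ch G F), frac_comp C ch (frac_comp C ch H G) F,
             class_assoc ch S H G F)
       else undefined),
     LUnit = (\<lambda>F. let F' = frac_comp C ch (frac_id C (frac_cod C F)) F
       in (F', F, frac2_class C W F' F (frac_lunit C ch F))),
     RUnit = (\<lambda>F. let F' = frac_comp C ch F (frac_id C (frac_dom C F))
       in (F', F, frac2_class C W F' F (frac_runit C ch F)))
   \<rparr>"

definition bicat_of_fractions :: "('o, 'a, 'c) selection_rule \<Rightarrow>
    ('o, 'a, 'c) choiceC \<Rightarrow> ('o, 'a, 'c) choiceD \<Rightarrow>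
    ('o, ('o, 'a) frac, ('o, 'a) frac \<times> ('o, 'a) frac \<times> ('o, 'a, 'c) frac2 set) bicat" where
  "bicat_of_fractions R ch d = fractions_of_selection ch (R ch d)"

end

end

theory Submission
  imports Defs
begin

text \<open>
  The computations take place in the strictification, which is a strict 2-category: by the pentagon,
  whiskering on the right is compatible with concatenation of lists. For fixed representatives, two
  admissible sets of auxiliary data have a common refinement. Indeed (BF3) completes a pair of legs in
  \<open>W\<close> to a square, and (BF4b) lifts the comparison of the other legs along elements of \<open>W\<close>, after a
  further refinement. An equation of 2-cells that is only known after whiskering on the left by an
  element of \<open>W\<close> becomes true after a further refinement, by (BF4c); this makes the 2-cells \<open>\<delta>\<close>, \<open>\<lambda>\<close>,
  \<open>\<omega>\<close> and \<open>\<rho>\<close>, which are determined by such equations, compatible with the comparison. Hence the two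
  results are equivalent, whatever choices in \<open>D(W)\<close> led to the data.
\<close>

text \<open>The obstacle is that most legs of the data lie outside \<open>W\<close>. A refinement
  can be chosen freely only over a leg in \<open>W\<close>; every other comparison has to be
  transported from there through the invertible 2-cells of the data. Each transport may cost a
  further refinement, which must not destroy the comparisons already made. A comparison is therefore
  stored as a square, \<open>csq\<close>, which survives restriction and can be pasted in both
  directions. The composites that define the results are then compared factor by factor.

  A 2-cell can be lifted along a leg \<open>u\<close> outside \<open>W\<close> as soon as some
  \<open>h\<close> in \<open>W\<close> has its composite with \<open>u\<close> in \<open>W\<close>:
  lift along the composite, then strip \<open>h\<close> off by faithfulness. The legs of
  representatives are of this kind, since only \<open>w1 \<star> v1\<close> is required to be in
  \<open>W\<close>.

  To conclude that classes are equal, and not only that two representatives are related, symmetry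
  and transitivity of the relation are proved with the same squares.\<close>

context bicategory
begin

section \<open>Coherence isomorphisms\<close>

lemma comp1_simps [simp]:
  assumes "f \<in> Arr C" "g \<in> Arr C" "Cod C f = Dom C g"
  shows "g \<star> f \<in> Arr C" "Dom C (g \<star> f) = Dom C f" "Cod C (g \<star> f) = Cod C g"
  using comp1[of f "Dom C f" "Cod C f" g "Cod C g"] assms by (auto simp: in_hom1_def)

lemma Id1_simps [simp]:
  assumes "A \<in> Obj C"
  shows "Id1 C A \<in> Arr C" "Dom C (Id1 C A) = A" "Cod C (Id1 C A) = A"
  using id1[OF assms] by (auto simp: in_hom1_def)

lemma cell_simps [simp]:
  assumes "x \<in> Cell C"
  shows "Src C x \<in> Arr C" "Tgt C x \<in> Arr C"
    "Dom C (Tgt C x) = Dom C (Src C x)" "Cod C (Tgt C x) = Cod C (Src C x)"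
  using cell_arr[OF assms] by auto

lemma Id2_simps [simp]:
  assumes "f \<in> Arr C"
  shows "Id2 C f \<in> Cell C" "Src C (Id2 C f) = f" "Tgt C (Id2 C f) = f"
  using id2[OF assms] by (auto simp: in_hom2_def)

lemma vcomp_simps [simp]:
  assumes "x \<in> Cell C" "y \<in> Cell C" "Src C y = Tgt C x"
  shows "y \<bullet> x \<in> Cell C" "Src C (y \<bullet> x) = Src C x" "Tgt C (y \<bullet> x) = Tgt C y"
  using vcomp[of x "Src C x" "Tgt C x" y "Tgt C y"] assms by (auto simp: in_hom2_def)

lemma vcomp_Id2 [simp]: "x \<in> Cell C \<Longrightarrow> Src C x = f \<Longrightarrow> x \<bullet> Id2 C f = x"
  using vcomp_id[of x f] by (simp add: in_hom2_def)

lemma Id2_vcomp [simp]: "x \<in> Cell C \<Longrightarrow> Tgt C x = f \<Longrightarrow> Id2 C f \<bullet> x = x"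
  using id_vcomp[of x _ f] by (simp add: in_hom2_def)

lemma vcomp_assoc_simp [simp]:
  assumes "x \<in> Cell C" "y \<in> Cell C" "z \<in> Cell C" "Src C y = Tgt C x" "Src C z = Tgt C y"
  shows "(z \<bullet> y) \<bullet> x = z \<bullet> y \<bullet> x"
  using vcomp_assoc[of x "Src C x" "Tgt C x" y "Tgt C y" z "Tgt C z"] assms by (simp add: in_hom2_def)

lemma hcomp_simps [simp]:
  assumes "x \<in> Cell C" "y \<in> Cell C" "Cod C (Src C x) = Dom C (Src C y)"
  shows "y \<diamondop> x \<in> Cell C" "Src C (y \<diamondop> x) = Src C y \<star> Src C x" "Tgt C (y \<diamondop> x) = Tgt C y \<star> Tgt C x"
  using hcomp[of x "Src C x" "Tgt C x" y "Src C y" "Tgt C y"] assms by (auto simp: in_hom2_def)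

lemma hcomp_Id2 [simp]:
  assumes "f \<in> Arr C" "g \<in> Arr C" "Cod C f = Dom C g"
  shows "Id2 C g \<diamondop> Id2 C f = Id2 C (g \<star> f)"
  using hcomp_id[of f "Dom C f" "Cod C f" g "Cod C g"] assms by (simp add: in_hom1_def)

lemma interchange_simp:
  assumes "x \<in> Cell C" "x' \<in> Cell C" "Src C x' = Tgt C x"
    "y \<in> Cell C" "y' \<in> Cell C" "Src C y' = Tgt C y" "Cod C (Src C x) = Dom C (Src C y)"
  shows "(y' \<bullet> y) \<diamondop> (x' \<bullet> x) = (y' \<diamondop> x') \<bullet> (y \<diamondop> x)"
  using interchange[of x "Src C x" "Tgt C x" x' "Tgt C x'" y "Src C y" "Tgt C y" y' "Tgt C y'"] assms
  by (simp add: in_hom2_def)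

lemma lwhisk_vcomp:
  assumes "x \<in> Cell C" "x' \<in> Cell C" "Src C x' = Tgt C x" "g \<in> Arr C" "Cod C (Src C x) = Dom C g"
  shows "Id2 C g \<diamondop> (x' \<bullet> x) = (Id2 C g \<diamondop> x') \<bullet> (Id2 C g \<diamondop> x)"
  using interchange_simp[of x x' "Id2 C g" "Id2 C g"] assms by simp

lemma rwhisk_vcomp:
  assumes "y \<in> Cell C" "y' \<in> Cell C" "Src C y' = Tgt C y" "f \<in> Arr C" "Cod C f = Dom C (Src C y)"
  shows "(y' \<bullet> y) \<diamondop> Id2 C f = (y' \<diamondop> Id2 C f) \<bullet> (y \<diamondop> Id2 C f)"
  using interchange_simp[of "Id2 C f" "Id2 C f" y y'] assms by simp

lemma Assoc_simps [simp]:
  assumes "f \<in> Arr C" "g \<in> Arr C" "h \<in> Arr C" "Cod C f = Dom C g" "Cod C g = Dom C h"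
  shows "Assoc C h g f \<in> Cell C" "Src C (Assoc C h g f) = h \<star> g \<star> f"
    "Tgt C (Assoc C h g f) = (h \<star> g) \<star> f" "iso2 C (Assoc C h g f)"
  using assoc[of f "Dom C f" "Cod C f" g "Cod C g" h "Cod C h"] assms
  by (auto simp: in_hom1_def in_hom2_def)

lemma Assoc_natural:
  assumes "x \<in> Cell C" "y \<in> Cell C" "z \<in> Cell C"
    "Cod C (Src C x) = Dom C (Src C y)" "Cod C (Src C y) = Dom C (Src C z)"
  shows "Assoc C (Tgt C z) (Tgt C y) (Tgt C x) \<bullet> (z \<diamondop> y \<diamondop> x)
    = ((z \<diamondop> y) \<diamondop> x) \<bullet> Assoc C (Src C z) (Src C y) (Src C x)"
  using assoc_natural[of x "Src C x" "Tgt C x" y "Src C y" "Tgt C y" z "Src C z" "Tgt C z"] assms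
  by (simp add: in_hom2_def)

section \<open>Inverses of 2-morphisms\<close>

lemma inverse2_unique:
  assumes "x \<in> Cell C" "inverse2 C x y" "inverse2 C x y'"
  shows "y = y'"
proof -
  have "y = y \<bullet> x \<bullet> y'"
    using assms by (simp add: inverse2_def in_hom2_def)
  also have "\<dots> = y'"
    using assms vcomp_assoc_simp[of y' x y] by (simp add: inverse2_def in_hom2_def)
  finally show ?thesis .
qed

lemma iso2_inverse2:
  assumes "iso2 C x"
  shows "inverse2 C x (inv2 C x)"
proof -
  obtain y where x: "x \<in> Cell C" and y: "inverse2 C x y"
    using assms unfolding iso2_def by blast
  have "inv2 C x = y"
    unfolding inv2_def by (rule the_equality[where P = "inverse2 C x", OF y]) (rule inverse2_unique[OF x _ y])
  with y show ?thesis by simp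
qed

lemma iso2_Cell: "iso2 C x \<Longrightarrow> x \<in> Cell C"
  by (simp add: iso2_def)

lemma inv2_simps [simp]:
  assumes "iso2 C x"
  shows "inv2 C x \<in> Cell C" "Src C (inv2 C x) = Tgt C x" "Tgt C (inv2 C x) = Src C x"
    "inv2 C x \<bullet> x = Id2 C (Src C x)" "x \<bullet> inv2 C x = Id2 C (Tgt C x)"
  using iso2_inverse2[OF assms] iso2_Cell[OF assms] by (auto simp: inverse2_def in_hom2_def)

lemma inv2_vcomp_cancel [simp]:
  assumes "iso2 C x" "y \<in> Cell C"
  shows "Tgt C y = Src C x \<Longrightarrow> inv2 C x \<bullet> x \<bullet> y = y" "Tgt C y = Tgt C x \<Longrightarrow> x \<bullet> inv2 C x \<bullet> y = y"
proof -
  show "inv2 C x \<bullet> x \<bullet> y = y" if "Tgt C y = Src C x"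
    using that assms iso2_Cell[OF assms(1)] by (subst vcomp_assoc_simp[symmetric]) simp_all
  show "x \<bullet> inv2 C x \<bullet> y = y" if "Tgt C y = Tgt C x"
    using that assms iso2_Cell[OF assms(1)] by (subst vcomp_assoc_simp[symmetric]) simp_all
qed

lemma iso2I:
  assumes "x \<in> Cell C" "y \<in> Cell C" "Src C y = Tgt C x" "Tgt C y = Src C x"
    "y \<bullet> x = Id2 C (Src C x)" "x \<bullet> y = Id2 C (Tgt C x)"
  shows "iso2 C x" "inv2 C x = y"
proof -
  have y: "inverse2 C x y"
    using assms by (auto simp: inverse2_def in_hom2_def)
  then show "iso2 C x"
    using assms by (auto simp: iso2_def)
  with y show "inv2 C x = y"
    using inverse2_unique[OF assms(1) iso2_inverse2] by blast
qed

lemma iso2_Id2 [simp]: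
  assumes "f \<in> Arr C"
  shows "iso2 C (Id2 C f)" "inv2 C (Id2 C f) = Id2 C f"
  using iso2I[of "Id2 C f" "Id2 C f"] assms by simp_all

lemma iso2_inv2 [simp]:
  assumes "iso2 C x"
  shows "iso2 C (inv2 C x)" "inv2 C (inv2 C x) = x"
  using iso2I[of "inv2 C x" x] iso2_Cell[OF assms] assms by simp_all

lemma iso2_vcomp [simp]:
  assumes "iso2 C x" "iso2 C y" "Src C y = Tgt C x"
  shows "iso2 C (y \<bullet> x)" "inv2 C (y \<bullet> x) = inv2 C x \<bullet> inv2 C y"
  using iso2I[of "y \<bullet> x" "inv2 C x \<bullet> inv2 C y"] assms iso2_Cell[OF assms(1)] iso2_Cell[OF assms(2)] by simp_all

lemma iso2_hcomp [simp]:
  assumes "iso2 C x" "iso2 C y" "Cod C (Src C x) = Dom C (Src C y)"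
  shows "iso2 C (y \<diamondop> x)" "inv2 C (y \<diamondop> x) = inv2 C y \<diamondop> inv2 C x"
  using iso2I[of "y \<diamondop> x" "inv2 C y \<diamondop> inv2 C x"] assms iso2_Cell[OF assms(1)] iso2_Cell[OF assms(2)] by (simp_all flip: interchange_simp)

text \<open>The coherence cells \<open>coh\<close> are built from inverse associators, while the
  axioms speak of associators. Composing with inverses at both ends moves the isomorphisms across an
  equation: this version has the shape of the pentagon, \<open>iso2_transpose'\<close> that of a
  naturality square.\<close>

lemma iso2_transpose:
  assumes p: "iso2 C p" and q: "iso2 C q" and e: "iso2 C e" and rs: "r \<in> Cell C" "s \<in> Cell C"
    and pq: "Src C p = Tgt C q" and qr: "Src C q = Tgt C r" and se: "Src C s = Tgt C e"
    and re: "Src C r = Src C e" and ps: "Tgt C p = Tgt C s"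
    and eq: "p \<bullet> q \<bullet> r = s \<bullet> e"
  shows "inv2 C q \<bullet> inv2 C p \<bullet> s = r \<bullet> inv2 C e"
proof -
  note [simp] = iso2_Cell[OF p] iso2_Cell[OF q] iso2_Cell[OF e] rs p q e pq qr se re ps
  have "inv2 C q \<bullet> inv2 C p \<bullet> s = inv2 C q \<bullet> inv2 C p \<bullet> (s \<bullet> e) \<bullet> inv2 C e"
    by simp
  also have "\<dots> = inv2 C q \<bullet> inv2 C p \<bullet> (p \<bullet> q \<bullet> r) \<bullet> inv2 C e"
    by (simp only: eq)
  also have "\<dots> = r \<bullet> inv2 C e"
    by simp
  finally show ?thesis .
qed

lemma iso2_transpose':
  assumes p: "iso2 C p" and e: "iso2 C e" and rs: "r \<in> Cell C" "s \<in> Cell C"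
    and pr: "Src C p = Tgt C r" and se: "Src C s = Tgt C e"
    and re: "Src C r = Src C e" and ps: "Tgt C p = Tgt C s"
    and eq: "p \<bullet> r = s \<bullet> e"
  shows "inv2 C p \<bullet> s = r \<bullet> inv2 C e"
proof -
  note [simp] = iso2_Cell[OF p] iso2_Cell[OF e] rs p e pr se re ps
  have "inv2 C p \<bullet> s = inv2 C p \<bullet> (s \<bullet> e) \<bullet> inv2 C e"
    by simp
  also have "\<dots> = inv2 C p \<bullet> (p \<bullet> r) \<bullet> inv2 C e"
    by (simp only: eq)
  also have "\<dots> = r \<bullet> inv2 C e"
    by simp
  finally show ?thesis .
qed

lemma inv2_Assoc_natural:
  assumes "x \<in> Cell C" "y \<in> Cell C" "z \<in> Cell C"
    "Cod C (Src C x) = Dom C (Src C y)" "Cod C (Src C y) = Dom C (Src C z)"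
  shows "inv2 C (Assoc C (Tgt C z) (Tgt C y) (Tgt C x)) \<bullet> ((z \<diamondop> y) \<diamondop> x)
    = (z \<diamondop> y \<diamondop> x) \<bullet> inv2 C (Assoc C (Src C z) (Src C y) (Src C x))"
  by (rule iso2_transpose') (use assms Assoc_natural[OF assms] in simp_all)

lemma inv2_pentagon:
  assumes "f \<in> Arr C" "g \<in> Arr C" "h \<in> Arr C" "k \<in> Arr C"
    "Cod C f = Dom C g" "Cod C g = Dom C h" "Cod C h = Dom C k"
  shows "inv2 C (Assoc C k (h \<star> g) f) \<bullet> (inv2 C (Assoc C k h g) \<diamondop> Id2 C f) \<bullet> Assoc C (k \<star> h) g f
    = (Id2 C k \<diamondop> Assoc C h g f) \<bullet> inv2 C (Assoc C k h (g \<star> f))"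
proof -
  have "inv2 C (Assoc C k h g) \<diamondop> Id2 C f = inv2 C (Assoc C k h g \<diamondop> Id2 C f)"
    using assms by simp
  moreover have "inv2 C (Assoc C k (h \<star> g) f) \<bullet> inv2 C (Assoc C k h g \<diamondop> Id2 C f)
      \<bullet> Assoc C (k \<star> h) g f
    = (Id2 C k \<diamondop> Assoc C h g f) \<bullet> inv2 C (Assoc C k h (g \<star> f))"
    by (rule iso2_transpose) (use assms pentagon[of f "Dom C f" "Cod C f" g "Cod C g" h "Cod C h" k "Cod C k"]
      in \<open>simp_all add: in_hom1_def\<close>)
  ultimately show ?thesis by simp
qed

lemma vcomp_right_cancel:
  assumes e: "iso2 C e" and xy: "x \<in> Cell C" "y \<in> Cell C" "Src C x = Tgt C e" "Src C y = Tgt C e"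
    and eq: "x \<bullet> e = y \<bullet> e"
  shows "x = y"
proof -
  have "x = (x \<bullet> e) \<bullet> inv2 C e"
    using e xy iso2_Cell[OF e] by simp
  also have "\<dots> = (y \<bullet> e) \<bullet> inv2 C e"
    by (simp only: eq)
  also have "\<dots> = y"
    using e xy iso2_Cell[OF e] by simp
  finally show ?thesis .
qed

section \<open>Composable lists and their coherence isomorphisms\<close>

fun mor :: "'a list \<Rightarrow> 'o \<Rightarrow> 'o \<Rightarrow> bool" where
  "mor [] A B \<longleftrightarrow> False"
| "mor [f] A B \<longleftrightarrow> \<guillemotleft>f : A \<rightarrow> B\<guillemotright>"
| "mor (f # g # fs) A B \<longleftrightarrow> \<guillemotleft>f : Dom C f \<rightarrow> B\<guillemotright> \<and> mor (g # fs) A (Dom C f)"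

lemma mor_Nil: "mor p A B \<Longrightarrow> p \<noteq> []"
  by auto

lemma mor_Cons: "p \<noteq> [] \<Longrightarrow> mor (f # p) A B \<longleftrightarrow> \<guillemotleft>f : Dom C f \<rightarrow> B\<guillemotright> \<and> mor p A (Dom C f)"
  by (cases p) auto

lemma path_Cons: "p \<noteq> [] \<Longrightarrow> path C (f # p) = f \<star> path C p"
  by (cases p) auto

lemma coh_Cons: "p \<noteq> [] \<Longrightarrow>
  coh C (f # p) q = (Id2 C f \<diamondop> coh C p q) \<bullet> inv2 C (Assoc C f (path C p) (path C q))"
  by (cases p) auto

lemma mor_append:
  assumes "p \<noteq> []" "q \<noteq> []"
  shows "mor (p @ q) A B \<longleftrightarrow> (\<exists>D. mor q A D \<and> mor p D B)"
  using assms(1)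
proof (induction p arbitrary: B rule: list_nonempty_induct)
  case (single f)
  show ?case
    using assms(2) by (auto simp: mor_Cons in_hom1_def)
next
  case (cons f p)
  then show ?case by (auto simp: mor_Cons)
qed

lemma mor_appendI: "mor q A D \<Longrightarrow> mor p D B \<Longrightarrow> mor (p @ q) A B"
  using mor_append mor_Nil by blast

lemma mor_ConsI: "mor q A D \<Longrightarrow> \<guillemotleft>f : D \<rightarrow> B\<guillemotright> \<Longrightarrow> mor (f # q) A B"
  using mor_appendI[of q A D "[f]" B] by simp

lemma path_simps:
  assumes "mor p A B"
  shows "path C p \<in> Arr C" "Dom C (path C p) = A" "Cod C (path C p) = B"
proof -
  have "path C p \<in> Arr C \<and> Dom C (path C p) = A \<and> Cod C (path C p) = B"
    using mor_Nil[OF assms] assms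
  proof (induction p arbitrary: B rule: list_nonempty_induct)
    case (single f)
    then show ?case by (simp add: in_hom1_def)
  next
    case (cons f p)
    then show ?case by (auto simp: mor_Cons path_Cons in_hom1_def)
  qed
  then show "path C p \<in> Arr C" "Dom C (path C p) = A" "Cod C (path C p) = B" by auto
qed

lemma mor_unique: "mor p A B \<Longrightarrow> mor p A' B' \<Longrightarrow> A = A' \<and> B = B'"
  using path_simps by metis

lemma coh_simps:
  assumes p: "mor p B D" and q: "mor q A B"
  shows "coh C p q \<in> Cell C" "Src C (coh C p q) = path C p \<star> path C q"
    "Tgt C (coh C p q) = path C (p @ q)" "iso2 C (coh C p q)"
proof -
  have "iso2 C (coh C p q) \<and> Src C (coh C p q) = path C p \<star> path C q
      \<and> Tgt C (coh C p q) = path C (p @ q)"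
    using mor_Nil[OF p] p
  proof (induction p arbitrary: D rule: list_nonempty_induct)
    case (single f)
    then show ?case using path_simps[OF q] by (simp add: in_hom1_def path_Cons[OF mor_Nil[OF q]])
  next
    case (cons f p)
    then have f: "f \<in> Arr C" and p: "mor p B (Dom C f)"
      by (auto simp: mor_Cons in_hom1_def)
    note IH = cons.IH[OF p]
    have "coh C p q \<in> Cell C" using IH iso2_Cell by blast
    with IH f path_simps[OF p] path_simps[OF q] path_simps[OF mor_appendI[OF q p]] cons.hyps show ?case
      by (simp add: coh_Cons path_Cons)
  qed
  then show "coh C p q \<in> Cell C" "Src C (coh C p q) = path C p \<star> path C q"
    "Tgt C (coh C p q) = path C (p @ q)" "iso2 C (coh C p q)"
    using iso2_Cell by auto
qed

abbreviation (input) "lwhisk p x \<equiv> foldr (\<lambda>f y. Id2 C f \<diamondop> y) p x"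

lemma lwhisk_simps:
  assumes "mor q A B" "mor q' A B" "mor p B D" "x \<in> Cell C" "Src C x = path C q" "Tgt C x = path C q'"
  shows "lwhisk p x \<in> Cell C" "Src C (lwhisk p x) = path C (p @ q)" "Tgt C (lwhisk p x) = path C (p @ q')"
proof -
  have "lwhisk p x \<in> Cell C \<and> Src C (lwhisk p x) = path C (p @ q) \<and> Tgt C (lwhisk p x) = path C (p @ q')"
    using mor_Nil[OF assms(3)] assms(3)
  proof (induction p arbitrary: D rule: list_nonempty_induct)
    case (single f)
    then show ?case using assms path_simps[OF assms(1)] mor_Nil[OF assms(1)] mor_Nil[OF assms(2)]
      by (simp add: in_hom1_def path_Cons)
  next
    case (cons f p)
    then have f: "f \<in> Arr C" and p: "mor p B (Dom C f)"
      by (auto simp: mor_Cons in_hom1_def)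
    have "mor (p @ q) A (Dom C f)" using p assms(1) by (rule mor_appendI[rotated])
    with cons.IH[OF p] path_simps[OF this] f show ?case
      by (simp add: path_Cons cons.hyps)
  qed
  then show "lwhisk p x \<in> Cell C" "Src C (lwhisk p x) = path C (p @ q)" "Tgt C (lwhisk p x) = path C (p @ q')"
    by auto
qed

text \<open>The inductive step of \<open>coh_natural\<close>, with the inner path and the inner
  coherence cells replaced by arbitrary cells of the right types. Functoriality of whiskering by
  \<open>f\<close> carries the hypothesis inside, and naturality moves \<open>x\<close> past the
  inverse associator.\<close>

lemma coh_natural_step:
  assumes eq: "l \<bullet> c = c' \<bullet> (Id2 C P \<diamondop> x)"
    and [simp]: "f \<in> Arr C" "P \<in> Arr C" "x \<in> Cell C" "Cod C (Src C x) = Dom C P" "Cod C P = Dom C f"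
    "c \<in> Cell C" "Src C c = P \<star> Src C x" "l \<in> Cell C" "Src C l = Tgt C c" "Cod C (Src C l) = Dom C f"
    "c' \<in> Cell C" "Src C c' = P \<star> Tgt C x"
  shows "(Id2 C f \<diamondop> l) \<bullet> (Id2 C f \<diamondop> c) \<bullet> inv2 C (Assoc C f P (Src C x))
    = ((Id2 C f \<diamondop> c') \<bullet> inv2 C (Assoc C f P (Tgt C x))) \<bullet> (Id2 C (f \<star> P) \<diamondop> x)"
proof -
  have [simp]: "Cod C (Tgt C c) = Cod C P"
    using cell_simps(4)[of c] by simp
  have "(Id2 C f \<diamondop> l) \<bullet> (Id2 C f \<diamondop> c) \<bullet> inv2 C (Assoc C f P (Src C x))
      = (Id2 C f \<diamondop> (l \<bullet> c)) \<bullet> inv2 C (Assoc C f P (Src C x))"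
    by (simp add: lwhisk_vcomp)
  also have "\<dots> = (Id2 C f \<diamondop> c') \<bullet> (Id2 C f \<diamondop> Id2 C P \<diamondop> x) \<bullet> inv2 C (Assoc C f P (Src C x))"
    by (simp add: lwhisk_vcomp eq)
  also have "(Id2 C f \<diamondop> Id2 C P \<diamondop> x) \<bullet> inv2 C (Assoc C f P (Src C x))
      = inv2 C (Assoc C f P (Tgt C x)) \<bullet> (Id2 C (f \<star> P) \<diamondop> x)"
    using inv2_Assoc_natural[of x "Id2 C P" "Id2 C f"] by simp
  finally show ?thesis by simp
qed

text \<open>Left whiskering by a list is iterated entry by entry, whereas horizontal composition
  with \<open>path C p\<close> acts at once. \<open>coh\<close> translates between the two.\<close>

lemma coh_natural:
  assumes q: "mor q A B" and q': "mor q' A B" and p: "mor p B D"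
    and x: "x \<in> Cell C" "Src C x = path C q" "Tgt C x = path C q'"
  shows "lwhisk p x \<bullet> coh C p q = coh C p q' \<bullet> (Id2 C (path C p) \<diamondop> x)"
  using mor_Nil[OF p] p
proof (induction p arbitrary: D rule: list_nonempty_induct)
  case (single f)
  then show ?case using path_simps[OF q] path_simps[OF q'] x by (simp add: in_hom1_def)
next
  case (cons f p)
  then have f: "f \<in> Arr C" and p: "mor p B (Dom C f)"
    by (auto simp: mor_Cons in_hom1_def)
  show ?case
    using coh_natural_step[OF cons.IH[OF p] f] p f x path_simps[OF p] path_simps[OF q]
      lwhisk_simps[OF q q' p x] coh_simps[OF p q] coh_simps[OF p q'] path_simps[OF mor_appendI[OF q p]]
    by (simp add: coh_Cons[OF cons.hyps] path_Cons[OF cons.hyps])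
qed

text \<open>Naturality in \<open>c1\<close> brings the associators of \<open>f\<close>,
  \<open>P\<close>, \<open>Q\<close> and \<open>S\<close> next to each other. The pentagon turns
  them into one associator whiskered by \<open>f\<close>, to which \<open>eq\<close> applies, and an
  inverse associator, past which \<open>c3\<close> moves by naturality.\<close>

lemma coh_append_step:
  assumes eq: "c2 \<bullet> (c1 \<diamondop> Id2 C S) \<bullet> Assoc C P Q S = c4 \<bullet> (Id2 C P \<diamondop> c3)"
    and [simp]: "f \<in> Arr C" "P \<in> Arr C" "Q \<in> Arr C" "S \<in> Arr C"
    "Cod C S = Dom C Q" "Cod C Q = Dom C P" "Cod C P = Dom C f"
    "c1 \<in> Cell C" "Src C c1 = P \<star> Q" "c2 \<in> Cell C" "Src C c2 = Tgt C c1 \<star> S"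
    "c3 \<in> Cell C" "Src C c3 = Q \<star> S" "c4 \<in> Cell C" "Src C c4 = P \<star> Tgt C c3"
  shows "((Id2 C f \<diamondop> c2) \<bullet> inv2 C (Assoc C f (Tgt C c1) S))
      \<bullet> (((Id2 C f \<diamondop> c1) \<bullet> inv2 C (Assoc C f P Q)) \<diamondop> Id2 C S) \<bullet> Assoc C (f \<star> P) Q S
    = ((Id2 C f \<diamondop> c4) \<bullet> inv2 C (Assoc C f P (Tgt C c3))) \<bullet> (Id2 C (f \<star> P) \<diamondop> c3)"
    (is "?L = ?R")
proof -
  have [simp]: "Dom C (Tgt C c1) = Dom C Q" "Cod C (Tgt C c1) = Cod C P"
    "Dom C (Tgt C c3) = Dom C S" "Cod C (Tgt C c3) = Cod C Q"
    using cell_simps[of c1] cell_simps[of c3] by simp_all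
  let ?f = "Id2 C f" and ?s = "Id2 C S"
  have "?L = (?f \<diamondop> c2) \<bullet> (inv2 C (Assoc C f (Tgt C c1) S) \<bullet> ((?f \<diamondop> c1) \<diamondop> ?s))
      \<bullet> (inv2 C (Assoc C f P Q) \<diamondop> ?s) \<bullet> Assoc C (f \<star> P) Q S"
    by (simp add: rwhisk_vcomp)
  also have "inv2 C (Assoc C f (Tgt C c1) S) \<bullet> ((?f \<diamondop> c1) \<diamondop> ?s)
      = (?f \<diamondop> c1 \<diamondop> ?s) \<bullet> inv2 C (Assoc C f (P \<star> Q) S)"
    using inv2_Assoc_natural[of ?s c1 ?f] by simp
  also have "(?f \<diamondop> c2) \<bullet> ((?f \<diamondop> c1 \<diamondop> ?s) \<bullet> inv2 C (Assoc C f (P \<star> Q) S))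
        \<bullet> (inv2 C (Assoc C f P Q) \<diamondop> ?s) \<bullet> Assoc C (f \<star> P) Q S
      = (?f \<diamondop> c2) \<bullet> (?f \<diamondop> c1 \<diamondop> ?s) \<bullet> (inv2 C (Assoc C f (P \<star> Q) S)
        \<bullet> (inv2 C (Assoc C f P Q) \<diamondop> ?s) \<bullet> Assoc C (f \<star> P) Q S)"
    by simp
  also have "inv2 C (Assoc C f (P \<star> Q) S) \<bullet> (inv2 C (Assoc C f P Q) \<diamondop> ?s) \<bullet> Assoc C (f \<star> P) Q S
      = (?f \<diamondop> Assoc C P Q S) \<bullet> inv2 C (Assoc C f P (Q \<star> S))"
    by (rule inv2_pentagon) simp_all
  also have "(?f \<diamondop> c2) \<bullet> (?f \<diamondop> c1 \<diamondop> ?s)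
        \<bullet> (?f \<diamondop> Assoc C P Q S) \<bullet> inv2 C (Assoc C f P (Q \<star> S))
      = (?f \<diamondop> (c2 \<bullet> (c1 \<diamondop> ?s) \<bullet> Assoc C P Q S)) \<bullet> inv2 C (Assoc C f P (Q \<star> S))"
    by (simp add: lwhisk_vcomp)
  also have "\<dots> = (?f \<diamondop> c4) \<bullet> ((?f \<diamondop> Id2 C P \<diamondop> c3) \<bullet> inv2 C (Assoc C f P (Q \<star> S)))"
    by (simp add: lwhisk_vcomp eq)
  also have "(?f \<diamondop> Id2 C P \<diamondop> c3) \<bullet> inv2 C (Assoc C f P (Q \<star> S))
      = inv2 C (Assoc C f P (Tgt C c3)) \<bullet> (Id2 C (f \<star> P) \<diamondop> c3)"
    using inv2_Assoc_natural[of c3 "Id2 C P" ?f] by simp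
  finally show ?thesis by simp
qed

text \<open>The pentagon for lists: the two ways of flattening three consecutive lists agree up to
  one associator. This is what makes successive right whiskerings compose strictly.\<close>

lemma coh_append:
  assumes r: "mor r A B" and q: "mor q B D" and p: "mor p D F"
  shows "coh C (p @ q) r \<bullet> (coh C p q \<diamondop> Id2 C (path C r)) \<bullet> Assoc C (path C p) (path C q) (path C r)
    = coh C p (q @ r) \<bullet> (Id2 C (path C p) \<diamondop> coh C q r)"
  using mor_Nil[OF p] p
proof (induction p arbitrary: F rule: list_nonempty_induct)
  case (single f)
  then have f: "f \<in> Arr C" "Dom C f = D" by (auto simp: in_hom1_def)
  have ne: "q \<noteq> []" "r \<noteq> []" using mor_Nil q r by auto
  show ?case
    using f path_simps[OF q] path_simps[OF r] path_simps[OF mor_appendI[OF r q]] coh_simps[OF q r]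
    by (simp add: path_Cons coh_Cons ne)
next
  case (cons f p)
  then have f: "f \<in> Arr C" and p: "mor p D (Dom C f)"
    by (auto simp: mor_Cons in_hom1_def)
  have pq: "mor (p @ q) B (Dom C f)" and qr: "mor (q @ r) A D"
    using p q r mor_appendI by blast+
  show ?case
    using coh_append_step[OF cons.IH[OF p] f] path_simps[OF p] path_simps[OF q] path_simps[OF r]
      coh_simps[OF p q] coh_simps[OF q r] coh_simps[OF pq r] coh_simps[OF p qr]
    by (simp add: coh_Cons path_Cons cons.hyps)
qed

section \<open>Laws of the strictification\<close>

definition cell :: "('a, 'c) scell \<Rightarrow> 'a list \<Rightarrow> 'a list \<Rightarrow> 'o \<Rightarrow> 'o \<Rightarrow> bool" where
  "cell X p q A B \<longleftrightarrow> fst X = p \<and> snd (snd X) = q \<and> mor p A B \<and> mor q A B \<and>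
     \<guillemotleft>the_cell X : path C p \<Rightarrow> path C q\<guillemotright>"

definition icell :: "('a, 'c) scell \<Rightarrow> 'a list \<Rightarrow> 'a list \<Rightarrow> 'o \<Rightarrow> 'o \<Rightarrow> bool" where
  "icell X p q A B \<longleftrightarrow> cell X p q A B \<and> iso2 C (the_cell X)"

text \<open>The empty list stands for an identity; it is allowed for left whiskering only, as \<open>path []\<close> is junk.\<close>

definition mor0 :: "'a list \<Rightarrow> 'o \<Rightarrow> 'o \<Rightarrow> bool" where
  "mor0 f A B \<longleftrightarrow> (if f = [] then A = B else mor f A B)"

lemma mor0_Nil [simp]: "mor0 [] A B \<longleftrightarrow> A = B"
  by (simp add: mor0_def)

lemma mor_mor0: "mor f A B \<Longrightarrow> mor0 f A B"
  using mor_Nil by (auto simp: mor0_def)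

lemma mor0_append0I: "mor0 q A D \<Longrightarrow> mor0 p D B \<Longrightarrow> mor0 (p @ q) A B"
  by (auto simp: mor0_def mor_appendI split: if_splits)

lemma cellE:
  assumes "cell X p q A B"
  obtains x where "X = (p, x, q)" "mor p A B" "mor q A B" "x \<in> Cell C" "Src C x = path C p" "Tgt C x = path C q"
  using assms by (cases X) (auto simp: cell_def in_hom2_def)

lemma cell_iff: "cell (p', x, q') p q A B \<longleftrightarrow>
    p' = p \<and> q' = q \<and> mor p A B \<and> mor q A B \<and> x \<in> Cell C \<and> Src C x = path C p \<and> Tgt C x = path C q"
  by (auto simp: cell_def in_hom2_def)

lemma icell_cell: "icell X p q A B \<Longrightarrow> cell X p q A B"
  by (simp add: icell_def)

lemma icellE:
  assumes "icell X p q A B"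
  obtains x where "X = (p, x, q)" "mor p A B" "mor q A B" "x \<in> Cell C" "Src C x = path C p" "Tgt C x = path C q"
    "iso2 C x"
  using assms by (cases X) (auto simp: icell_def cell_def in_hom2_def)

lemma icell_iff: "icell (p', x, q') p q A B \<longleftrightarrow>
    p' = p \<and> q' = q \<and> mor p A B \<and> mor q A B \<and> x \<in> Cell C \<and> Src C x = path C p \<and> Tgt C x = path C q \<and> iso2 C x"
  by (auto simp: icell_def cell_iff)

lemma cell_mor: "cell X p q A B \<Longrightarrow> mor p A B \<and> mor q A B"
  by (simp add: cell_def)

lemma cell_unique: "cell X p q A B \<Longrightarrow> cell X p' q' A' B' \<Longrightarrow> p = p' \<and> q = q' \<and> A = A' \<and> B = B'"
  using mor_unique by (fastforce simp: cell_def)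

lemma cell_svcomp: "cell X p q A B \<Longrightarrow> cell Y q r A B \<Longrightarrow> cell (Y \<odot> X) p r A B"
  by (elim cellE) (simp add: cell_iff)

lemma icell_svcomp: "icell X p q A B \<Longrightarrow> icell Y q r A B \<Longrightarrow> icell (Y \<odot> X) p r A B"
  by (elim icellE) (simp add: icell_iff)

lemma svcomp_assoc:
  "cell X p q A B \<Longrightarrow> cell Y q r A B \<Longrightarrow> cell Z r s A B \<Longrightarrow> (Z \<odot> Y) \<odot> X = Z \<odot> Y \<odot> X"
  by (elim cellE) simp

definition sid :: "'a list \<Rightarrow> ('a, 'c) scell" where
  "sid p = (p, Id2 C (path C p), p)"

lemma svcomp_sid: "cell X p q A B \<Longrightarrow> X \<odot> sid p = X"
  by (elim cellE) (simp add: sid_def)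

lemma sid_svcomp: "cell X p q A B \<Longrightarrow> sid q \<odot> X = X"
  by (elim cellE) (simp add: sid_def)

lemma icell_sinv: "icell X p q A B \<Longrightarrow> icell (sinv C X) q p A B"
  by (elim icellE) (simp add: icell_iff)

lemma sinv_svcomp: "icell X p q A B \<Longrightarrow> sinv C X \<odot> X = sid p"
  by (elim icellE) (simp add: sid_def)

lemma svcomp_sinv: "icell X p q A B \<Longrightarrow> X \<odot> sinv C X = sid q"
  by (elim icellE) (simp add: sid_def)

section \<open>Strict laws for whiskering\<close>

lemma slwhisk_Nil [simp]: "[] \<lhd> X = X"
  by (cases X) simp

lemma slwhisk_append: "(f @ g) \<lhd> X = f \<lhd> g \<lhd> X"
  by (cases X) simp

lemma slwhisk_Cons: "(f # g) \<lhd> X = [f] \<lhd> g \<lhd> X"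
  by (cases X) simp

lemma cell_slwhisk:
  assumes "cell X p q A B" "mor0 f B D"
  shows "cell (f \<lhd> X) (f @ p) (f @ q) A D"
proof (cases "f = []")
  case True
  then show ?thesis using assms by simp
next
  case False
  then have f: "mor f B D" using assms by (simp add: mor0_def)
  obtain x where x: "X = (p, x, q)" "mor p A B" "mor q A B" "x \<in> Cell C" "Src C x = path C p" "Tgt C x = path C q"
    using assms(1) by (rule cellE)
  show ?thesis
    using lwhisk_simps[OF x(2,3) f x(4-6)] mor_appendI[OF x(2) f] mor_appendI[OF x(3) f] x
    by (simp add: cell_iff)
qed

lemma slwhisk_single_svcomp:
  assumes "cell X p q A B" "cell Y q r A B" "\<guillemotleft>f : B \<rightarrow> D\<guillemotright>"
  shows "[f] \<lhd> (Y \<odot> X) = ([f] \<lhd> Y) \<odot> ([f] \<lhd> X)"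
  using assms path_simps by (elim cellE) (simp add: lwhisk_vcomp in_hom1_def)

text \<open>Lists are in applicative order, so a new head extends the composite at its codomain. The
  source \<open>B\<close> stays fixed while the target varies.\<close>

lemma list_mor0_induct [consumes 1, case_names Nil Cons]:
  assumes "mor0 f B D"
    and "P [] B"
    and "\<And>g f D' D. mor0 f B D' \<Longrightarrow> \<guillemotleft>g : D' \<rightarrow> D\<guillemotright> \<Longrightarrow> P f D' \<Longrightarrow> P (g # f) D"
  shows "P f D"
  using assms(1)
proof (induction f arbitrary: D)
  case Nil
  then show ?case using assms(2) by simp
next
  case (Cons g f)
  then have "mor0 f B (Dom C g) \<and> \<guillemotleft>g : Dom C g \<rightarrow> D\<guillemotright>"
    by (cases f) (auto simp: mor0_def in_hom1_def)
  then show ?case using Cons.IH assms(3) by blast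
qed

lemma slwhisk_svcomp:
  assumes "cell X p q A B" "cell Y q r A B" "mor0 f B D"
  shows "f \<lhd> (Y \<odot> X) = (f \<lhd> Y) \<odot> (f \<lhd> X)"
  using assms(3)
proof (induction rule: list_mor0_induct)
  case (Cons g f D' D)
  have "(g # f) \<lhd> (Y \<odot> X) = [g] \<lhd> ((f \<lhd> Y) \<odot> (f \<lhd> X))"
    by (simp only: slwhisk_Cons[of g f] Cons.IH)
  also have "\<dots> = ([g] \<lhd> f \<lhd> Y) \<odot> ([g] \<lhd> f \<lhd> X)"
    using Cons.hyps assms by (blast intro: slwhisk_single_svcomp cell_slwhisk)
  finally show ?case by (simp only: slwhisk_Cons[of g f])
qed simp

lemma icell_slwhisk:
  assumes X: "icell X p q A B" and f: "mor0 f B D"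
  shows "icell (f \<lhd> X) (f @ p) (f @ q) A D" "sinv C (f \<lhd> X) = f \<lhd> sinv C X"
proof -
  have "icell (f \<lhd> X) (f @ p) (f @ q) A D \<and> sinv C (f \<lhd> X) = f \<lhd> sinv C X"
    using f
  proof (induction rule: list_mor0_induct)
    case Nil
    then show ?case using X by simp
  next
    case (Cons g f D' D)
    then have fX: "icell (f \<lhd> X) (f @ p) (f @ q) A D'" and eq: "sinv C (f \<lhd> X) = f \<lhd> sinv C X"
      by auto
    have g: "mor0 [g] D' D" using Cons.hyps by (simp add: mor0_def)
    have "icell ([g] \<lhd> f \<lhd> X) ([g] @ f @ p) ([g] @ f @ q) A D
      \<and> sinv C ([g] \<lhd> f \<lhd> X) = [g] \<lhd> sinv C (f \<lhd> X)"
      using fX cell_slwhisk[OF icell_cell[OF fX] g] Cons.hyps(2) path_simps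
      by (elim icellE) (auto simp: icell_def cell_def in_hom1_def)
    then show ?case by (simp add: slwhisk_Cons[of g f] eq del: slwhisk.simps)
  qed
  then show "icell (f \<lhd> X) (f @ p) (f @ q) A D" "sinv C (f \<lhd> X) = f \<lhd> sinv C X" by auto
qed

lemma cell_srwhisk:
  assumes "cell X p q A B" "mor r D A"
  shows "cell (X \<rhd> r) (p @ r) (q @ r) D B"
  using assms(1)
proof (rule cellE)
  fix x assume x: "X = (p, x, q)" "mor p A B" "mor q A B" "x \<in> Cell C" "Src C x = path C p" "Tgt C x = path C q"
  show ?thesis
    using x coh_simps[OF x(2) assms(2)] coh_simps[OF x(3) assms(2)] path_simps[OF assms(2)]
      path_simps[OF x(2)] mor_appendI[OF assms(2) x(2)] mor_appendI[OF assms(2) x(3)]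
    by (simp add: cell_iff)
qed

lemma icell_srwhisk:
  assumes "icell X p q A B" "mor r D A"
  shows "icell (X \<rhd> r) (p @ r) (q @ r) D B" "sinv C (X \<rhd> r) = sinv C X \<rhd> r"
  using assms(1)
proof (rule_tac [!] icellE)
  fix x assume x: "X = (p, x, q)" "mor p A B" "mor q A B" "x \<in> Cell C" "Src C x = path C p" "Tgt C x = path C q" "iso2 C x"
  note facts = x coh_simps[OF x(2) assms(2)] coh_simps[OF x(3) assms(2)] path_simps[OF assms(2)]
      path_simps[OF x(2)] path_simps[OF x(3)]
  show "icell (X \<rhd> r) (p @ r) (q @ r) D B"
    using facts mor_appendI[OF assms(2) x(2)] mor_appendI[OF assms(2) x(3)]
    by (simp add: icell_iff)
  show "sinv C (X \<rhd> r) = sinv C X \<rhd> r"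
    using facts by simp
qed

lemma srwhisk_svcomp:
  assumes X: "cell X p q A B" and Y: "cell Y q s A B" and r: "mor r D A"
  shows "(Y \<odot> X) \<rhd> r = (Y \<rhd> r) \<odot> (X \<rhd> r)"
proof -
  obtain x where x: "X = (p, x, q)" "mor p A B" "mor q A B" "x \<in> Cell C" "Src C x = path C p" "Tgt C x = path C q"
    using X by (rule cellE)
  obtain y where y: "Y = (q, y, s)" "mor q A B" "mor s A B" "y \<in> Cell C" "Src C y = path C q" "Tgt C y = path C s"
    using Y by (rule cellE)
  show ?thesis
    using x y coh_simps[OF x(2) r] coh_simps[OF x(3) r] coh_simps[OF y(3) r] path_simps[OF r]
      path_simps[OF x(2)] path_simps[OF x(3)]
    by (simp add: rwhisk_vcomp)
qed

text \<open>Each entry \<open>g\<close> of \<open>f\<close> contributes, through \<open>coh\<close>,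
  an inverse associator at the target end and an associator at the source end. By naturality they
  cancel around the whiskered cell (the equation \<open>nat\<close>).\<close>

lemma slwhisk_srwhisk:
  assumes X: "cell X p q A B" and r: "mor r D A" and f: "mor0 f B E"
  shows "(f \<lhd> X) \<rhd> r = f \<lhd> X \<rhd> r"
  using f
proof (induction rule: list_mor0_induct)
  case Nil
  then show ?case by simp
next
  case (Cons g f E' E)
  obtain x where x: "f \<lhd> X = (f @ p, x, f @ q)" "mor (f @ p) A E'" "mor (f @ q) A E'" "x \<in> Cell C"
      "Src C x = path C (f @ p)" "Tgt C x = path C (f @ q)"
    using cell_slwhisk[OF X Cons.hyps(1)] by (rule cellE)
  have g: "g \<in> Arr C" "Dom C g = E'" using Cons.hyps by (auto simp: in_hom1_def)
  have ne: "f @ p \<noteq> []" "f @ q \<noteq> []" using x mor_Nil by blast+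
  let ?R = "path C r"
  have "inv2 C (Assoc C g (path C (f @ q)) ?R) \<bullet> ((Id2 C g \<diamondop> x) \<diamondop> Id2 C ?R)
      = (Id2 C g \<diamondop> x \<diamondop> Id2 C ?R) \<bullet> inv2 C (Assoc C g (path C (f @ p)) ?R)"
    using inv2_Assoc_natural[of "Id2 C ?R" x "Id2 C g"] x g path_simps[OF r] path_simps[OF x(2)] by simp
  then have nat: "inv2 C (Assoc C g (path C (f @ q)) ?R) \<bullet> ((Id2 C g \<diamondop> x) \<diamondop> Id2 C ?R)
      \<bullet> Assoc C g (path C (f @ p)) ?R = Id2 C g \<diamondop> x \<diamondop> Id2 C ?R"
    using x g path_simps[OF r] path_simps[OF x(2)] path_simps[OF x(3)]
    by (subst vcomp_assoc_simp[symmetric]) simp_all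
  have "the_cell (([g] \<lhd> f \<lhd> X) \<rhd> r) = (Id2 C g \<diamondop> coh C (f @ q) r) \<bullet>
      (inv2 C (Assoc C g (path C (f @ q)) ?R) \<bullet> ((Id2 C g \<diamondop> x) \<diamondop> Id2 C ?R)
      \<bullet> Assoc C g (path C (f @ p)) ?R) \<bullet> (Id2 C g \<diamondop> inv2 C (coh C (f @ p) r))"
    using x g path_simps[OF r] path_simps[OF x(2)] path_simps[OF x(3)]
      coh_simps[OF x(2) r] coh_simps[OF x(3) r] path_simps[OF mor_appendI[OF r x(2)]]
    by (simp add: coh_Cons ne del: append_eq_append_conv append_is_Nil_conv)
  also have "\<dots> = the_cell ([g] \<lhd> (f \<lhd> X) \<rhd> r)"
    unfolding nat using x g path_simps[OF r] path_simps[OF x(2)] path_simps[OF x(3)]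
      coh_simps[OF x(2) r] coh_simps[OF x(3) r] path_simps[OF mor_appendI[OF r x(2)]]
    by (simp add: lwhisk_vcomp)
  finally have "([g] \<lhd> f \<lhd> X) \<rhd> r = [g] \<lhd> (f \<lhd> X) \<rhd> r"
    using x by simp
  then show ?case by (simp add: slwhisk_Cons[of g f] Cons.IH del: slwhisk.simps srwhisk.simps)
qed

lemma srwhisk_append_step:
  assumes kp: "dp \<bullet> (cp \<diamondop> Id2 C S) \<bullet> Assoc C P R S = ep \<bullet> (Id2 C P \<diamondop> c)"
    and kq: "dq \<bullet> (cq \<diamondop> Id2 C S) \<bullet> Assoc C Q R S = eq \<bullet> (Id2 C Q \<diamondop> c)"
    and iso: "iso2 C cp" "iso2 C dp" "iso2 C ep" "iso2 C c"
    and [simp]: "x \<in> Cell C" "Src C x = P" "Tgt C x = Q" "P \<in> Arr C" "Q \<in> Arr C" "R \<in> Arr C" "S \<in> Arr C"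
    "Dom C P = Cod C R" "Dom C Q = Cod C R" "Dom C R = Cod C S" "Cod C P = Cod C Q"
    "cp \<in> Cell C" "Src C cp = P \<star> R" "cq \<in> Cell C" "Src C cq = Q \<star> R"
    "dp \<in> Cell C" "Src C dp = Tgt C cp \<star> S" "dq \<in> Cell C" "Src C dq = Tgt C cq \<star> S"
    "c \<in> Cell C" "Src C c = R \<star> S" "ep \<in> Cell C" "Src C ep = P \<star> Tgt C c"
    "eq \<in> Cell C" "Src C eq = Q \<star> Tgt C c"
    and tgt: "Tgt C ep = Tgt C dp" "Tgt C eq = Tgt C dq"
  shows "dq \<bullet> ((cq \<bullet> (x \<diamondop> Id2 C R) \<bullet> inv2 C cp) \<diamondop> Id2 C S) \<bullet> inv2 C dp
    = eq \<bullet> (x \<diamondop> Id2 C (Tgt C c)) \<bullet> inv2 C ep"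
\<comment> \<open>Precomposing with this invertible cell removes the inverses of \<open>cp\<close>,
  \<open>dp\<close> and \<open>ep\<close>: \<open>kp\<close> replaces it by a composite that starts
  with an associator, past which \<open>x\<close> moves by naturality, and \<open>kq\<close>
  reassembles the target side.\<close>
proof (rule vcomp_right_cancel[of "ep \<bullet> (Id2 C P \<diamondop> c)"])
  have [simp]: "Dom C (Tgt C cp) = Dom C R" "Cod C (Tgt C cp) = Cod C Q"
    "Dom C (Tgt C cq) = Dom C R" "Cod C (Tgt C cq) = Cod C Q"
    "Dom C (Tgt C c) = Dom C S" "Cod C (Tgt C c) = Cod C R"
    using cell_simps[of cp] cell_simps[of cq] cell_simps[of c] by simp_all
  note iso [simp] tgt [simp]
  show "iso2 C (ep \<bullet> (Id2 C P \<diamondop> c))" by simp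
  let ?l = "dq \<bullet> ((cq \<bullet> (x \<diamondop> Id2 C R) \<bullet> inv2 C cp) \<diamondop> Id2 C S) \<bullet> inv2 C dp"
  let ?r = "eq \<bullet> (x \<diamondop> Id2 C (Tgt C c)) \<bullet> inv2 C ep"
  show "?l \<in> Cell C" "?r \<in> Cell C" "Src C ?l = Tgt C (ep \<bullet> (Id2 C P \<diamondop> c))"
    "Src C ?r = Tgt C (ep \<bullet> (Id2 C P \<diamondop> c))"
    by simp_all
  have cp: "(inv2 C cp \<diamondop> Id2 C S) \<bullet> (cp \<diamondop> Id2 C S) = Id2 C ((P \<star> R) \<star> S)"
    by (subst rwhisk_vcomp[symmetric]) simp_all
  have "?l \<bullet> ep \<bullet> (Id2 C P \<diamondop> c) = ?l \<bullet> dp \<bullet> (cp \<diamondop> Id2 C S) \<bullet> Assoc C P R S"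
    by (simp only: kp)
  also have "\<dots> = dq \<bullet> (cq \<diamondop> Id2 C S) \<bullet> ((x \<diamondop> Id2 C R) \<diamondop> Id2 C S)
      \<bullet> ((inv2 C cp \<diamondop> Id2 C S) \<bullet> (cp \<diamondop> Id2 C S)) \<bullet> Assoc C P R S"
    by (simp add: rwhisk_vcomp)
  also have "\<dots> = dq \<bullet> (cq \<diamondop> Id2 C S) \<bullet> (((x \<diamondop> Id2 C R) \<diamondop> Id2 C S) \<bullet> Assoc C P R S)"
    unfolding cp by simp
  also have "((x \<diamondop> Id2 C R) \<diamondop> Id2 C S) \<bullet> Assoc C P R S = Assoc C Q R S \<bullet> (x \<diamondop> Id2 C (R \<star> S))"
    using Assoc_natural[of "Id2 C S" "Id2 C R" x] by simp
  also have "dq \<bullet> (cq \<diamondop> Id2 C S) \<bullet> Assoc C Q R S \<bullet> (x \<diamondop> Id2 C (R \<star> S))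
      = (dq \<bullet> (cq \<diamondop> Id2 C S) \<bullet> Assoc C Q R S) \<bullet> (x \<diamondop> Id2 C (R \<star> S))"
    by simp
  also have "\<dots> = eq \<bullet> (Id2 C Q \<diamondop> c) \<bullet> (x \<diamondop> Id2 C (R \<star> S))"
    by (simp add: kq)
  also have "(Id2 C Q \<diamondop> c) \<bullet> (x \<diamondop> Id2 C (R \<star> S)) = (x \<diamondop> Id2 C (Tgt C c)) \<bullet> (Id2 C P \<diamondop> c)"
    by (simp flip: interchange_simp)
  also have "eq \<bullet> \<dots> = ?r \<bullet> ep \<bullet> (Id2 C P \<diamondop> c)"
    by simp
  finally show "?l \<bullet> ep \<bullet> (Id2 C P \<diamondop> c) = ?r \<bullet> ep \<bullet> (Id2 C P \<diamondop> c)" .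
qed

lemma srwhisk_append:
  assumes X: "cell X p q A B" and r: "mor r D A" and s: "mor s E D"
  shows "(X \<rhd> r) \<rhd> s = X \<rhd> (r @ s)"
proof -
  obtain x where x: "X = (p, x, q)" "mor p A B" "mor q A B" "x \<in> Cell C" "Src C x = path C p" "Tgt C x = path C q"
    using X by (rule cellE)
  note pr = mor_appendI[OF r x(2)] and qr = mor_appendI[OF r x(3)] and rs = mor_appendI[OF s r]
  show ?thesis
    using srwhisk_append_step[OF coh_append[OF s r x(2)] coh_append[OF s r x(3)]]
      x path_simps[OF r] path_simps[OF s] path_simps[OF x(2)] path_simps[OF x(3)]
      coh_simps[OF x(2) r] coh_simps[OF x(3) r] coh_simps[OF r s] coh_simps[OF pr s] coh_simps[OF qr s]
      coh_simps[OF x(2) rs] coh_simps[OF x(3) rs]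
    by simp
qed

lemma interchange_step:
  assumes lr: "lr \<bullet> crp = crq \<bullet> (Id2 C R \<diamondop> x)" and ls: "ls \<bullet> csp = csq \<bullet> (Id2 C S \<diamondop> x)"
    and iso: "iso2 C crp" "iso2 C crq"
    and [simp]: "x \<in> Cell C" "Src C x = P" "Tgt C x = Q" "y \<in> Cell C" "Src C y = R" "Tgt C y = S"
    "P \<in> Arr C" "Q \<in> Arr C" "R \<in> Arr C" "S \<in> Arr C" "Cod C P = Dom C R" "Cod C Q = Dom C R" "Dom C S = Dom C R"
    "crp \<in> Cell C" "Src C crp = R \<star> P" "crq \<in> Cell C" "Src C crq = R \<star> Q"
    "csp \<in> Cell C" "Src C csp = S \<star> P" "csq \<in> Cell C" "Src C csq = S \<star> Q"
    "lr \<in> Cell C" "Src C lr = Tgt C crp" "Tgt C lr = Tgt C crq"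
    "ls \<in> Cell C" "Src C ls = Tgt C csp"
  shows "(csq \<bullet> (y \<diamondop> Id2 C Q) \<bullet> inv2 C crq) \<bullet> lr = ls \<bullet> csp \<bullet> (y \<diamondop> Id2 C P) \<bullet> inv2 C crp"
proof -
  note iso [simp]
  have "inv2 C crq \<bullet> lr = (Id2 C R \<diamondop> x) \<bullet> inv2 C crp"
    by (rule iso2_transpose') (simp_all add: lr)
  then have "(csq \<bullet> (y \<diamondop> Id2 C Q) \<bullet> inv2 C crq) \<bullet> lr
      = csq \<bullet> ((y \<diamondop> Id2 C Q) \<bullet> (Id2 C R \<diamondop> x)) \<bullet> inv2 C crp"
    by simp
  also have "(y \<diamondop> Id2 C Q) \<bullet> (Id2 C R \<diamondop> x) = (Id2 C S \<diamondop> x) \<bullet> (y \<diamondop> Id2 C P)"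
    by (simp flip: interchange_simp)
  also have "csq \<bullet> ((Id2 C S \<diamondop> x) \<bullet> (y \<diamondop> Id2 C P)) \<bullet> inv2 C crp
      = (csq \<bullet> (Id2 C S \<diamondop> x)) \<bullet> (y \<diamondop> Id2 C P) \<bullet> inv2 C crp"
    by simp
  also have "\<dots> = (ls \<bullet> csp) \<bullet> (y \<diamondop> Id2 C P) \<bullet> inv2 C crp"
    by (simp only: ls)
  finally show ?thesis by simp
qed

text \<open>\<open>coh_natural\<close> turns the iterated left whiskerings by \<open>r\<close> and
  by \<open>s\<close> into horizontal composites with \<open>path C r\<close> and
  \<open>path C s\<close>, and there the interchange axiom of the bicategory applies.\<close>

lemma scell_interchange:
  assumes X: "cell X p q A B" and Y: "cell Y r s B D"
  shows "(Y \<rhd> q) \<odot> (r \<lhd> X) = (s \<lhd> X) \<odot> (Y \<rhd> p)"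
proof -
  obtain x where x: "X = (p, x, q)" "mor p A B" "mor q A B" "x \<in> Cell C" "Src C x = path C p" "Tgt C x = path C q"
    using X by (rule cellE)
  obtain y where y: "Y = (r, y, s)" "mor r B D" "mor s B D" "y \<in> Cell C" "Src C y = path C r" "Tgt C y = path C s"
    using Y by (rule cellE)
  show ?thesis
    using interchange_step[OF coh_natural[OF x(2,3) y(2) x(4-6)] coh_natural[OF x(2,3) y(3) x(4-6)]]
      x y lwhisk_simps[OF x(2,3) y(2) x(4-6)] lwhisk_simps[OF x(2,3) y(3) x(4-6)]
      path_simps[OF x(2)] path_simps[OF x(3)] path_simps[OF y(2)] path_simps[OF y(3)]
      coh_simps[OF y(2) x(2)] coh_simps[OF y(2) x(3)] coh_simps[OF y(3) x(2)] coh_simps[OF y(3) x(3)]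
    by simp
qed

lemma icell_split: "mor p A B \<Longrightarrow> icell (split C p) [path C p] p A B"
  using path_simps by (simp add: split_def icell_iff in_hom1_def)

lemma icell_join: "mor p A B \<Longrightarrow> icell (join C p) p [path C p] A B"
  using path_simps by (simp add: join_def icell_iff in_hom1_def)

section \<open>Comparison of refined data\<close>

lemma svcomp_left_cancel:
  assumes E: "icell E q r A B" and X: "cell X p q A B" and Y: "cell Y p q A B" and eq: "E \<odot> X = E \<odot> Y"
  shows "X = Y"
proof -
  note E' = icell_cell[OF icell_sinv[OF E]]
  have "X = sinv C E \<odot> E \<odot> X"
    using sinv_svcomp[OF E] sid_svcomp[OF X] svcomp_assoc[OF X icell_cell[OF E] E'] by simp
  also have "\<dots> = sinv C E \<odot> E \<odot> Y"
    by (simp only: eq)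
  also have "\<dots> = Y"
    using sinv_svcomp[OF E] sid_svcomp[OF Y] svcomp_assoc[OF Y icell_cell[OF E] E'] by simp
  finally show ?thesis .
qed

lemma svcomp_right_cancel:
  assumes E: "icell E p q A B" and X: "cell X q r A B" and Y: "cell Y q r A B" and eq: "X \<odot> E = Y \<odot> E"
  shows "X = Y"
proof -
  note E' = icell_cell[OF icell_sinv[OF E]]
  have "X = (X \<odot> E) \<odot> sinv C E"
    using svcomp_sinv[OF E] svcomp_sid[OF X] svcomp_assoc[OF E' icell_cell[OF E] X] by simp
  also have "\<dots> = (Y \<odot> E) \<odot> sinv C E"
    by (simp only: eq)
  also have "\<dots> = Y"
    using svcomp_sinv[OF E] svcomp_sid[OF Y] svcomp_assoc[OF E' icell_cell[OF E] Y] by simp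
  finally show ?thesis .
qed

text \<open>
  The comparison of two sets of data after refining them by \<open>z\<close> and \<open>z'\<close>: the invertible \<open>E\<close> and \<open>F\<close>
  identify the refined legs, and \<open>X\<close> and \<open>X'\<close> are corresponding 2-cells of the two sets.
\<close>

definition csq :: "'a list \<Rightarrow> 'a list \<Rightarrow> 'a list \<Rightarrow> ('a, 'c) scell \<Rightarrow> ('a, 'c) scell \<Rightarrow> ('a, 'c) scell
    \<Rightarrow> 'a list \<Rightarrow> ('a, 'c) scell \<Rightarrow> bool" where
  "csq z z' f E X X' g F \<longleftrightarrow>
     (\<exists>a a' b b' A A' B B' T Z. mor z Z A \<and> mor z' Z A' \<and>
        cell X (f @ a) (g @ b) A T \<and> cell X' (f @ a') (g @ b') A' T \<and>
        icell E (a @ z) (a' @ z') Z B \<and> icell F (b @ z) (b' @ z') Z B' \<and>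
        mor0 f B T \<and> mor0 g B' T) \<and>
     (X' \<rhd> z') \<odot> (f \<lhd> E) = (g \<lhd> F) \<odot> (X \<rhd> z)"

lemma csqI:
  assumes "mor z Z A" "mor z' Z A'" "cell X (f @ a) (g @ b) A T" "cell X' (f @ a') (g @ b') A' T"
    "icell E (a @ z) (a' @ z') Z B" "icell F (b @ z) (b' @ z') Z B'" "mor0 f B T" "mor0 g B' T"
    "(X' \<rhd> z') \<odot> (f \<lhd> E) = (g \<lhd> F) \<odot> (X \<rhd> z)"
  shows "csq z z' f E X X' g F"
  unfolding csq_def using assms by blast

lemma csqE:
  assumes "csq z z' f E X X' g F"
  obtains a a' b b' A A' B B' T Z where
    "mor z Z A" "mor z' Z A'" "cell X (f @ a) (g @ b) A T" "cell X' (f @ a') (g @ b') A' T"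
    "icell E (a @ z) (a' @ z') Z B" "icell F (b @ z) (b' @ z') Z B'" "mor0 f B T" "mor0 g B' T"
    "(X' \<rhd> z') \<odot> (f \<lhd> E) = (g \<lhd> F) \<odot> (X \<rhd> z)"
  using assms unfolding csq_def by blast

text \<open>A fixed cell \<open>X\<close> acts on the front of the list, the refinement changes only
  its tail, and the two commute by interchange. The segment \<open>p\<close> is common to both sets
  of data and lies between \<open>X\<close> and the compared legs.\<close>

lemma csq_natp:
  assumes X: "cell X f g B T" and p: "mor0 p P B" and E: "icell E (a @ z) (a' @ z') Z P"
    and a: "mor (p @ a) A B" "mor (p @ a') A' B" and z: "mor z Z A" "mor z' Z A'"
  shows "csq z z' (f @ p) E (X \<rhd> (p @ a)) (X \<rhd> (p @ a')) (g @ p) E"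
proof (rule csqI[OF z _ _ E E])
  show "cell (X \<rhd> (p @ a)) ((f @ p) @ a) ((g @ p) @ a) A T" "cell (X \<rhd> (p @ a')) ((f @ p) @ a') ((g @ p) @ a') A' T"
    using cell_srwhisk[OF X a(1)] cell_srwhisk[OF X a(2)] by simp_all
  show "mor0 (f @ p) P T" "mor0 (g @ p) P T"
    using mor0_append0I[OF p mor_mor0] cell_mor[OF X] by auto
  have pE: "icell (p \<lhd> E) (p @ a @ z) (p @ a' @ z') Z B"
    using icell_slwhisk(1)[OF E p] .
  show "((X \<rhd> (p @ a')) \<rhd> z') \<odot> ((f @ p) \<lhd> E) = ((g @ p) \<lhd> E) \<odot> ((X \<rhd> (p @ a)) \<rhd> z)"
    using scell_interchange[OF icell_cell[OF pE] X]
    by (simp only: srwhisk_append[OF X a(1) z(1)] srwhisk_append[OF X a(2) z(2)] slwhisk_append append.assoc)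
qed

lemma csq_nat:
  assumes X: "cell X f g B T" and E: "icell E (a @ z) (a' @ z') Z B"
    and a: "mor a A B" "mor a' A' B" and z: "mor z Z A" "mor z' Z A'"
  shows "csq z z' f E (X \<rhd> a) (X \<rhd> a') g E"
  using csq_natp[OF X _ E _ _ z, of "[]"] a by simp

text \<open>The case in which no leg stands behind \<open>X\<close>: the cell \<open>E\<close>
  compares the refinements themselves.\<close>

lemma csq_nat0:
  assumes X: "cell X f g A T" and E: "icell E z z' Z A"
  shows "csq z z' f E X X g E"
proof (rule csqI[where a = "[]" and a' = "[]" and b = "[]" and b' = "[]"])
  show "mor z Z A" "mor z' Z A" using cell_mor[OF icell_cell[OF E]] by auto
  show "mor0 f A T" "mor0 g A T" using cell_mor[OF X] mor_mor0 by blast+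
  show "(X \<rhd> z') \<odot> (f \<lhd> E) = (g \<lhd> E) \<odot> (X \<rhd> z)"
    using scell_interchange[OF icell_cell[OF E] X] .
qed (use X E in simp_all)

text \<open>Pasting along the shared comparison \<open>F\<close>. This is what allows a composite of
  2-cells to be compared factor by factor.\<close>

lemma csq_comp:
  assumes X: "csq z z' f E X X' g F" and Y: "csq z z' g F Y Y' h G"
  shows "csq z z' f E (Y \<odot> X) (Y' \<odot> X') h G"
  using X
proof (rule csqE)
  fix a a' b b' A A' B B' T Z
  assume z: "mor z Z A" "mor z' Z A'" and cX: "cell X (f @ a) (g @ b) A T" "cell X' (f @ a') (g @ b') A' T"
    and E: "icell E (a @ z) (a' @ z') Z B" and F: "icell F (b @ z) (b' @ z') Z B'"
    and f: "mor0 f B T" and g: "mor0 g B' T"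
    and eqX: "(X' \<rhd> z') \<odot> (f \<lhd> E) = (g \<lhd> F) \<odot> (X \<rhd> z)"
  obtain c c' d d' A1 A1' D D' T1 Z1 where
    z1: "mor z Z1 A1" "mor z' Z1 A1'" and cY: "cell Y (g @ c) (h @ d) A1 T1" "cell Y' (g @ c') (h @ d') A1' T1"
    and F1: "icell F (c @ z) (c' @ z') Z1 D" and G: "icell G (d @ z) (d' @ z') Z1 D'"
    and h: "mor0 h D' T1"
    and eqY: "(Y' \<rhd> z') \<odot> (g \<lhd> F) = (h \<lhd> G) \<odot> (Y \<rhd> z)"
    using Y by (rule csqE)
  \<comment> \<open>\<open>csq\<close> hides the types of its cells under an existential quantifier.
    They are recovered from the shared cell \<open>F\<close> and from \<open>z\<close>,
    \<open>z'\<close>, since a cell determines its source, its target and their end objects.\<close>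
  have eqs: "c = b" "c' = b'" "A1 = A" "A1' = A'" "Z1 = Z"
    using cell_unique[OF icell_cell[OF F] icell_cell[OF F1]] mor_unique[OF z(1) z1(1)]
      mor_unique[OF z(2) z1(2)] by auto
  have "mor (g @ b) A T1" "mor (g @ b) A T"
    using cX(1) cY(1) eqs by (auto simp: cell_def)
  then have T: "T1 = T" using mor_unique by blast
  note cY' = cY[unfolded eqs T] and G' = G[unfolded eqs] and h' = h[unfolded T]
  note Xz = cell_srwhisk[OF cX(1) z(1)] and Xz' = cell_srwhisk[OF cX(2) z(2)]
    and Yz = cell_srwhisk[OF cY'(1) z(1)] and Yz' = cell_srwhisk[OF cY'(2) z(2)]
  note cE = cell_slwhisk[OF icell_cell[OF E] f] and cF = cell_slwhisk[OF icell_cell[OF F] g]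
    and cG = cell_slwhisk[OF icell_cell[OF G'] h']
  show ?thesis
  proof (rule csqI[OF z _ _ E G' f h'])
    show "cell (Y \<odot> X) (f @ a) (h @ d) A T" "cell (Y' \<odot> X') (f @ a') (h @ d') A' T"
      using cX cY' by (blast intro: cell_svcomp)+
    have "((Y' \<odot> X') \<rhd> z') \<odot> (f \<lhd> E) = (Y' \<rhd> z') \<odot> (X' \<rhd> z') \<odot> (f \<lhd> E)"
      using srwhisk_svcomp[OF cX(2) cY'(2) z(2)] svcomp_assoc Xz' Yz' cE
      by (metis append.assoc)
    also have "\<dots> = (Y' \<rhd> z') \<odot> (g \<lhd> F) \<odot> (X \<rhd> z)"
      by (simp only: eqX)
    also have "\<dots> = ((Y' \<rhd> z') \<odot> (g \<lhd> F)) \<odot> (X \<rhd> z)"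
      using svcomp_assoc Xz cF Yz' by (metis append.assoc)
    also have "\<dots> = (h \<lhd> G) \<odot> (Y \<rhd> z) \<odot> (X \<rhd> z)"
      using eqY svcomp_assoc Xz Yz cG by (metis append.assoc)
    also have "\<dots> = (h \<lhd> G) \<odot> ((Y \<odot> X) \<rhd> z)"
      using srwhisk_svcomp[OF cX(1) cY'(1) z(1)] by simp
    finally show "((Y' \<odot> X') \<rhd> z') \<odot> (f \<lhd> E) = (h \<lhd> G) \<odot> ((Y \<odot> X) \<rhd> z)" .
  qed
qed

text \<open>Pasting in the other direction, through an intermediate set of data. It serves to
  collapse lists and to prove transitivity.\<close>

lemma csq_paste:
  assumes X: "csq z z' f E X X' g F" and Y: "csq z' z'' f E' X' X'' g F'"
  shows "csq z z'' f (E' \<odot> E) X X'' g (F' \<odot> F)"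
  using X
proof (rule csqE)
  fix a a' b b' A A' B B' T Z
  assume z: "mor z Z A" "mor z' Z A'" and cX: "cell X (f @ a) (g @ b) A T" "cell X' (f @ a') (g @ b') A' T"
    and E: "icell E (a @ z) (a' @ z') Z B" and F: "icell F (b @ z) (b' @ z') Z B'"
    and f: "mor0 f B T" and g: "mor0 g B' T"
    and eqX: "(X' \<rhd> z') \<odot> (f \<lhd> E) = (g \<lhd> F) \<odot> (X \<rhd> z)"
  obtain c c' d d' A1 A1' D D' T1 Z1 where
    z1: "mor z' Z1 A1" "mor z'' Z1 A1'" and cY: "cell X' (f @ c) (g @ d) A1 T1" "cell X'' (f @ c') (g @ d') A1' T1"
    and F1: "icell E' (c @ z') (c' @ z'') Z1 D" and G: "icell F' (d @ z') (d' @ z'') Z1 D'"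
    and fh: "mor0 f D T1" "mor0 g D' T1"
    and eqY: "(X'' \<rhd> z'') \<odot> (f \<lhd> E') = (g \<lhd> F') \<odot> (X' \<rhd> z')"
    using Y by (rule csqE)
  have eqs: "c = a'" "d = b'" "A1 = A'" "Z1 = Z" "T1 = T"
    using cell_unique[OF cX(2) cY(1)] mor_unique[OF z(2) z1(1)] by auto
  have "mor (a' @ z') Z B" "mor (a' @ z') Z D" "mor (b' @ z') Z B'" "mor (b' @ z') Z D'"
    using E F F1 G eqs by (auto simp: icell_def cell_def)
  then have D: "D = B" "D' = B'" using mor_unique by blast+
  note z'' = z1(2)[unfolded eqs] and cX'' = cY(2)[unfolded eqs] and E' = F1[unfolded eqs D] and F' = G[unfolded eqs D]
  note EE = icell_cell[OF E] and FF = icell_cell[OF F] and EE' = icell_cell[OF E'] and FF' = icell_cell[OF F']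
  note Xz = cell_srwhisk[OF cX(1) z(1)] and Xz' = cell_srwhisk[OF cX(2) z(2)] and Xz'' = cell_srwhisk[OF cX'' z'']
  show ?thesis
  proof (rule csqI[OF z(1) z'' cX(1) cX'' icell_svcomp[OF E E'] icell_svcomp[OF F F'] f g])
    have "(X'' \<rhd> z'') \<odot> (f \<lhd> (E' \<odot> E)) = ((X'' \<rhd> z'') \<odot> (f \<lhd> E')) \<odot> (f \<lhd> E)"
      using slwhisk_svcomp[OF EE EE' f] svcomp_assoc Xz'' cell_slwhisk[OF EE f] cell_slwhisk[OF EE' f]
      by (metis append.assoc)
    also have "\<dots> = (g \<lhd> F') \<odot> (X' \<rhd> z') \<odot> (f \<lhd> E)"
      using eqY svcomp_assoc Xz' cell_slwhisk[OF EE f] cell_slwhisk[OF FF' g] by (metis append.assoc)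
    also have "\<dots> = ((g \<lhd> F') \<odot> (g \<lhd> F)) \<odot> (X \<rhd> z)"
      using eqX svcomp_assoc Xz cell_slwhisk[OF FF g] cell_slwhisk[OF FF' g] by (metis append.assoc)
    also have "\<dots> = (g \<lhd> (F' \<odot> F)) \<odot> (X \<rhd> z)"
      using slwhisk_svcomp[OF FF FF' g] by simp
    finally show "(X'' \<rhd> z'') \<odot> (f \<lhd> (E' \<odot> E)) = (g \<lhd> (F' \<odot> F)) \<odot> (X \<rhd> z)" .
  qed
qed

lemma scell_transpose:
  assumes E: "icell E p q A B" and E': "icell E' r s A B" and X: "cell X p r A B" and Y: "cell Y q s A B"
    and eq: "Y \<odot> E = E' \<odot> X"
  shows "X \<odot> sinv C E = sinv C E' \<odot> Y"
proof (rule svcomp_right_cancel[OF E])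
  note iE = icell_cell[OF icell_sinv[OF E]] and iE' = icell_cell[OF icell_sinv[OF E']]
  show "cell (X \<odot> sinv C E) q r A B" "cell (sinv C E' \<odot> Y) q r A B"
    using iE iE' X Y by (blast intro: cell_svcomp)+
  have "(X \<odot> sinv C E) \<odot> E = X"
    using svcomp_assoc[OF icell_cell[OF E] iE X] sinv_svcomp[OF E] svcomp_sid[OF X] by simp
  also have "\<dots> = sinv C E' \<odot> (E' \<odot> X)"
    using svcomp_assoc[OF X icell_cell[OF E'] iE'] sinv_svcomp[OF E'] sid_svcomp[OF X] by simp
  also have "\<dots> = (sinv C E' \<odot> Y) \<odot> E"
    using svcomp_assoc[OF icell_cell[OF E] Y iE'] eq by simp
  finally show "(X \<odot> sinv C E) \<odot> E = (sinv C E' \<odot> Y) \<odot> E" .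
qed

lemma csq_sym:
  assumes "csq z z' f E X X' g F"
  shows "csq z' z f (sinv C E) X' X g (sinv C F)"
  using assms
proof (rule csqE)
  fix a a' b b' A A' B B' T Z
  assume z: "mor z Z A" "mor z' Z A'" and cX: "cell X (f @ a) (g @ b) A T" "cell X' (f @ a') (g @ b') A' T"
    and E: "icell E (a @ z) (a' @ z') Z B" and F: "icell F (b @ z) (b' @ z') Z B'"
    and f: "mor0 f B T" and g: "mor0 g B' T"
    and eq: "(X' \<rhd> z') \<odot> (f \<lhd> E) = (g \<lhd> F) \<odot> (X \<rhd> z)"
  show ?thesis
  proof (rule csqI[OF z(2,1) cX(2,1) icell_sinv[OF E] icell_sinv[OF F] f g])
    show "(X \<rhd> z) \<odot> (f \<lhd> sinv C E) = (g \<lhd> sinv C F) \<odot> (X' \<rhd> z')"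
      using scell_transpose[of "f \<lhd> E" "f @ a @ z" "f @ a' @ z'" Z T "g \<lhd> F" "g @ b @ z" "g @ b' @ z'" "X \<rhd> z" "X' \<rhd> z'"]
        icell_slwhisk[OF E f] icell_slwhisk[OF F g] cell_srwhisk[OF cX(1) z(1)] cell_srwhisk[OF cX(2) z(2)] eq
      by simp
  qed
qed

text \<open>Inverting the cells \<open>X\<close> and \<open>X'\<close> exchanges the two comparisons
  \<open>E\<close> and \<open>F\<close>, whereas \<open>csq_sym\<close> inverts the comparisons and
  exchanges the two sets of data. Both are the same transposition of a commuting square.\<close>

lemma csq_inv:
  assumes "csq z z' f E X X' g F" "iso2 C (the_cell X)" "iso2 C (the_cell X')"
  shows "csq z z' g F (sinv C X) (sinv C X') f E"
  using assms(1)
proof (rule csqE)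
  fix a a' b b' A A' B B' T Z
  assume z: "mor z Z A" "mor z' Z A'" and cX: "cell X (f @ a) (g @ b) A T" "cell X' (f @ a') (g @ b') A' T"
    and E: "icell E (a @ z) (a' @ z') Z B" and F: "icell F (b @ z) (b' @ z') Z B'"
    and f: "mor0 f B T" and g: "mor0 g B' T"
    and eq: "(X' \<rhd> z') \<odot> (f \<lhd> E) = (g \<lhd> F) \<odot> (X \<rhd> z)"
  have X: "icell X (f @ a) (g @ b) A T" and X': "icell X' (f @ a') (g @ b') A' T"
    using cX assms by (auto simp: icell_def)
  show ?thesis
  proof (rule csqI[OF z icell_cell[OF icell_sinv[OF X]] icell_cell[OF icell_sinv[OF X']] F E g f])
    show "(sinv C X' \<rhd> z') \<odot> (g \<lhd> F) = (f \<lhd> E) \<odot> (sinv C X \<rhd> z)"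
      using scell_transpose[of "X \<rhd> z" "f @ a @ z" "g @ b @ z" Z T "X' \<rhd> z'" "f @ a' @ z'" "g @ b' @ z'" "f \<lhd> E" "g \<lhd> F"]
        icell_srwhisk[OF X z(1)] icell_srwhisk[OF X' z(2)] cell_slwhisk[OF icell_cell[OF E] f]
        cell_slwhisk[OF icell_cell[OF F] g] eq
      by simp
  qed
qed

text \<open>The typing of \<open>X\<close> fixes the object \<open>T\<close>, which
  \<open>csq\<close> does not display.\<close>

lemma csq_lwhisk:
  assumes "csq z z' f E X X' g F" "cell X p q A T" "mor0 h T T'"
  shows "csq z z' (h @ f) E (h \<lhd> X) (h \<lhd> X') (h @ g) F"
  using assms(1)
proof (rule csqE)
  fix a a' b b' A1 A' B B' T1 Z
  assume z: "mor z Z A1" "mor z' Z A'" and cX1: "cell X (f @ a) (g @ b) A1 T1" "cell X' (f @ a') (g @ b') A' T1"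
    and E: "icell E (a @ z) (a' @ z') Z B" and F: "icell F (b @ z) (b' @ z') Z B'"
    and fg1: "mor0 f B T1" "mor0 g B' T1"
    and eq: "(X' \<rhd> z') \<odot> (f \<lhd> E) = (g \<lhd> F) \<odot> (X \<rhd> z)"
  have "T1 = T" using cell_unique[OF cX1(1) assms(2)] by simp
  note cX = cX1[unfolded this] and f = fg1(1)[unfolded this] and g = fg1(2)[unfolded this]
  note h = assms(3)
  show ?thesis
  proof (rule csqI[OF z _ _ E F mor0_append0I[OF f h] mor0_append0I[OF g h]])
    show "cell (h \<lhd> X) ((h @ f) @ a) ((h @ g) @ b) A1 T'" "cell (h \<lhd> X') ((h @ f) @ a') ((h @ g) @ b') A' T'"
      using cell_slwhisk[OF cX(1) h] cell_slwhisk[OF cX(2) h] by simp_all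
    have "((h \<lhd> X') \<rhd> z') \<odot> ((h @ f) \<lhd> E) = h \<lhd> ((X' \<rhd> z') \<odot> (f \<lhd> E))"
      unfolding slwhisk_append slwhisk_srwhisk[OF cX(2) z(2) h]
      using slwhisk_svcomp[OF _ _ h] cell_srwhisk[OF cX(2) z(2)] cell_slwhisk[OF icell_cell[OF E] f]
      by (metis append.assoc)
    also have "\<dots> = ((h @ g) \<lhd> F) \<odot> ((h \<lhd> X) \<rhd> z)"
      unfolding slwhisk_append slwhisk_srwhisk[OF cX(1) z(1) h] eq
      using slwhisk_svcomp[OF _ _ h] cell_srwhisk[OF cX(1) z(1)] cell_slwhisk[OF icell_cell[OF F] g]
      by (metis append.assoc)
    finally show "((h \<lhd> X') \<rhd> z') \<odot> ((h @ f) \<lhd> E) = ((h @ g) \<lhd> F) \<odot> ((h \<lhd> X) \<rhd> z)" .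
  qed
qed

text \<open>Commutativity is asked for only after restriction along \<open>r\<close>. So the rule
  covers both the restriction of a given square and the creation of one from an equation that holds
  only after refinement, as in \<open>csq_cancel\<close>.\<close>

lemma csq_restrictI:
  assumes z: "mor z Z A" "mor z' Z A'" and cX: "cell X (f @ a) (g @ b) A T" "cell X' (f @ a') (g @ b') A' T"
    and E: "icell E (a @ z) (a' @ z') Z B" and F: "icell F (b @ z) (b' @ z') Z B'"
    and f: "mor0 f B T" and g: "mor0 g B' T" and r: "mor r D Z"
    and eq: "((X' \<rhd> z') \<odot> (f \<lhd> E)) \<rhd> r = ((g \<lhd> F) \<odot> (X \<rhd> z)) \<rhd> r"
  shows "csq (z @ r) (z' @ r) f (E \<rhd> r) X X' g (F \<rhd> r)"
proof (rule csqI[OF mor_appendI[OF r z(1)] mor_appendI[OF r z(2)] cX _ _ f g])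
  show "icell (E \<rhd> r) (a @ z @ r) (a' @ z' @ r) D B" "icell (F \<rhd> r) (b @ z @ r) (b' @ z' @ r) D B'"
    using icell_srwhisk(1)[OF E r] icell_srwhisk(1)[OF F r] by simp_all
  have "(X' \<rhd> (z' @ r)) \<odot> (f \<lhd> (E \<rhd> r)) = ((X' \<rhd> z') \<odot> (f \<lhd> E)) \<rhd> r"
    unfolding srwhisk_append[OF cX(2) z(2) r, symmetric] slwhisk_srwhisk[OF icell_cell[OF E] r f, symmetric]
    using srwhisk_svcomp[OF _ _ r] cell_srwhisk[OF cX(2) z(2)] cell_slwhisk[OF icell_cell[OF E] f]
    by (metis append.assoc)
  also have "\<dots> = (g \<lhd> (F \<rhd> r)) \<odot> (X \<rhd> (z @ r))"
    unfolding srwhisk_append[OF cX(1) z(1) r, symmetric] slwhisk_srwhisk[OF icell_cell[OF F] r g, symmetric] eq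
    using srwhisk_svcomp[OF _ _ r] cell_srwhisk[OF cX(1) z(1)] cell_slwhisk[OF icell_cell[OF F] g]
    by (metis append.assoc)
  finally show "(X' \<rhd> (z' @ r)) \<odot> (f \<lhd> (E \<rhd> r)) = (g \<lhd> (F \<rhd> r)) \<odot> (X \<rhd> (z @ r))" .
qed

lemma csq_restrict:
  assumes "csq z z' f E X X' g F" "mor r D Z" "mor z Z A"
  shows "csq (z @ r) (z' @ r) f (E \<rhd> r) X X' g (F \<rhd> r)"
  using assms(1)
proof (rule csqE)
  fix a a' b b' A1 A' B B' T Z1
  assume z: "mor z Z1 A1" "mor z' Z1 A'" and cX: "cell X (f @ a) (g @ b) A1 T" "cell X' (f @ a') (g @ b') A' T"
    and E: "icell E (a @ z) (a' @ z') Z1 B" and F: "icell F (b @ z) (b' @ z') Z1 B'"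
    and f: "mor0 f B T" and g: "mor0 g B' T"
    and eq: "(X' \<rhd> z') \<odot> (f \<lhd> E) = (g \<lhd> F) \<odot> (X \<rhd> z)"
  have "Z1 = Z" using mor_unique[OF z(1) assms(3)] by simp
  with assms(2) have "mor r D Z1" by simp
  from csq_restrictI[OF z cX E F f g this] eq show ?thesis by simp
qed

text \<open>Invertibility is recorded apart from \<open>csq\<close>: the first 2-cell of a
  representative and the cells to be inverted need it, while the second 2-cell and the lift
  \<open>\<lambda>\<close> are in general not invertible.\<close>

definition icsq :: "'a list \<Rightarrow> 'a list \<Rightarrow> 'a list \<Rightarrow> ('a, 'c) scell \<Rightarrow> ('a, 'c) scell \<Rightarrow> ('a, 'c) scell
    \<Rightarrow> 'a list \<Rightarrow> ('a, 'c) scell \<Rightarrow> bool" where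
  "icsq z z' f E X X' g F \<longleftrightarrow> csq z z' f E X X' g F \<and> iso2 C (the_cell X) \<and> iso2 C (the_cell X')"

lemma icsq_csq: "icsq z z' f E X X' g F \<Longrightarrow> csq z z' f E X X' g F"
  by (simp add: icsq_def)

lemma icsq_inv: "icsq z z' f E X X' g F \<Longrightarrow> icsq z z' g F (sinv C X) (sinv C X') f E"
  unfolding icsq_def using csq_inv[of z z' f E X X' g F] by (cases X; cases X') auto

lemma csq_cells:
  assumes "csq z z' f E X X' g F" "icell E (a @ z) (a' @ z') Z B" "icell F (b @ z) (b' @ z') Z B'"
    "mor z Z A" "mor z' Z A'"
  obtains T where "cell X (f @ a) (g @ b) A T" "cell X' (f @ a') (g @ b') A' T"
  using assms(1)
proof (rule csqE)
  fix a1 a1' b1 b1' A1 A1' B1 B1' T Z1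
  assume h: "mor z Z1 A1" "mor z' Z1 A1'"
    "cell X (f @ a1) (g @ b1) A1 T" "cell X' (f @ a1') (g @ b1') A1' T"
    "icell E (a1 @ z) (a1' @ z') Z1 B1" "icell F (b1 @ z) (b1' @ z') Z1 B1'"
  have "a1 = a" "a1' = a'" "b1 = b" "b1' = b'" "A1 = A" "A1' = A'"
    using cell_unique[OF icell_cell[OF h(5)] icell_cell[OF assms(2)]]
      cell_unique[OF icell_cell[OF h(6)] icell_cell[OF assms(3)]]
      mor_unique[OF h(1) assms(4)] mor_unique[OF h(2) assms(5)] by auto
  with h(3,4) show ?thesis using that by blast
qed

lemma icsq_comp:
  assumes X: "icsq z z' f E X X' g F" and Y: "icsq z z' g F Y Y' h G"
  shows "icsq z z' f E (Y \<odot> X) (Y' \<odot> X') h G"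
proof -
  note c = icsq_csq[OF X] icsq_csq[OF Y]
  show ?thesis
    using c(1)
  proof (rule csqE)
    fix a a' b b' A A' B B' T Z
    assume z: "mor z Z A" "mor z' Z A'" and cX: "cell X (f @ a) (g @ b) A T" "cell X' (f @ a') (g @ b') A' T"
      and F: "icell F (b @ z) (b' @ z') Z B'"
    obtain c c' d d' A1 A1' T1 D Z1 where cY: "cell Y (g @ c) (h @ d) A1 T1" "cell Y' (g @ c') (h @ d') A1' T1"
      and F1: "icell F (c @ z) (c' @ z') Z1 D"
      using c(2) by (rule csqE)
    have eqs: "c = b" "c' = b'" using cell_unique[OF icell_cell[OF F] icell_cell[OF F1]] by auto
    have gb: "mor (g @ b) A T" "mor (g @ b) A1 T1" "mor (g @ b') A' T" "mor (g @ b') A1' T1"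
      using cX cY eqs by (auto simp: cell_def)
    have eq: "A1 = A" "A1' = A'" "T1 = T"
      using mor_unique[OF gb(1,2)] mor_unique[OF gb(3,4)] by auto
    have "icell (Y \<odot> X) (f @ a) (h @ d) A T" "icell (Y' \<odot> X') (f @ a') (h @ d') A' T"
      using X Y cX cY unfolding eqs eq icsq_def by (blast intro: icell_svcomp[unfolded icell_def] icell_svcomp icell_def[THEN iffD2])+
    then show ?thesis
      using csq_comp[OF c] by (simp add: icsq_def icell_def)
  qed
qed

lemma icsq_natp:
  assumes X: "icell X f g B T" and p: "mor0 p P B" and E: "icell E (a @ z) (a' @ z') Z P"
    and a: "mor (p @ a) A B" "mor (p @ a') A' B" and z: "mor z Z A" "mor z' Z A'"
  shows "icsq z z' (f @ p) E (X \<rhd> (p @ a)) (X \<rhd> (p @ a')) (g @ p) E"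
  using csq_natp[OF icell_cell[OF X] p E a z] icell_srwhisk(1)[OF X a(1)] icell_srwhisk(1)[OF X a(2)]
  by (simp add: icsq_def icell_def)

lemma icsq_nat:
  assumes X: "icell X f g B T" and E: "icell E (a @ z) (a' @ z') Z B"
    and a: "mor a A B" "mor a' A' B" and z: "mor z Z A" "mor z' Z A'"
  shows "icsq z z' f E (X \<rhd> a) (X \<rhd> a') g E"
  using icsq_natp[OF X _ E _ _ z, of "[]"] a by simp

lemma icsq_restrict:
  "icsq z z' f E X X' g F \<Longrightarrow> mor r D Z \<Longrightarrow> mor z Z A \<Longrightarrow> icsq (z @ r) (z' @ r) f (E \<rhd> r) X X' g (F \<rhd> r)"
  unfolding icsq_def using csq_restrict by blast

lemma icell_restrict:
  "icell E (a @ z) (b @ z') Z B \<Longrightarrow> mor r D Z \<Longrightarrow> icell (E \<rhd> r) (a @ z @ r) (b @ z' @ r) D B"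
  using icell_srwhisk(1)[of E "a @ z" "b @ z'" Z B r D] by simp

lemma icsq_lwhisk:
  assumes "icsq z z' f E X X' g F" "cell X p q A T" "mor0 h T T'"
  shows "icsq z z' (h @ f) E (h \<lhd> X) (h \<lhd> X') (h @ g) F"
proof -
  note c = icsq_csq[OF assms(1)]
  show ?thesis
    using c
  proof (rule csqE)
    fix a a' b b' A1 A1' T1
    assume cX: "cell X (f @ a) (g @ b) A1 T1" "cell X' (f @ a') (g @ b') A1' T1"
    have "T1 = T" using cell_unique[OF cX(1) assms(2)] by simp
    with cX assms(1) have iX: "icell X (f @ a) (g @ b) A1 T" "icell X' (f @ a') (g @ b') A1' T"
      by (simp_all add: icsq_def icell_def)
    show ?thesis
      using csq_lwhisk[OF c assms(2,3)] icell_slwhisk(1)[OF iX(1) assms(3)] icell_slwhisk(1)[OF iX(2) assms(3)]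
      by (simp add: icsq_def icell_def)
  qed
qed

text \<open>Regrouping of a list: a segment moves from the fixed front into the compared tail, and
  the comparison is whiskered by it. This passes from a comparison of auxiliary legs to one of the
  composite legs of the result.\<close>

lemma csq_shift:
  assumes "csq z z' (f @ p) E X X' (g @ q) F" and p: "mor0 p B D" and q: "mor0 q B' D'"
    and f: "mor0 f D T" and g: "mor0 g D' T"
    and E: "icell E (a @ z) (a' @ z') Z B" and F: "icell F (b @ z) (b' @ z') Z B'"
    and X: "cell X s t A T"
  shows "csq z z' f (p \<lhd> E) X X' g (q \<lhd> F)"
  using assms(1)
proof (rule csqE)
  fix a1 a1' b1 b1' A1 A1' B1 B1' T1 Z1
  assume z: "mor z Z1 A1" "mor z' Z1 A1'"
    and cX: "cell X ((f @ p) @ a1) ((g @ q) @ b1) A1 T1" "cell X' ((f @ p) @ a1') ((g @ q) @ b1') A1' T1"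
    and E1: "icell E (a1 @ z) (a1' @ z') Z1 B1" and F1: "icell F (b1 @ z) (b1' @ z') Z1 B1'"
    and eq: "(X' \<rhd> z') \<odot> ((f @ p) \<lhd> E) = ((g @ q) \<lhd> F) \<odot> (X \<rhd> z)"
  have eqs: "T1 = T" "B1 = B" "B1' = B'"
    using cell_unique[OF cX(1) X] cell_unique[OF icell_cell[OF E1] icell_cell[OF E]]
      cell_unique[OF icell_cell[OF F1] icell_cell[OF F]] by auto
  show ?thesis
  proof (rule csqI[OF z _ _ _ _ f g])
    show "cell X (f @ p @ a1) (g @ q @ b1) A1 T" "cell X' (f @ p @ a1') (g @ q @ b1') A1' T"
      using cX eqs by simp_all
    show "icell (p \<lhd> E) ((p @ a1) @ z) ((p @ a1') @ z') Z1 D" "icell (q \<lhd> F) ((q @ b1) @ z) ((q @ b1') @ z') Z1 D'"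
      using icell_slwhisk(1) E1 F1 p q eqs by simp_all
    show "(X' \<rhd> z') \<odot> (f \<lhd> p \<lhd> E) = (g \<lhd> q \<lhd> F) \<odot> (X \<rhd> z)"
      using eq by (simp only: slwhisk_append)
  qed
qed

text \<open>For invertible \<open>X\<close> the square determines the missing side: \<open>F\<close>
  is forced to be the conjugate of the whiskered \<open>E\<close> by \<open>X\<close> and
  \<open>X'\<close>. Nothing is refined, but the legs are compared only together with everything in
  front of them.\<close>

lemma csq_push:
  assumes z: "mor z Z A" "mor z' Z A'" and X: "icell X (f @ a) b A T" and X': "icell X' (f @ a') b' A' T"
    and E: "icell E (a @ z) (a' @ z') Z B" and f: "mor0 f B T"
  obtains F where "icell F (b @ z) (b' @ z') Z T" "icsq z z' f E X X' [] F"
proof -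
  let ?Xz = "X \<rhd> z" and ?Xz' = "X' \<rhd> z'" and ?fE = "f \<lhd> E"
  have Xz: "icell ?Xz (f @ a @ z) (b @ z) Z T" "icell ?Xz' (f @ a' @ z') (b' @ z') Z T"
    using icell_srwhisk(1)[OF X z(1)] icell_srwhisk(1)[OF X' z(2)] by simp_all
  have fE: "icell ?fE (f @ a @ z) (f @ a' @ z') Z T"
    using icell_slwhisk(1)[OF E f] .
  let ?S = "(?Xz' \<odot> ?fE) \<odot> sinv C ?Xz"
  have S: "icell ?S (b @ z) (b' @ z') Z T"
    using icell_svcomp[OF icell_sinv[OF Xz(1)] icell_svcomp[OF fE Xz(2)]] .
  have "?S \<odot> ?Xz = ?Xz' \<odot> ?fE"
    using svcomp_assoc[OF icell_cell[OF Xz(1)] icell_cell[OF icell_sinv[OF Xz(1)]] icell_cell[OF icell_svcomp[OF fE Xz(2)]]]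
      sinv_svcomp[OF Xz(1)] svcomp_sid[OF icell_cell[OF icell_svcomp[OF fE Xz(2)]]] by simp
  moreover have "cell X (f @ a) ([] @ b) A T" "cell X' (f @ a') ([] @ b') A' T"
    using X X' by (simp_all add: icell_cell)
  ultimately have "csq z z' f E X X' [] ?S"
    using csqI[OF z _ _ E S f, of X "[]" X'] by simp
  with that S X X' show ?thesis by (simp add: icsq_def icell_def)
qed

text \<open>The 2-cells of a representative run between single composites, while comparisons are
  made on lists. Flattening \<open>p1\<close>, \<open>p2\<close> and \<open>z\<close> by
  \<open>join\<close> is itself a comparison square, and can therefore be pasted to others.\<close>

lemma csq_collapse:
  assumes A: "cell A ([w1] @ p1) ([w2] @ p2) D T" and z: "mor z Z D"
    and p1: "mor p1 D (Dom C w1)" and p2: "mor p2 D (Dom C w2)"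
  shows "csq z [path C z] [w1] ((join C p1 \<rhd> [path C z]) \<odot> (p1 \<lhd> join C z))
    A ([w1, path C p1], the_cell A, [w2, path C p2])
    [w2] ((join C p2 \<rhd> [path C z]) \<odot> (p2 \<lhd> join C z))"
proof -
  \<comment> \<open>\<open>A\<close> and \<open>?A\<close> have the same underlying 2-morphism: the
    lists \<open>w1 # p1\<close> and \<open>[w1, path C p1]\<close> have the same right-bracketed
    composite.\<close>
  let ?z = "[path C z]" and ?A = "([w1, path C p1], the_cell A, [w2, path C p2])"
  have mz: "mor ?z Z D" using path_simps[OF z] by (simp add: in_hom1_def)
  have "mor ([w1] @ p1) D T" "mor ([w2] @ p2) D T" using A by (auto simp: cell_def)
  then have w: "mor [w1] (Dom C w1) T" "mor [w2] (Dom C w2) T"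
    using mor_Nil[OF p1] mor_Nil[OF p2] by (auto simp: mor_Cons)
  have pp: "mor [path C p1] D (Dom C w1)" "mor [path C p2] D (Dom C w2)"
    using path_simps[OF p1] path_simps[OF p2] by (simp_all add: in_hom1_def)
  have cA: "cell ?A ([w1] @ [path C p1]) ([w2] @ [path C p2]) D T"
    using A mor_appendI[OF pp(1) w(1)] mor_appendI[OF pp(2) w(2)] mor_Nil[OF p1] mor_Nil[OF p2]
    by (auto simp: cell_def path_Cons)
  have "csq z ?z ([w1] @ p1) (join C z) A A ([w2] @ p2) (join C z)"
    using csq_nat0[OF A icell_join[OF z]] .
  from csq_shift[OF this mor_mor0[OF p1] mor_mor0[OF p2] mor_mor0[OF w(1)] mor_mor0[OF w(2)] _ _ A,
      of "[]" "[]" Z "[]" "[]"] icell_join[OF z]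
  have 1: "csq z ?z [w1] (p1 \<lhd> join C z) A A [w2] (p2 \<lhd> join C z)" by simp
  have 2: "csq ?z ?z [w1] (join C p1 \<rhd> ?z) A ?A [w2] (join C p2 \<rhd> ?z)"
  proof (rule csqI[OF mz mz A cA icell_srwhisk(1)[OF icell_join[OF p1] mz] icell_srwhisk(1)[OF icell_join[OF p2] mz]
        mor_mor0[OF w(1)] mor_mor0[OF w(2)]])
    have j: "cell ([w1] \<lhd> join C p1) ([w1] @ p1) ([w1] @ [path C p1]) D T"
      "cell ([w2] \<lhd> join C p2) ([w2] @ p2) ([w2] @ [path C p2]) D T"
      using cell_slwhisk[OF icell_cell[OF icell_join[OF p1]] mor_mor0[OF w(1)]]
        cell_slwhisk[OF icell_cell[OF icell_join[OF p2]] mor_mor0[OF w(2)]] by simp_all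
    have "?A \<odot> ([w1] \<lhd> join C p1) = ([w2] \<lhd> join C p2) \<odot> A"
      using A path_simps[OF p1] path_simps[OF p2] w mor_Nil[OF p1] mor_Nil[OF p2]
      by (elim cellE) (simp add: join_def in_hom1_def path_Cons)
    then have "(?A \<odot> ([w1] \<lhd> join C p1)) \<rhd> ?z = (([w2] \<lhd> join C p2) \<odot> A) \<rhd> ?z" by simp
    then show "(?A \<rhd> ?z) \<odot> ([w1] \<lhd> (join C p1 \<rhd> ?z)) = ([w2] \<lhd> (join C p2 \<rhd> ?z)) \<odot> (A \<rhd> ?z)"
      using srwhisk_svcomp[OF j(1) cA mz] srwhisk_svcomp[OF A j(2) mz]
        slwhisk_srwhisk[OF icell_cell[OF icell_join[OF p1]] mz mor_mor0[OF w(1)]]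
        slwhisk_srwhisk[OF icell_cell[OF icell_join[OF p2]] mz mor_mor0[OF w(2)]]
      by simp
  qed
  from csq_paste[OF 1 2] show ?thesis .
qed

text \<open>The right-hand side is the equation in \<open>equiv_frac2\<close>. There the cell
  \<open>\<sigma>1\<close> runs from the primed legs to the unprimed ones, against the direction of
  \<open>E\<close>, and so it appears as \<open>sinv C E\<close>.\<close>

lemma csq_single_iff:
  assumes z: "mor [z] Z D" "mor [z'] Z D'" and X: "cell X [w1, v1] [w2, v2] D T" and X': "cell X' [w1, v1'] [w2, v2'] D' T"
    and E: "icell E [v1, z] [v1', z'] Z B" and F: "icell F [v2, z] [v2', z'] Z B'"
    and w: "mor [w1] B T" "mor [w2] B' T"
  shows "csq [z] [z'] [w1] E X X' [w2] F \<longleftrightarrow>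
    ([w2] \<lhd> F) \<odot> (X \<rhd> [z]) \<odot> ([w1] \<lhd> sinv C E) = X' \<rhd> [z']"
proof -
  let ?E = "[w1] \<lhd> E" and ?F = "[w2] \<lhd> F" and ?X = "X \<rhd> [z]" and ?X' = "X' \<rhd> [z']"
  have wE: "icell ?E [w1, v1, z] [w1, v1', z'] Z T" and wF: "cell ?F [w2, v2, z] [w2, v2', z'] Z T"
    using icell_slwhisk(1)[OF E mor_mor0[OF w(1)]] cell_slwhisk[OF icell_cell[OF F] mor_mor0[OF w(2)]] by simp_all
  have sE: "[w1] \<lhd> sinv C E = sinv C ?E"
    using icell_slwhisk(2)[OF E mor_mor0[OF w(1)]] by simp
  have Xz: "cell ?X [w1, v1, z] [w2, v2, z] Z T" "cell ?X' [w1, v1', z'] [w2, v2', z'] Z T"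
    using cell_srwhisk[OF X z(1)] cell_srwhisk[OF X' z(2)] by simp_all
  have "csq [z] [z'] [w1] E X X' [w2] F \<longleftrightarrow> ?X' \<odot> ?E = ?F \<odot> ?X"
    using csqI[of "[z]" Z D "[z']" D' X "[w1]" "[v1]" "[w2]" "[v2]" T X' "[v1']" "[v2']" E B F B'] assms mor_mor0
    by (auto simp: csq_def simp del: slwhisk.simps srwhisk.simps)
  also have "\<dots> \<longleftrightarrow> ?F \<odot> ?X \<odot> sinv C ?E = ?X'"
  proof
    note sc = icell_cell[OF icell_sinv[OF wE]]
    assume "?X' \<odot> ?E = ?F \<odot> ?X"
    then have "(?F \<odot> ?X) \<odot> sinv C ?E = (?X' \<odot> ?E) \<odot> sinv C ?E" by simp
    then show "?F \<odot> ?X \<odot> sinv C ?E = ?X'"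
      using svcomp_assoc[OF sc Xz(1) wF] svcomp_assoc[OF sc icell_cell[OF wE] Xz(2)] svcomp_sinv[OF wE] svcomp_sid[OF Xz(2)]
      by simp
  next
    note sc = icell_cell[OF icell_sinv[OF wE]]
    assume "?F \<odot> ?X \<odot> sinv C ?E = ?X'"
    then have "?X' \<odot> ?E = ((?F \<odot> ?X) \<odot> sinv C ?E) \<odot> ?E"
      using svcomp_assoc[OF sc Xz(1) wF] by simp
    then show "?X' \<odot> ?E = ?F \<odot> ?X"
      using svcomp_assoc[OF icell_cell[OF wE] sc cell_svcomp[OF Xz(1) wF]] sinv_svcomp[OF wE]
        svcomp_sid[OF cell_svcomp[OF Xz(1) wF]] by simp
  qed
  finally show ?thesis by (simp only: sE)
qed

end

section \<open>Consequences of (BF)\<close>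

locale fractions = bicategory C for C :: "('o, 'a, 'c, 'm) bicat_scheme" (structure) +
  fixes W :: "'a set"
  assumes W_Arr: "W \<subseteq> Arr C" and BF: "BF C W"
begin

text \<open>Only the composite has to lie in \<open>W\<close>. In \<open>[w1, v1]\<close>, for a
  representative of a 2-morphism, the entry \<open>v1\<close> is arbitrary.\<close>

definition wpath :: "'a list \<Rightarrow> 'o \<Rightarrow> 'o \<Rightarrow> bool" where
  "wpath p A B \<longleftrightarrow> mor p A B \<and> path C p \<in> W"

lemma wpath_mor: "wpath p A B \<Longrightarrow> mor p A B"
  by (simp add: wpath_def)

lemma W_iso:
  assumes "w \<in> W" "iso2 C x" "Src C x = v" "Tgt C x = w"
  shows "v \<in> W"
  using BF assms iso2_Cell[OF assms(2)] unfolding BF_def BF5_def in_hom2_def by blast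

lemma wpath_icell:
  assumes "icell X p q A B"
  shows "wpath p A B \<longleftrightarrow> wpath q A B"
proof -
  obtain x where x: "X = (p, x, q)" "mor p A B" "mor q A B" "x \<in> Cell C" "Src C x = path C p" "Tgt C x = path C q" "iso2 C x"
    using assms by (rule icellE)
  then have "iso2 C (inv2 C x)" "Src C (inv2 C x) = path C q" "Tgt C (inv2 C x) = path C p"
    by simp_all
  with x show ?thesis unfolding wpath_def using W_iso by metis
qed

text \<open>(BF2) puts the composite of the two paths into \<open>W\<close>, and (BF5) along
  \<open>coh\<close> passes to the right-bracketed composite of the concatenation.\<close>

lemma wpath_append:
  assumes p: "wpath p B D" and q: "wpath q A B"
  shows "wpath (p @ q) A D"
proof -
  note pq = wpath_mor[OF p] wpath_mor[OF q]
  have "path C p \<star> path C q \<in> W"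
    using BF p q path_simps[OF pq(1)] path_simps[OF pq(2)]
    unfolding BF_def BF2_def wpath_def by auto
  moreover have "iso2 C (inv2 C (coh C p q))" "Src C (inv2 C (coh C p q)) = path C (p @ q)"
    "Tgt C (inv2 C (coh C p q)) = path C p \<star> path C q"
    using coh_simps[OF pq] by simp_all
  ultimately have "path C (p @ q) \<in> W" by (rule W_iso)
  with mor_appendI[OF pq(2,1)] show ?thesis by (simp add: wpath_def)
qed

text \<open>(BF3) for the composites, opened and closed by \<open>split\<close> and
  \<open>join\<close>. Only the leg \<open>z\<close> over \<open>f\<close> is known to be in
  \<open>W\<close>, so in all comparisons the refinement \<open>z'\<close> of the second set of data
  is an arbitrary morphism.\<close>

lemma wpath_square:
  assumes w: "wpath w A B" and f: "mor f Z B"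
  obtains z z' D X where "wpath z D Z" "mor z' D A" "icell X (f @ z) (w @ z') D B"
proof -
  note wm = wpath_mor[OF w]
  obtain s where "BF3_square C W (path C f) (path C w) s"
    using BF w path_simps[OF f] path_simps[OF wm] unfolding BF_def BF3_def wpath_def by metis
  then obtain D v g x where v: "v \<in> W" "\<guillemotleft>v : D \<rightarrow> Z\<guillemotright>" and g: "\<guillemotleft>g : D \<rightarrow> A\<guillemotright>"
    and x: "\<guillemotleft>x : path C f \<star> v \<cong> path C w \<star> g\<guillemotright>"
    using path_simps[OF f] path_simps[OF wm] by (cases s) auto
  have vg: "mor [v] D Z" "mor [g] D A" using v g by simp_all
  have "mor [path C f, v] D B" "mor [path C w, g] D B"
    using v g path_simps[OF f] path_simps[OF wm] by (auto simp: in_hom1_def)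
  with x have X: "icell ([path C f, v], x, [path C w, g]) [path C f, v] [path C w, g] D B"
    by (auto simp: icell_iff in_hom2_def)
  have "icell (join C f \<rhd> [v]) (f @ [v]) [path C f, v] D B"
    using icell_srwhisk(1)[OF icell_join[OF f] vg(1)] by simp
  moreover have "icell (split C w \<rhd> [g]) [path C w, g] (w @ [g]) D B"
    using icell_srwhisk(1)[OF icell_split[OF wm] vg(2)] by simp
  ultimately have "icell ((split C w \<rhd> [g]) \<odot> ([path C f, v], x, [path C w, g]) \<odot> (join C f \<rhd> [v]))
      (f @ [v]) (w @ [g]) D B"
    using icell_svcomp X by blast
  moreover have "wpath [v] D Z" using v vg by (simp add: wpath_def)
  ultimately show ?thesis using that vg by blast
qed

section \<open>Lifting and cancelling 2-cells along \<open>W\<close>\<close>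

lemma join_slwhisk:
  assumes w: "mor w B D" and K: "cell K p q A B"
  shows "(join C w \<rhd> q) \<odot> (w \<lhd> K) = ([path C w] \<lhd> K) \<odot> (join C w \<rhd> p)"
  using scell_interchange[OF K icell_cell[OF icell_join[OF w]]] .

text \<open>(BF4b) for lists. The cell \<open>X\<close> is flattened to the shape required by the
  condition, lifted there, and the lift is unflattened again.\<close>

lemma wpath_lift:
  assumes w: "wpath w B D" and a: "mor a A B" and b: "mor b A B" and X: "icell X (w @ a) (w @ b) A D"
  obtains r K Z where "wpath r Z A" "icell K (a @ r) (b @ r) Z B" "w \<lhd> K = X \<rhd> r"
proof -
  note wm = wpath_mor[OF w]
  let ?w = "path C w" and ?a = "path C a" and ?b = "path C b"
  have mw: "mor0 [?w] B D" "mor [?w] B D" using path_simps[OF wm] by (simp_all add: mor0_def in_hom1_def)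
  have ma: "mor [?a] A B" "mor [?b] A B" using path_simps[OF a] path_simps[OF b] by (simp_all add: in_hom1_def)
  \<comment> \<open>\<open>J c\<close> flattens \<open>w @ c\<close> to the two-entry list of the
    composites of \<open>w\<close> and \<open>c\<close>, which is the shape of the arguments in
    (BF4).\<close>
  define J where "J = (\<lambda>c. (join C w \<rhd> [path C c]) \<odot> (w \<lhd> join C c))"
  have J: "icell (J c) (w @ c) [?w, path C c] A D" if c: "mor c A B" for c
  proof -
    have "mor [path C c] A B" using path_simps[OF c] by (simp add: in_hom1_def)
    from icell_srwhisk(1)[OF icell_join[OF wm] this] icell_slwhisk(1)[OF icell_join[OF c] mor_mor0[OF wm]]
    show ?thesis unfolding J_def by (simp add: icell_svcomp)
  qed
  let ?Y = "J b \<odot> X \<odot> sinv C (J a)"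
  have Y: "icell ?Y [?w, ?a] [?w, ?b] A D"
    using icell_svcomp[OF icell_sinv[OF J[OF a]] icell_svcomp[OF X J[OF b]]]
      svcomp_assoc[OF icell_cell[OF icell_sinv[OF J[OF a]]] icell_cell[OF X] icell_cell[OF J[OF b]]] by simp
  then obtain y where y: "?Y = ([?w, ?a], y, [?w, ?b])" "y \<in> Cell C" "Src C y = ?w \<star> ?a" "Tgt C y = ?w \<star> ?b" "iso2 C y"
    by (rule icellE) simp
  have "BF4_input C W ?w ?a ?b y"
    using w y path_simps[OF wm] path_simps[OF a] path_simps[OF b]
    by (auto simp: BF4_input_def wpath_def in_hom1_def in_hom2_def)
  \<comment> \<open>The triple is taken from (BF4b) and not from a set of choices, because
    invertibility of \<open>k\<close> is guaranteed only in this way.\<close>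
  with y(5) obtain Z v k where t: "BF4_triple C W ?w ?a ?b y (Z, v, k)" and k: "iso2 C k"
    using BF unfolding BF_def BF4b_def by blast
  let ?K = "([?a, v], k, [?b, v])"
  have v: "wpath [v] Z A" "mor [v] Z A" using t path_simps[OF a] by (simp_all add: wpath_def)
  have K: "icell ?K [?a, v] [?b, v] Z B"
    using t k ma v by (auto simp: icell_iff in_hom2_def in_hom1_def)
  have YK: "?Y \<rhd> [v] = [?w] \<lhd> ?K" using t y(1) by simp
  let ?sb = "split C b \<rhd> [v]" and ?ja = "join C a \<rhd> [v]" and ?jb = "join C b \<rhd> [v]"
  have jb: "icell ?jb (b @ [v]) [?b, v] Z B" using icell_srwhisk(1)[OF icell_join[OF b] v(2)] by simp
  have ja: "icell ?ja (a @ [v]) [?a, v] Z B" using icell_srwhisk(1)[OF icell_join[OF a] v(2)] by simp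
  \<comment> \<open>\<open>?K\<close> runs between lists whose first entry is a closed composite;
    conjugation by the \<open>join\<close> cells brings it back to \<open>a @ [v]\<close> and
    \<open>b @ [v]\<close>.\<close>
  let ?L = "sinv C ?jb \<odot> ?K \<odot> ?ja"
  have KJ: "icell (?K \<odot> ?ja) (a @ [v]) [?b, v] Z B" using icell_svcomp[OF ja K] .
  have L: "icell ?L (a @ [v]) (b @ [v]) Z B" using icell_svcomp[OF KJ icell_sinv[OF jb]] .
  have LJ: "?jb \<odot> ?L = ?K \<odot> ?ja"
  proof -
    have "?jb \<odot> ?L = (?jb \<odot> sinv C ?jb) \<odot> ?K \<odot> ?ja"
      using svcomp_assoc[OF icell_cell[OF KJ] icell_cell[OF icell_sinv[OF jb]] icell_cell[OF jb]] by simp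
    also have "\<dots> = ?K \<odot> ?ja"
      using svcomp_sinv[OF jb] sid_svcomp[OF icell_cell[OF KJ]] by simp
    finally show ?thesis .
  qed
  have Jv: "J c \<rhd> [v] = (join C w \<rhd> [path C c, v]) \<odot> (w \<lhd> (join C c \<rhd> [v]))" if c: "mor c A B" for c
  proof -
    have pc: "mor [path C c] A B" using path_simps[OF c] by (simp add: in_hom1_def)
    have "J c \<rhd> [v] = ((join C w \<rhd> [path C c]) \<rhd> [v]) \<odot> ((w \<lhd> join C c) \<rhd> [v])"
      unfolding J_def
      using srwhisk_svcomp[OF cell_slwhisk[OF icell_cell[OF icell_join[OF c]] mor_mor0[OF wm]] _ v(2)]
        cell_srwhisk[OF icell_cell[OF icell_join[OF wm]] pc] by simp
    then show ?thesis
      using srwhisk_append[OF icell_cell[OF icell_join[OF wm]] pc v(2)]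
        slwhisk_srwhisk[OF icell_cell[OF icell_join[OF c]] v(2) mor_mor0[OF wm]] by simp
  qed
  have YJ: "?Y \<odot> J a = J b \<odot> X"
  proof -
    note c = icell_cell[OF icell_sinv[OF J[OF a]]] icell_cell[OF X] icell_cell[OF J[OF b]] icell_cell[OF J[OF a]]
    have "?Y \<odot> J a = (J b \<odot> X) \<odot> sinv C (J a) \<odot> J a"
      using svcomp_assoc[OF c(4) c(1) cell_svcomp[OF c(2,3)]] svcomp_assoc[OF c(1,2,3)] by simp
    also have "\<dots> = J b \<odot> X"
      using sinv_svcomp[OF J[OF a]] svcomp_sid[OF cell_svcomp[OF c(2,3)]] by simp
    finally show ?thesis .
  qed
  \<comment> \<open>The equation for \<open>?L\<close> is checked after composing with the
    invertible \<open>J b \<rhd> [v]\<close>, where it reduces to \<open>YK\<close>, the equation of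
    the triple.\<close>
  have JLeft: "(J b \<rhd> [v]) \<odot> (w \<lhd> ?L) = (J b \<rhd> [v]) \<odot> (X \<rhd> [v])"
  proof -
    have wjb: "cell (w \<lhd> ?jb) (w @ b @ [v]) (w @ [?b, v]) Z D"
      and wL: "cell (w \<lhd> ?L) (w @ a @ [v]) (w @ b @ [v]) Z D"
      and wK: "cell (w \<lhd> ?K) (w @ [?a, v]) (w @ [?b, v]) Z D"
      and wja: "cell (w \<lhd> ?ja) (w @ a @ [v]) (w @ [?a, v]) Z D"
      using jb L K ja cell_slwhisk icell_cell mor_mor0[OF wm] by blast+
    have jw: "cell (join C w \<rhd> c) (w @ c) (?w # c) Z D" if "mor c Z B" for c
      using cell_srwhisk[OF icell_cell[OF icell_join[OF wm]] that] by simp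
    have mav: "mor [?a, v] Z B" "mor [?b, v] Z B" using K by (auto simp: icell_iff)
    have pK: "cell ([?w] \<lhd> ?K) (?w # [?a, v]) (?w # [?b, v]) Z D"
      using cell_slwhisk[OF icell_cell[OF K] mw(1)] by simp
    have "(J b \<rhd> [v]) \<odot> (w \<lhd> ?L) = (join C w \<rhd> [?b, v]) \<odot> (w \<lhd> ?jb) \<odot> (w \<lhd> ?L)"
      unfolding Jv[OF b] using svcomp_assoc[OF wL wjb jw[OF mav(2)]] .
    also have "(w \<lhd> ?jb) \<odot> (w \<lhd> ?L) = (w \<lhd> ?K) \<odot> (w \<lhd> ?ja)"
      using slwhisk_svcomp[OF icell_cell[OF L] icell_cell[OF jb] mor_mor0[OF wm]]
        slwhisk_svcomp[OF icell_cell[OF ja] icell_cell[OF K] mor_mor0[OF wm]] LJ by simp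
    also have "(join C w \<rhd> [?b, v]) \<odot> (w \<lhd> ?K) \<odot> (w \<lhd> ?ja)
        = ((join C w \<rhd> [?b, v]) \<odot> (w \<lhd> ?K)) \<odot> (w \<lhd> ?ja)"
      using svcomp_assoc[OF wja wK jw[OF mav(2)]] by simp
    also have "\<dots> = ([?w] \<lhd> ?K) \<odot> (join C w \<rhd> [?a, v]) \<odot> (w \<lhd> ?ja)"
      unfolding join_slwhisk[OF wm icell_cell[OF K]] using svcomp_assoc[OF wja jw[OF mav(1)] pK] .
    also have "\<dots> = (?Y \<rhd> [v]) \<odot> (J a \<rhd> [v])"
      unfolding Jv[OF a] YK ..
    also have "\<dots> = (J b \<rhd> [v]) \<odot> (X \<rhd> [v])"
      using srwhisk_svcomp[OF icell_cell[OF J[OF a]] icell_cell[OF Y] v(2)]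
        srwhisk_svcomp[OF icell_cell[OF X] icell_cell[OF J[OF b]] v(2)] YJ by simp
    finally show ?thesis .
  qed
  have "w \<lhd> ?L = X \<rhd> [v]"
  proof (rule svcomp_left_cancel[OF icell_srwhisk(1)[OF J[OF b] v(2)] _ _ JLeft])
    show "cell (w \<lhd> ?L) (w @ a @ [v]) ((w @ b) @ [v]) Z D"
      using cell_slwhisk[OF icell_cell[OF L] mor_mor0[OF wm]] by simp
    show "cell (X \<rhd> [v]) (w @ a @ [v]) ((w @ b) @ [v]) Z D"
      using cell_srwhisk[OF icell_cell[OF X] v(2)] by simp
  qed
  with v L that show ?thesis by blast
qed

text \<open>
  (BF4c) is applied to two triples whose 1-morphism is the identity \<open>i\<close> of \<open>A\<close>. Its two legs \<open>u\<close> and \<open>u'\<close>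
  are exchanged by interchange, and the refinement is \<open>[i, u]\<close> rather than \<open>[u]\<close>, so that no unitor is needed.
\<close>

lemma wpath_faithful:
  assumes w: "wpath w B D" and K: "cell K a b A B" and K': "cell K' a b A B" and eq: "w \<lhd> K = w \<lhd> K'"
  obtains r Z where "wpath r Z A" "K \<rhd> r = K' \<rhd> r"
proof -
  note wm = wpath_mor[OF w]
  let ?w = "path C w" and ?a = "path C a" and ?b = "path C b"
  have a: "mor a A B" and b: "mor b A B" using cell_mor[OF K] by auto
  have mw: "mor0 [?w] B D" "mor [?w] B D" using path_simps[OF wm] by (simp_all add: mor0_def in_hom1_def)
  have ma: "mor [?a] A B" "mor [?b] A B" using path_simps[OF a] path_simps[OF b] by (simp_all add: in_hom1_def)
  have weq: "[?w] \<lhd> K = [?w] \<lhd> K'"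
  proof (rule svcomp_right_cancel)
    show "icell (join C w \<rhd> a) (w @ a) ([?w] @ a) A D"
      using icell_srwhisk(1)[OF icell_join[OF wm] a] .
    show "cell ([?w] \<lhd> K) ([?w] @ a) ([?w] @ b) A D" "cell ([?w] \<lhd> K') ([?w] @ a) ([?w] @ b) A D"
      using cell_slwhisk[OF K mw(1)] cell_slwhisk[OF K' mw(1)] by simp_all
    show "([?w] \<lhd> K) \<odot> (join C w \<rhd> a) = ([?w] \<lhd> K') \<odot> (join C w \<rhd> a)"
      using join_slwhisk[OF wm K] join_slwhisk[OF wm K'] eq by simp
  qed
  obtain k where k: "K = (a, k, b)" "k \<in> Cell C" "Src C k = ?a" "Tgt C k = ?b"
    using K by (rule cellE)
  obtain k' where k': "K' = (a, k', b)" "k' \<in> Cell C" "Src C k' = ?a" "Tgt C k' = ?b"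
    using K' by (rule cellE)
  let ?k = "([?a], k, [?b])" and ?k' = "([?a], k', [?b])" and ?i = "Id1 C A" and ?\<alpha> = "Id2 C ?w \<diamondop> k"
  have ck: "cell ?k [?a] [?b] A B" "cell ?k' [?a] [?b] A B" using k k' ma by (simp_all add: cell_iff)
  \<comment> \<open>As the whiskered cells agree, \<open>k\<close> and \<open>k'\<close> solve the
    lifting problem (BF4a) for one and the same 2-cell, so that (BF4c) can compare them.\<close>
  have \<alpha>': "?\<alpha> = Id2 C ?w \<diamondop> k'" using weq k k' by simp
  have A: "A \<in> Obj C" using arr_obj path_simps[OF a] by metis
  have i: "mor [?i] A A" "?i \<in> W" "\<guillemotleft>?i : A \<rightarrow> A\<guillemotright>"
    using A BF unfolding BF_def BF1_def by (auto simp: in_hom1_def)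
  have inp: "BF4_input C W ?w ?a ?b ?\<alpha>"
    using w k path_simps[OF wm] path_simps[OF a] path_simps[OF b]
    by (auto simp: BF4_input_def wpath_def in_hom1_def in_hom2_def)
  have triple: "BF4_triple C W ?w ?a ?b ?\<alpha> (A, ?i, the_cell (([?a], x, [?b]) \<rhd> [?i]))"
    if x: "cell ([?a], x, [?b]) [?a] [?b] A B" "?\<alpha> = Id2 C ?w \<diamondop> x" for x
  proof -
    have "([?w, ?a], ?\<alpha>, [?w, ?b]) \<rhd> [?i] = [?w] \<lhd> ([?a], x, [?b]) \<rhd> [?i]"
      using slwhisk_srwhisk[OF x(1) i(1) mw(1)] x(2) by simp
    moreover have "([?a], x, [?b]) \<rhd> [?i] = ([?a, ?i], the_cell (([?a], x, [?b]) \<rhd> [?i]), [?b, ?i])"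
      by simp
    moreover have "\<guillemotleft>the_cell (([?a], x, [?b]) \<rhd> [?i]) : ?a \<star> ?i \<Rightarrow> ?b \<star> ?i\<guillemotright>"
      using cell_srwhisk[OF x(1) i(1)] by (simp add: cell_def)
    ultimately show ?thesis
      using i path_simps[OF a] by (simp del: slwhisk.simps srwhisk.simps)
  qed
  have BF4c: "BF4c C W" using BF by (simp add: BF_def)
  obtain Z u u' x where u: "\<guillemotleft>u : Z \<rightarrow> A\<guillemotright>" "\<guillemotleft>u' : Z \<rightarrow> A\<guillemotright>" and x: "\<guillemotleft>x : ?i \<star> u \<cong> ?i \<star> u'\<guillemotright>"
    and W: "?i \<star> u \<in> W"
    and eq4: "(([?a, ?i], the_cell (?k' \<rhd> [?i]), [?b, ?i]) \<rhd> [u']) \<odot> ([?a] \<lhd> ([?i, u], x, [?i, u']))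
       = ([?b] \<lhd> ([?i, u], x, [?i, u'])) \<odot> (([?a, ?i], the_cell (?k \<rhd> [?i]), [?b, ?i]) \<rhd> [u])"
    using BF4c[unfolded BF4c_def, rule_format, OF conjI[OF inp conjI[OF triple[OF ck(1) refl] triple[OF ck(2) \<alpha>']]]]
    by blast
  have mu: "mor [u] Z A" "mor [u'] Z A" "mor [?i, u] Z A" "mor [?i, u'] Z A"
    using u i by (auto simp: in_hom1_def)
  let ?X = "([?i, u], x, [?i, u'])"
  have X: "icell ?X [?i, u] [?i, u'] Z A" using x mu by (auto simp: icell_iff in_hom2_def)
  have "(?k' \<rhd> [?i, u']) \<odot> ([?a] \<lhd> ?X) = ([?b] \<lhd> ?X) \<odot> (?k \<rhd> [?i, u])"
    using eq4 srwhisk_append[OF ck(1) i(1) mu(1)] srwhisk_append[OF ck(2) i(1) mu(2)] by simp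
  moreover have "(?k' \<rhd> [?i, u']) \<odot> ([?a] \<lhd> ?X) = ([?b] \<lhd> ?X) \<odot> (?k' \<rhd> [?i, u])"
    using scell_interchange[OF icell_cell[OF X] ck(2)] .
  ultimately have "([?b] \<lhd> ?X) \<odot> (?k \<rhd> [?i, u]) = ([?b] \<lhd> ?X) \<odot> (?k' \<rhd> [?i, u])" by simp
  from svcomp_left_cancel[OF icell_slwhisk(1)[OF X mor_mor0[OF ma(2)]] cell_srwhisk[OF ck(1) mu(3)]
      cell_srwhisk[OF ck(2) mu(3)] this]
  have k_eq: "?k \<rhd> [?i, u] = ?k' \<rhd> [?i, u]" .
  have K_eq: "(join C b \<rhd> [?i, u]) \<odot> (L \<rhd> [?i, u]) = (([?a], the_cell L, [?b]) \<rhd> [?i, u]) \<odot> (join C a \<rhd> [?i, u])"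
    if L: "cell L a b A B" for L
  proof -
    obtain l where l: "L = (a, l, b)" "l \<in> Cell C" "Src C l = ?a" "Tgt C l = ?b"
      using L by (rule cellE)
    have cl: "cell ([?a], l, [?b]) [?a] [?b] A B" using l ma by (simp add: cell_iff)
    have "join C b \<odot> L = ([?a], l, [?b]) \<odot> join C a"
      using l by (simp add: join_def)
    then show ?thesis
      using srwhisk_svcomp[OF L icell_cell[OF icell_join[OF b]] mu(3)]
        srwhisk_svcomp[OF icell_cell[OF icell_join[OF a]] cl mu(3)] l by simp
  qed
  have "K \<rhd> [?i, u] = K' \<rhd> [?i, u]"
  proof (rule svcomp_left_cancel[OF icell_srwhisk(1)[OF icell_join[OF b] mu(3)]
        cell_srwhisk[OF K mu(3)] cell_srwhisk[OF K' mu(3)]])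
    show "(join C b \<rhd> [?i, u]) \<odot> (K \<rhd> [?i, u]) = (join C b \<rhd> [?i, u]) \<odot> (K' \<rhd> [?i, u])"
      using K_eq[OF K] K_eq[OF K'] k_eq k k' by simp
  qed
  moreover have "wpath [?i, u] Z A" using mu W by (simp add: wpath_def)
  ultimately show ?thesis using that by blast
qed

definition wpath0 :: "'a list \<Rightarrow> 'o \<Rightarrow> 'o \<Rightarrow> bool" where
  "wpath0 h A B \<longleftrightarrow> (if h = [] then A = B else wpath h A B)"

text \<open>Here \<open>u\<close> itself may lie outside \<open>W\<close>; what counts is that
  \<open>h\<close> and \<open>h @ u\<close> have composites in \<open>W\<close>. The cell
  \<open>h \<lhd> S\<close> is lifted along \<open>h @ u\<close>, and the resulting equation, which
  still carries \<open>h\<close>, holds without \<open>h\<close> after one more refinement by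
  faithfulness. With \<open>h\<close> empty, \<open>u\<close> is itself in \<open>W\<close> and a
  single lift is enough.\<close>

lemma wpath_lift2:
  assumes h: "wpath0 h D T" and hu: "wpath (h @ u) B T" and u: "mor0 u B D"
    and a: "mor a A B" and b: "mor b A B" and S: "icell S (u @ a) (u @ b) A D"
  obtains r K Z where "wpath r Z A" "icell K (a @ r) (b @ r) Z B" "u \<lhd> K = S \<rhd> r"
proof (cases "h = []")
  case True
  then have "D = T" using h by (simp add: wpath0_def)
  with True hu have "wpath u B D" by simp
  from wpath_lift[OF this a b S] that show ?thesis by blast
next
  case False
  then have h': "wpath h D T" using h by (simp add: wpath0_def)
  note hm = mor_mor0[OF wpath_mor[OF h']]
  have "icell (h \<lhd> S) ((h @ u) @ a) ((h @ u) @ b) A T"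
    using icell_slwhisk(1)[OF S hm] by simp
  from wpath_lift[OF hu a b this] obtain r K Z where
    r: "wpath r Z A" and K: "icell K (a @ r) (b @ r) Z B" and eq: "(h @ u) \<lhd> K = (h \<lhd> S) \<rhd> r"
    by blast
  note rm = wpath_mor[OF r]
  have "h \<lhd> u \<lhd> K = h \<lhd> S \<rhd> r"
    using eq slwhisk_srwhisk[OF icell_cell[OF S] rm hm] by (simp add: slwhisk_append)
  moreover have "cell (u \<lhd> K) (u @ a @ r) (u @ b @ r) Z D" "cell (S \<rhd> r) (u @ a @ r) (u @ b @ r) Z D"
    using cell_slwhisk[OF icell_cell[OF K] u] cell_srwhisk[OF icell_cell[OF S] rm] by simp_all
  ultimately obtain r' Z' where r': "wpath r' Z' Z" and eq': "(u \<lhd> K) \<rhd> r' = (S \<rhd> r) \<rhd> r'"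
    using wpath_faithful[OF h'] by metis
  note r'm = wpath_mor[OF r']
  have "u \<lhd> (K \<rhd> r') = S \<rhd> (r @ r')"
    using eq' slwhisk_srwhisk[OF icell_cell[OF K] r'm u] srwhisk_append[OF icell_cell[OF S] rm r'm] by simp
  moreover have "icell (K \<rhd> r') (a @ r @ r') (b @ r @ r') Z' B"
    using icell_srwhisk(1)[OF K r'm] by simp
  ultimately show ?thesis using that wpath_append[OF r r'] by blast
qed

text \<open>Transports a comparison across invertible cells of the data: \<open>csq_push\<close>
  compares the target legs together with the front segment \<open>g\<close>, and
  \<open>wpath_lift2\<close> strips \<open>g\<close> off at the price of the refinement
  \<open>r\<close>. The list \<open>h\<close> makes this possible when \<open>g\<close> is not in
  \<open>W\<close>.\<close>

lemma csq_lift: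
  assumes z: "mor z Z A" "mor z' Z A'" and X: "icell X (f @ a) (g @ b) A T" and X': "icell X' (f @ a') (g @ b') A' T"
    and E: "icell E (a @ z) (a' @ z') Z B" and f: "mor0 f B T"
    and g: "mor0 g B' T" and h: "wpath0 h T T'" and hg: "wpath (h @ g) B' T'"
    and b: "mor b A B'" "mor b' A' B'"
  obtains r F Z' where "wpath r Z' Z" "icell F (b @ z @ r) (b' @ z' @ r) Z' B'"
    "icsq (z @ r) (z' @ r) f (E \<rhd> r) X X' g F"
proof -
  obtain G where G: "icell G ((g @ b) @ z) ((g @ b') @ z') Z T" and GX: "icsq z z' f E X X' [] G"
    using csq_push[OF z X X' E f] .
  have "icell G (g @ b @ z) (g @ b' @ z') Z T" using G by simp
  then obtain r K Z' where r: "wpath r Z' Z" and K: "icell K ((b @ z) @ r) ((b' @ z') @ r) Z' B'"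
    and eq: "g \<lhd> K = G \<rhd> r"
    using wpath_lift2[OF h hg g mor_appendI[OF z(1) b(1)] mor_appendI[OF z(2) b(2)]] by blast
  note rm = wpath_mor[OF r]
  have K': "icell K (b @ z @ r) (b' @ z' @ r) Z' B'" using K by simp
  have "csq (z @ r) (z' @ r) f (E \<rhd> r) X X' g K"
  proof (rule csqI[OF mor_appendI[OF rm z(1)] mor_appendI[OF rm z(2)] icell_cell[OF X] icell_cell[OF X']
        icell_restrict[OF E rm] K' f g])
    show "(X' \<rhd> (z' @ r)) \<odot> (f \<lhd> (E \<rhd> r)) = (g \<lhd> K) \<odot> (X \<rhd> (z @ r))"
      using csq_restrict[OF icsq_csq[OF GX] rm z(1)] eq by (simp add: csq_def)
  qed
  then show ?thesis
    using that r K' X X' by (simp add: icsq_def icell_def)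
qed

text \<open>Used for cells of the data that are known only through an equation whiskered by
  \<open>h\<close>. The whiskered square is proved from that equation, and faithfulness of
  whiskering along \<open>W\<close> removes \<open>h\<close> after a refinement.\<close>

lemma csq_cancel:
  assumes eq: "csq z z' (h @ f) E (h \<lhd> X) (h \<lhd> X') (h @ g) F"
    and z: "mor z Z A" "mor z' Z A'" and X: "cell X (f @ a) (g @ b) A T" and X': "cell X' (f @ a') (g @ b') A' T"
    and E: "icell E (a @ z) (a' @ z') Z B" and F: "icell F (b @ z) (b' @ z') Z B'"
    and f: "mor0 f B T" and g: "mor0 g B' T" and h: "wpath h T T'"
  obtains r Z' where "wpath r Z' Z" "csq (z @ r) (z' @ r) f (E \<rhd> r) X X' g (F \<rhd> r)"
proof -
  note hm = mor_mor0[OF wpath_mor[OF h]]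
  have Xz: "cell (X \<rhd> z) (f @ a @ z) (g @ b @ z) Z T" "cell (X' \<rhd> z') (f @ a' @ z') (g @ b' @ z') Z T"
    using cell_srwhisk[OF X z(1)] cell_srwhisk[OF X' z(2)] by simp_all
  have fE: "cell (f \<lhd> E) (f @ a @ z) (f @ a' @ z') Z T"
    using cell_slwhisk[OF icell_cell[OF E] f] .
  have gF: "cell (g \<lhd> F) (g @ b @ z) (g @ b' @ z') Z T"
    using cell_slwhisk[OF icell_cell[OF F] g] .
  have "((h \<lhd> X') \<rhd> z') \<odot> ((h @ f) \<lhd> E) = ((h @ g) \<lhd> F) \<odot> ((h \<lhd> X) \<rhd> z)"
    using eq by (simp add: csq_def)
  then have "h \<lhd> ((X' \<rhd> z') \<odot> (f \<lhd> E)) = h \<lhd> ((g \<lhd> F) \<odot> (X \<rhd> z))"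
    using slwhisk_svcomp[OF fE Xz(2) hm] slwhisk_svcomp[OF Xz(1) gF hm]
      slwhisk_srwhisk[OF X z(1) hm] slwhisk_srwhisk[OF X' z(2) hm] by (simp add: slwhisk_append)
  then obtain r Z' where r: "wpath r Z' Z"
    and "((X' \<rhd> z') \<odot> (f \<lhd> E)) \<rhd> r = ((g \<lhd> F) \<odot> (X \<rhd> z)) \<rhd> r"
    using wpath_faithful[OF h cell_svcomp[OF fE Xz(2)] cell_svcomp[OF Xz(1) gF]] by blast
  from csq_restrictI[OF z X X' E F f g wpath_mor[OF r] this(2)] r that show ?thesis by blast
qed

section \<open>Equivalence of representatives\<close>

lemma frac2_cells:
  assumes F: "(A1, w1, f1) \<in> frac_arr C W" "(A2, w2, f2) \<in> frac_arr C W"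
    and d: "is_frac2 C W (A1, w1, f1) (A2, w2, f2) (A3, v1, v2, \<alpha>, \<beta>)"
  shows "mor [v1] A3 A1" "mor [v2] A3 A2" "wpath [w1] A1 (Cod C w1)" "wpath [w2] A2 (Cod C w1)"
    "mor [f1] A1 (Cod C f1)" "mor [f2] A2 (Cod C f1)" "wpath [w1, v1] A3 (Cod C w1)"
    "icell ([w1, v1], \<alpha>, [w2, v2]) [w1, v1] [w2, v2] A3 (Cod C w1)"
    "cell ([f1, v1], \<beta>, [f2, v2]) [f1, v1] [f2, v2] A3 (Cod C f1)"
proof -
  have w: "w1 \<in> Arr C" "w2 \<in> Arr C" "Dom C w1 = A1" "Dom C w2 = A2" "w1 \<in> W" "w2 \<in> W"
    "f1 \<in> Arr C" "f2 \<in> Arr C" "Dom C f1 = A1" "Dom C f2 = A2"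
    using F W_Arr by (auto simp: frac_arr_def)
  have v: "v1 \<in> Arr C" "v2 \<in> Arr C" "Dom C v1 = A3" "Dom C v2 = A3" "Cod C v1 = A1" "Cod C v2 = A2"
    "w1 \<star> v1 \<in> W"
    using d by (auto simp: in_hom1_def)
  have \<alpha>: "\<alpha> \<in> Cell C" "Src C \<alpha> = w1 \<star> v1" "Tgt C \<alpha> = w2 \<star> v2" "iso2 C \<alpha>"
    and \<beta>: "\<beta> \<in> Cell C" "Src C \<beta> = f1 \<star> v1" "Tgt C \<beta> = f2 \<star> v2"
    using d by (auto simp: in_hom2_def)
  \<comment> \<open>\<open>is_frac2\<close> does not state that the codomains agree; it follows
    because source and target of a 2-cell are parallel.\<close>
  have c: "Cod C w2 = Cod C w1" "Cod C f2 = Cod C f1"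
    using cell_simps(4)[OF \<alpha>(1)] cell_simps(4)[OF \<beta>(1)] \<alpha> \<beta> w v by simp_all
  show "mor [v1] A3 A1" "mor [v2] A3 A2" "wpath [w1] A1 (Cod C w1)" "wpath [w2] A2 (Cod C w1)"
    "mor [f1] A1 (Cod C f1)" "mor [f2] A2 (Cod C f1)" "wpath [w1, v1] A3 (Cod C w1)"
    "icell ([w1, v1], \<alpha>, [w2, v2]) [w1, v1] [w2, v2] A3 (Cod C w1)"
    "cell ([f1, v1], \<beta>, [f2, v2]) [f1, v1] [f2, v2] A3 (Cod C f1)"
    using w v \<alpha> \<beta> c by (simp_all add: in_hom1_def wpath_def icell_iff cell_iff)
qed

text \<open>\<open>equiv_frac2\<close> asks for single 1-morphisms as refinements and as legs. The
  lists are therefore collapsed: \<open>z\<close> and \<open>z'\<close> become their composites, and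
  \<open>E\<close>, \<open>F\<close> are conjugated by the flattening cells
  \<open>J\<close>.\<close>

lemma equiv_frac2I:
  assumes w: "mor [w1] A1 T" "mor [w2] A2 T" and f: "mor [f1] A1 S" "mor [f2] A2 S"
    and z: "mor z Z D" "mor z' Z D'"
    and p: "mor p1 D A1" "mor p2 D A2" "mor p1' D' A1" "mor p2' D' A2"
    and E: "icell E (p1 @ z) (p1' @ z') Z A1" and F: "icell F (p2 @ z) (p2' @ z') Z A2"
    and A: "csq z z' [w1] E A A' [w2] F" and B: "csq z z' [f1] E B B' [f2] F"
    and W: "wpath (w1 # p1 @ z) Z T"
  shows "equiv_frac2 C W (A1, w1, f1) (A2, w2, f2)
    (D, path C p1, path C p2, the_cell A, the_cell B) (D', path C p1', path C p2', the_cell A', the_cell B')"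
proof -
  define J where "J = (\<lambda>p z. (join C p \<rhd> [path C z]) \<odot> (p \<lhd> join C z))"
  let ?z = "path C z" and ?z' = "path C z'"
  have mz: "mor [?z] Z D" "mor [?z'] Z D'" using path_simps[OF z(1)] path_simps[OF z(2)] by (simp_all add: in_hom1_def)
  have J: "icell (J p x) (p @ x) [path C p, path C x] Z Q" if "mor p X Q" "mor x Z X" for p x X Q
  proof -
    have "mor [path C x] Z X" using path_simps[OF that(2)] by (simp add: in_hom1_def)
    from icell_srwhisk(1)[OF icell_join[OF that(1)] this]
      icell_slwhisk(1)[OF icell_join[OF that(2)] mor_mor0[OF that(1)]]
    show ?thesis unfolding J_def by (simp add: icell_svcomp)
  qed
  have J1: "icell (J p1 z) (p1 @ z) [path C p1, ?z] Z A1" and J2: "icell (J p2 z) (p2 @ z) [path C p2, ?z] Z A2"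
    and J1': "icell (J p1' z') (p1' @ z') [path C p1', ?z'] Z A1" and J2': "icell (J p2' z') (p2' @ z') [path C p2', ?z'] Z A2"
    using J z p by blast+
  define E' where "E' = J p1' z' \<odot> E \<odot> sinv C (J p1 z)"
  define F' where "F' = J p2' z' \<odot> F \<odot> sinv C (J p2 z)"
  have E': "icell E' [path C p1, ?z] [path C p1', ?z'] Z A1"
    unfolding E'_def using icell_svcomp[OF icell_svcomp[OF icell_sinv[OF J1] E] J1'] .
  have F': "icell F' [path C p2, ?z] [path C p2', ?z'] Z A2"
    unfolding F'_def using icell_svcomp[OF icell_svcomp[OF icell_sinv[OF J2] F] J2'] .
  have key: "cell X (w # p1) (v # p2) D Q \<and> cell X' (w # p1') (v # p2') D' Q \<and>
      ([v] \<lhd> F') \<odot> (([w, path C p1], the_cell X, [v, path C p2]) \<rhd> [?z]) \<odot> ([w] \<lhd> sinv C E')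
       = ([w, path C p1'], the_cell X', [v, path C p2']) \<rhd> [?z']"
    if X: "csq z z' [w] E X X' [v] F" and w: "mor [w] A1 Q" "mor [v] A2 Q" for w v X X' Q
  proof -
    obtain Q' where c: "cell X ([w] @ p1) ([v] @ p2) D Q'" "cell X' ([w] @ p1') ([v] @ p2') D' Q'"
      using csq_cells[OF X E F z] .
    have "mor ([w] @ p1) D Q" "mor ([w] @ p1) D Q'" using mor_appendI[OF p(1) w(1)] c by (auto simp: cell_def)
    then have "Q' = Q" using mor_unique by blast
    note c = c[unfolded this]
    have dom: "Dom C w = A1" "Dom C v = A2" using w by (auto simp: in_hom1_def)
    note col = csq_collapse[OF c(1) z(1), folded J_def, unfolded dom, OF p(1,2)]
      and col' = csq_collapse[OF c(2) z(2), folded J_def, unfolded dom, OF p(3,4)]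
    \<comment> \<open>Three squares are pasted: the collapse of the first datum read backwards, the
      given comparison, and the collapse of the second datum.\<close>
    have "csq [?z] [?z'] [w] E' ([w, path C p1], the_cell X, [v, path C p2])
        ([w, path C p1'], the_cell X', [v, path C p2']) [v] F'"
      unfolding E'_def F'_def J_def using csq_paste[OF csq_paste[OF csq_sym[OF col] X] col'] by (simp only: J_def)
    moreover have "cell ([w, path C p1], the_cell X, [v, path C p2]) [w, path C p1] [v, path C p2] D Q"
      "cell ([w, path C p1'], the_cell X', [v, path C p2']) [w, path C p1'] [v, path C p2'] D' Q"
      using c w path_simps[OF p(1)] path_simps[OF p(2)] path_simps[OF p(3)] path_simps[OF p(4)]
        mor_Nil[OF p(1)] mor_Nil[OF p(2)] mor_Nil[OF p(3)] mor_Nil[OF p(4)]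
      by (auto simp: cell_def path_Cons in_hom1_def)
    ultimately show ?thesis
      using csq_single_iff[OF mz _ _ E' F' w] c by simp
  qed
  note kA = key[OF A w] and kB = key[OF B f]
  obtain s where s: "sinv C E' = ([path C p1', ?z'], s, [path C p1, ?z])" "s \<in> Cell C"
    "Src C s = path C p1' \<star> ?z'" "Tgt C s = path C p1 \<star> ?z" "iso2 C s"
    using icell_sinv[OF E'] by (rule icellE) simp
  obtain t where t: "F' = ([path C p2, ?z], t, [path C p2', ?z'])" "t \<in> Cell C"
    "Src C t = path C p2 \<star> ?z" "Tgt C t = path C p2' \<star> ?z'" "iso2 C t"
    using F' by (rule icellE) simp
  have "icell ([w1] \<lhd> J p1 z) (w1 # p1 @ z) [w1, path C p1, ?z] Z T"
    using icell_slwhisk(1)[OF J1 mor_mor0[OF w(1)]] by simp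
  with W have "wpath [w1, path C p1, ?z] Z T" using wpath_icell by blast
  then have "w1 \<star> path C p1 \<star> ?z \<in> W" by (simp add: wpath_def)
  with mz s t kA kB show ?thesis
    unfolding equiv_frac2.simps
    by - (rule exI[of _ Z], rule exI[of _ ?z], rule exI[of _ ?z'], rule exI[of _ s], rule exI[of _ t],
      simp add: in_hom2_def del: slwhisk.simps srwhisk.simps svcomp.simps)
qed

lemma equiv_frac2D:
  assumes F: "(A1, w1, f1) \<in> frac_arr C W" "(A2, w2, f2) \<in> frac_arr C W"
    and d: "is_frac2 C W (A1, w1, f1) (A2, w2, f2) (A3, v1, v2, \<alpha>, \<beta>)"
    and d': "is_frac2 C W (A1, w1, f1) (A2, w2, f2) (A3', v1', v2', \<alpha>', \<beta>')"
    and eq: "equiv_frac2 C W (A1, w1, f1) (A2, w2, f2) (A3, v1, v2, \<alpha>, \<beta>) (A3', v1', v2', \<alpha>', \<beta>')"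
  obtains Z z z' E G where "mor [z] Z A3" "mor [z'] Z A3'"
    "icell E [v1, z] [v1', z'] Z A1" "icell G [v2, z] [v2', z'] Z A2"
    "csq [z] [z'] [w1] E ([w1, v1], \<alpha>, [w2, v2]) ([w1, v1'], \<alpha>', [w2, v2']) [w2] G"
    "csq [z] [z'] [f1] E ([f1, v1], \<beta>, [f2, v2]) ([f1, v1'], \<beta>', [f2, v2']) [f2] G"
    "wpath [w1, v1, z] Z (Cod C w1)"
proof -
  note c = frac2_cells[OF F d] and c' = frac2_cells[OF F d']
  obtain Z z z' s t where z: "\<guillemotleft>z : Z \<rightarrow> A3\<guillemotright>" "\<guillemotleft>z' : Z \<rightarrow> A3'\<guillemotright>"
    and s: "\<guillemotleft>s : v1' \<star> z' \<cong> v1 \<star> z\<guillemotright>" and t: "\<guillemotleft>t : v2 \<star> z \<cong> v2' \<star> z'\<guillemotright>" and W: "w1 \<star> v1 \<star> z \<in> W"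
    and eqA: "([w2] \<lhd> ([v2, z], t, [v2', z'])) \<odot> (([w1, v1], \<alpha>, [w2, v2]) \<rhd> [z])
            \<odot> ([w1] \<lhd> ([v1', z'], s, [v1, z]))
          = ([w1, v1'], \<alpha>', [w2, v2']) \<rhd> [z']"
    and eqB: "([f2] \<lhd> ([v2, z], t, [v2', z'])) \<odot> (([f1, v1], \<beta>, [f2, v2]) \<rhd> [z])
            \<odot> ([f1] \<lhd> ([v1', z'], s, [v1, z]))
          = ([f1, v1'], \<beta>', [f2, v2']) \<rhd> [z']"
    using eq unfolding equiv_frac2.simps by blast
  have mz: "mor [z] Z A3" "mor [z'] Z A3'" using z by simp_all
  have vz: "mor [v1, z] Z A1" "mor [v2, z] Z A2" "mor [v1', z'] Z A1" "mor [v2', z'] Z A2"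
    using mor_appendI[OF mz(1) c(1)] mor_appendI[OF mz(1) c(2)] mor_appendI[OF mz(2) c'(1)] mor_appendI[OF mz(2) c'(2)]
    by simp_all
  \<comment> \<open>The first cell is inverted because \<open>csq\<close> compares both pairs of
    legs in the direction from the unprimed to the primed datum.\<close>
  let ?E = "([v1, z], inv2 C s, [v1', z'])" and ?G = "([v2, z], t, [v2', z'])"
  have E: "icell ?E [v1, z] [v1', z'] Z A1" and G: "icell ?G [v2, z] [v2', z'] Z A2"
    using s t vz by (simp_all add: icell_iff in_hom2_def)
  have sE: "sinv C ?E = ([v1', z'], s, [v1, z])" using s by simp
  have "csq [z] [z'] [w1] ?E ([w1, v1], \<alpha>, [w2, v2]) ([w1, v1'], \<alpha>', [w2, v2']) [w2] ?G"
    using csq_single_iff[OF mz icell_cell[OF c(8)] icell_cell[OF c'(8)] E G wpath_mor[OF c(3)] wpath_mor[OF c(4)]]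
      eqA sE by simp
  moreover have "csq [z] [z'] [f1] ?E ([f1, v1], \<beta>, [f2, v2]) ([f1, v1'], \<beta>', [f2, v2']) [f2] ?G"
    using csq_single_iff[OF mz c(9) c'(9) E G c(5) c(6)] eqB sE by simp
  moreover have "wpath [w1, v1, z] Z (Cod C w1)"
    using W mor_appendI[OF vz(1) wpath_mor[OF c(3)]] by (simp add: wpath_def)
  ultimately show ?thesis using that mz E G by blast
qed

section \<open>Symmetry and transitivity of the relation on representatives\<close>

lemma frac2_rel_sym:
  assumes F: "F1 \<in> frac_arr C W" "F2 \<in> frac_arr C W"
  shows "sym (frac2_rel C W F1 F2)"
proof (rule symI)
  fix d d' assume rel: "(d, d') \<in> frac2_rel C W F1 F2"
  obtain A1 w1 f1 where F1: "F1 = (A1, w1, f1)" by (cases F1)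
  obtain A2 w2 f2 where F2: "F2 = (A2, w2, f2)" by (cases F2)
  obtain A3 v1 v2 \<alpha> \<beta> where d: "d = (A3, v1, v2, \<alpha>, \<beta>)" by (cases d)
  obtain A3' v1' v2' \<alpha>' \<beta>' where d': "d' = (A3', v1', v2', \<alpha>', \<beta>')" by (cases d')
  have F: "(A1, w1, f1) \<in> frac_arr C W" "(A2, w2, f2) \<in> frac_arr C W" using F F1 F2 by auto
  have i: "is_frac2 C W (A1, w1, f1) (A2, w2, f2) (A3, v1, v2, \<alpha>, \<beta>)"
    and i': "is_frac2 C W (A1, w1, f1) (A2, w2, f2) (A3', v1', v2', \<alpha>', \<beta>')"
    and e: "equiv_frac2 C W (A1, w1, f1) (A2, w2, f2) (A3, v1, v2, \<alpha>, \<beta>) (A3', v1', v2', \<alpha>', \<beta>')"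
    using rel unfolding frac2_rel_def F1 F2 d d' by blast+
  note c = frac2_cells[OF F i] and c' = frac2_cells[OF F i']
  obtain Z z z' E G where z: "mor [z] Z A3" "mor [z'] Z A3'"
    and E: "icell E [v1, z] [v1', z'] Z A1" and G: "icell G [v2, z] [v2', z'] Z A2"
    and csq: "csq [z] [z'] [w1] E ([w1, v1], \<alpha>, [w2, v2]) ([w1, v1'], \<alpha>', [w2, v2']) [w2] G"
    "csq [z] [z'] [f1] E ([f1, v1], \<beta>, [f2, v2]) ([f1, v1'], \<beta>', [f2, v2']) [f2] G"
    and W: "wpath [w1, v1, z] Z (Cod C w1)"
    using equiv_frac2D[OF F i i' e] .
  \<comment> \<open>\<open>equiv_frac2\<close> places only the refined leg of the first datum in
    \<open>W\<close>; (BF5) along \<open>E\<close> does the same for the second.\<close>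
  have "wpath [w1, v1', z'] Z (Cod C w1)"
    using W wpath_icell icell_slwhisk(1)[OF E mor_mor0[OF wpath_mor[OF c(3)]]] by simp
  then have "equiv_frac2 C W (A1, w1, f1) (A2, w2, f2) (A3', v1', v2', \<alpha>', \<beta>') (A3, v1, v2, \<alpha>, \<beta>)"
    using equiv_frac2I[OF wpath_mor[OF c(3)] wpath_mor[OF c(4)] c(5,6) z(2,1) c'(1,2) c(1,2) _ _ csq[THEN csq_sym]]
      icell_sinv[OF E] icell_sinv[OF G] by simp
  with i i' show "(d', d) \<in> frac2_rel C W F1 F2" unfolding frac2_rel_def F1 F2 d d' by blast
qed

text \<open>The middle datum is refined twice, by \<open>z'\<close> and by \<open>y\<close>. The
  composite of \<open>w1\<close>, \<open>v1'\<close> and \<open>y\<close> is in \<open>W\<close>, so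
  (BF3) completes it with the composite through \<open>z'\<close> to a square, and this square is
  lifted along \<open>[w1, v1']\<close>, also in \<open>W\<close>. The lift \<open>N\<close>
  compares the two refinements of the middle datum themselves.\<close>

lemma frac2_rel_trans:
  assumes F: "F1 \<in> frac_arr C W" "F2 \<in> frac_arr C W"
  shows "trans (frac2_rel C W F1 F2)"
proof (rule transI)
  fix d d' d'' assume rel: "(d, d') \<in> frac2_rel C W F1 F2" and rel': "(d', d'') \<in> frac2_rel C W F1 F2"
  obtain A1 w1 f1 where F1: "F1 = (A1, w1, f1)" by (cases F1)
  obtain A2 w2 f2 where F2: "F2 = (A2, w2, f2)" by (cases F2)
  obtain A3 v1 v2 \<alpha> \<beta> where d: "d = (A3, v1, v2, \<alpha>, \<beta>)" by (cases d)
  obtain A3' v1' v2' \<alpha>' \<beta>' where d': "d' = (A3', v1', v2', \<alpha>', \<beta>')" by (cases d')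
  obtain A3'' v1'' v2'' \<alpha>'' \<beta>'' where d'': "d'' = (A3'', v1'', v2'', \<alpha>'', \<beta>'')" by (cases d'')
  have F: "(A1, w1, f1) \<in> frac_arr C W" "(A2, w2, f2) \<in> frac_arr C W" using F F1 F2 by auto
  have i: "is_frac2 C W (A1, w1, f1) (A2, w2, f2) (A3, v1, v2, \<alpha>, \<beta>)"
    and i': "is_frac2 C W (A1, w1, f1) (A2, w2, f2) (A3', v1', v2', \<alpha>', \<beta>')"
    and e: "equiv_frac2 C W (A1, w1, f1) (A2, w2, f2) (A3, v1, v2, \<alpha>, \<beta>) (A3', v1', v2', \<alpha>', \<beta>')"
    using rel unfolding frac2_rel_def F1 F2 d d' by blast+
  have i'': "is_frac2 C W (A1, w1, f1) (A2, w2, f2) (A3'', v1'', v2'', \<alpha>'', \<beta>'')"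
    and e': "equiv_frac2 C W (A1, w1, f1) (A2, w2, f2) (A3', v1', v2', \<alpha>', \<beta>') (A3'', v1'', v2'', \<alpha>'', \<beta>'')"
    using rel' unfolding frac2_rel_def F1 F2 d' d'' by blast+
  note c = frac2_cells[OF F i] and c' = frac2_cells[OF F i'] and c'' = frac2_cells[OF F i'']
  note w = wpath_mor[OF c(3)] wpath_mor[OF c(4)]
  obtain Z z z' E G where z: "mor [z] Z A3" "mor [z'] Z A3'"
    and E: "icell E [v1, z] [v1', z'] Z A1" and G: "icell G [v2, z] [v2', z'] Z A2"
    and csq: "csq [z] [z'] [w1] E ([w1, v1], \<alpha>, [w2, v2]) ([w1, v1'], \<alpha>', [w2, v2']) [w2] G"
    "csq [z] [z'] [f1] E ([f1, v1], \<beta>, [f2, v2]) ([f1, v1'], \<beta>', [f2, v2']) [f2] G"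
    and W: "wpath [w1, v1, z] Z (Cod C w1)"
    using equiv_frac2D[OF F i i' e] .
  obtain Y y y' E' G' where y: "mor [y] Y A3'" "mor [y'] Y A3''"
    and E': "icell E' [v1', y] [v1'', y'] Y A1" and G': "icell G' [v2', y] [v2'', y'] Y A2"
    and csq': "csq [y] [y'] [w1] E' ([w1, v1'], \<alpha>', [w2, v2']) ([w1, v1''], \<alpha>'', [w2, v2'']) [w2] G'"
    "csq [y] [y'] [f1] E' ([f1, v1'], \<beta>', [f2, v2']) ([f1, v1''], \<beta>'', [f2, v2'']) [f2] G'"
    and W': "wpath [w1, v1', y] Y (Cod C w1)"
    using equiv_frac2D[OF F i' i'' e'] .
  have Wz': "mor [w1, v1', z'] Z (Cod C w1)"
    using icell_slwhisk(1)[OF E mor_mor0[OF w(1)]] by (auto simp: icell_def cell_def)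
  obtain s t Q X where s: "wpath s Q Z" and t: "mor t Q Y" and X: "icell X ([w1, v1', z'] @ s) ([w1, v1', y] @ t) Q (Cod C w1)"
    using wpath_square[OF W' Wz'] .
  note sm = wpath_mor[OF s]
  have "icell X ([w1, v1'] @ [z'] @ s) ([w1, v1'] @ [y] @ t) Q (Cod C w1)" using X by simp
  from wpath_lift[OF c'(7) mor_appendI[OF sm z(2)] mor_appendI[OF t y(1)] this]
  obtain r N V where r: "wpath r V Q" and N: "icell N ([z'] @ s @ r) ([y] @ t @ r) V A3'" by (metis append.assoc)
  note rm = wpath_mor[OF r]
  note sr = mor_appendI[OF rm sm] and tr = mor_appendI[OF rm t]
  \<comment> \<open>The comparison goes from the first datum to the middle one by \<open>E\<close>,
    changes its refinement by \<open>N\<close>, and continues to the third by \<open>E'\<close>;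
    \<open>?G\<close> does the same for the second legs.\<close>
  let ?E = "(E' \<rhd> (t @ r)) \<odot> ([v1'] \<lhd> N) \<odot> (E \<rhd> (s @ r))"
  let ?G = "(G' \<rhd> (t @ r)) \<odot> ([v2'] \<lhd> N) \<odot> (G \<rhd> (s @ r))"
  have paste: "csq ([z] @ s @ r) ([y'] @ t @ r) [h1] ?E U U'' [h2] ?G"
    if U: "csq [z] [z'] [h1] E U U' [h2] G" "csq [y] [y'] [h1] E' U' U'' [h2] G'"
      and cU: "cell U' [h1, v1'] [h2, v2'] A3' S" and h: "mor [h1] A1 S" "mor [h2] A2 S" for h1 h2 U U' U'' S
  proof -
    have "csq ([z'] @ s @ r) ([y] @ t @ r) ([h1] @ [v1']) N U' U' ([h2] @ [v2']) N"
      using csq_nat0[OF cU N] by simp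
    from csq_shift[OF this mor_mor0[OF c'(1)] mor_mor0[OF c'(2)] mor_mor0[OF h(1)] mor_mor0[OF h(2)] _ _ cU,
        of "[]" "[]" V "[]" "[]"] N
    have NU: "csq ([z'] @ s @ r) ([y] @ t @ r) [h1] ([v1'] \<lhd> N) U' U' [h2] ([v2'] \<lhd> N)" by simp
    have a: "csq ([z] @ s @ r) ([z'] @ s @ r) [h1] (E \<rhd> (s @ r)) U U' [h2] (G \<rhd> (s @ r))"
      using csq_restrict[OF U(1) sr z(1)] .
    have b: "csq ([y] @ t @ r) ([y'] @ t @ r) [h1] (E' \<rhd> (t @ r)) U' U'' [h2] (G' \<rhd> (t @ r))"
      using csq_restrict[OF U(2) tr y(1)] .
    show ?thesis using csq_paste[OF csq_paste[OF a NU] b] .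
  qed
  have E1: "icell ?E ([v1] @ [z] @ s @ r) ([v1''] @ [y'] @ t @ r) V A1"
    using icell_svcomp[OF icell_svcomp[OF icell_srwhisk(1)[OF E sr]] icell_srwhisk(1)[OF E' tr], of "[v1'] \<lhd> N"]
      icell_slwhisk(1)[OF N mor_mor0[OF c'(1)]] by simp
  have G1: "icell ?G ([v2] @ [z] @ s @ r) ([v2''] @ [y'] @ t @ r) V A2"
    using icell_svcomp[OF icell_svcomp[OF icell_srwhisk(1)[OF G sr]] icell_srwhisk(1)[OF G' tr], of "[v2'] \<lhd> N"]
      icell_slwhisk(1)[OF N mor_mor0[OF c'(2)]] by simp
  have "wpath (w1 # [v1] @ [z] @ s @ r) V (Cod C w1)"
    using wpath_append[OF W wpath_append[OF s r]] by simp
  from equiv_frac2I[OF w c(5,6) mor_appendI[OF sr z(1)] mor_appendI[OF tr y(2)] c(1,2) c''(1,2) E1 G1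
      paste[OF csq(1) csq'(1) icell_cell[OF c'(8)] w] paste[OF csq(2) csq'(2) c'(9) c(5,6)] this]
  have "equiv_frac2 C W (A1, w1, f1) (A2, w2, f2) (A3, v1, v2, \<alpha>, \<beta>) (A3'', v1'', v2'', \<alpha>'', \<beta>'')"
    by simp
  with i i'' show "(d, d'') \<in> frac2_rel C W F1 F2" unfolding frac2_rel_def F1 F2 d d'' by blast
qed

lemma frac2_class_eqI:
  assumes "F1 \<in> frac_arr C W" "F2 \<in> frac_arr C W" "(d, d') \<in> frac2_rel C W F1 F2"
  shows "frac2_class C W F1 F2 d = frac2_class C W F1 F2 d'"
  using assms frac2_rel_sym[OF assms(1,2)] frac2_rel_trans[OF assms(1,2)]
  unfolding frac2_class_def by (blast dest: symD transD)

text \<open>The form in which the four comparisons below end. The squares also carry the types of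
  all cells, so that \<open>is_frac2\<close> for both representatives is read off from them;
  \<open>A\<close> is an \<open>icsq\<close> because the first 2-cell of a representative must be
  invertible.\<close>

lemma frac2_class_eq:
  assumes F: "(A1, w1, f1) \<in> frac_arr C W" "(A2, w2, f2) \<in> frac_arr C W"
    and z: "wpath z Z D" "mor z' Z D'"
    and p: "mor p1 D A1" "mor p2 D A2" "mor p1' D' A1" "mor p2' D' A2"
    and E: "icell E (p1 @ z) (p1' @ z') Z A1" and G: "icell G (p2 @ z) (p2' @ z') Z A2"
    and A: "icsq z z' [w1] E A A' [w2] G" and B: "csq z z' [f1] E B B' [f2] G"
    and W: "wpath (w1 # p1) D (Cod C w1)" "wpath (w1 # p1') D' (Cod C w1)"
  shows "frac2_class C W (A1, w1, f1) (A2, w2, f2) (D, path C p1, path C p2, the_cell A, the_cell B)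
    = frac2_class C W (A1, w1, f1) (A2, w2, f2) (D', path C p1', path C p2', the_cell A', the_cell B')"
proof (rule frac2_class_eqI[OF F])
  note zm = wpath_mor[OF z(1)]
  obtain T where cA: "cell A ([w1] @ p1) ([w2] @ p2) D T" "cell A' ([w1] @ p1') ([w2] @ p2') D' T"
    using csq_cells[OF icsq_csq[OF A] E G zm z(2)] .
  obtain S where cB: "cell B ([f1] @ p1) ([f2] @ p2) D S" "cell B' ([f1] @ p1') ([f2] @ p2') D' S"
    using csq_cells[OF B E G zm z(2)] .
  have w: "w1 \<in> Arr C" "w2 \<in> Arr C" "Dom C w1 = A1" "Dom C w2 = A2"
    "f1 \<in> Arr C" "f2 \<in> Arr C" "Dom C f1 = A1" "Dom C f2 = A2"
    using F W_Arr by (auto simp: frac_arr_def)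
  have "mor (w1 # p1) D T" "mor (w2 # p2) D T" "mor (f1 # p1) D S" "mor (f2 # p2) D S"
    using cA cB by (auto simp: cell_def)
  then have h: "mor [w1] A1 T" "mor [w2] A2 T" "mor [f1] A1 S" "mor [f2] A2 S"
    using w mor_Nil[OF p(1)] mor_Nil[OF p(2)] by (auto simp: mor_Cons in_hom1_def)
  then have T: "Cod C w1 = T" by (simp add: in_hom1_def)
  have "wpath (w1 # p1 @ z) Z T" using wpath_append[OF W(1) z(1)] T by simp
  note equiv_frac2I[OF h zm z(2) p E G icsq_csq[OF A] B this]
  moreover have "is_frac2 C W (A1, w1, f1) (A2, w2, f2) (D, path C p1, path C p2, the_cell A, the_cell B)"
    "is_frac2 C W (A1, w1, f1) (A2, w2, f2) (D', path C p1', path C p2', the_cell A', the_cell B')"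
    using cA cB A W path_simps[OF p(1)] path_simps[OF p(2)] path_simps[OF p(3)] path_simps[OF p(4)]
      mor_Nil[OF p(1)] mor_Nil[OF p(2)] mor_Nil[OF p(3)] mor_Nil[OF p(4)]
    by (auto simp: in_hom1_def cell_def path_Cons wpath_def icsq_def)
  ultimately show "((D, path C p1, path C p2, the_cell A, the_cell B), (D', path C p1', path C p2', the_cell A', the_cell B'))
      \<in> frac2_rel C W (A1, w1, f1) (A2, w2, f2)"
    by (simp add: frac2_rel_def del: is_frac2.simps equiv_frac2.simps)
qed

section \<open>Independence of the auxiliary data\<close>

text \<open>The legs \<open>t1\<close> and \<open>t1'\<close> are in \<open>W\<close> and are
  compared by (BF3). The comparison of \<open>t2\<close> and \<open>t2'\<close> is transported
  through \<open>\<rho>\<close> and lifted along \<open>u3\<close>, which need not be in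
  \<open>W\<close>: that is why \<open>w2\<close> is put in front, since both \<open>w2\<close> and
  \<open>w2 \<star> u3\<close> are in \<open>W\<close>.\<close>

lemma vcomp_class_eq:
  assumes F: "(A1, w1, f1) \<in> frac_arr C W" "(A2, w2, f2) \<in> frac_arr C W" "(A3, w3, f3) \<in> frac_arr C W"
    and d1: "is_frac2 C W (A1, w1, f1) (A2, w2, f2) (A4, u1, u2, \<alpha>1, \<beta>1)"
    and d2: "is_frac2 C W (A2, w2, f2) (A3, w3, f3) (A5, u3, u4, \<alpha>2, \<beta>2)"
    and s: "vcomp_aux C W (A4, u1, u2, \<alpha>1, \<beta>1) (A5, u3, u4, \<alpha>2, \<beta>2) (D, t1, t2, \<rho>)"
    and s': "vcomp_aux C W (A4, u1, u2, \<alpha>1, \<beta>1) (A5, u3, u4, \<alpha>2, \<beta>2) (D', t1', t2', \<rho>')"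
  shows "frac2_class C W (A1, w1, f1) (A3, w3, f3) (vcomp_rep C (A1, w1, f1) (A2, w2, f2) (A3, w3, f3)
      (A4, u1, u2, \<alpha>1, \<beta>1) (A5, u3, u4, \<alpha>2, \<beta>2) (D, t1, t2, \<rho>))
    = frac2_class C W (A1, w1, f1) (A3, w3, f3) (vcomp_rep C (A1, w1, f1) (A2, w2, f2) (A3, w3, f3)
      (A4, u1, u2, \<alpha>1, \<beta>1) (A5, u3, u4, \<alpha>2, \<beta>2) (D', t1', t2', \<rho>'))"
proof -
  define T S where "T = Cod C w1" and "S = Cod C f1"
  note c = frac2_cells[OF F(1,2) d1, folded T_def S_def]
  note e0 = frac2_cells[OF F(2,3) d2]
  have "Cod C w2 = T" "Cod C f2 = S"
    using mor_unique[OF wpath_mor[OF c(4)] wpath_mor[OF e0(3)]] mor_unique[OF c(6) e0(5)] by auto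
  note e = e0[unfolded this]
  define a1 b1 a2 b2 where "a1 = ([w1, u1], \<alpha>1, [w2, u2])" and "b1 = ([f1, u1], \<beta>1, [f2, u2])"
    and "a2 = ([w2, u3], \<alpha>2, [w3, u4])" and "b2 = ([f2, u3], \<beta>2, [f3, u4])"
  note defs = a1_def b1_def a2_def b2_def
  note c = c[folded defs] and e = e[folded defs]
  have cells: "wpath [t1] D A4" "mor [t2] D A5" "icell ([u2, t1], \<rho>, [u3, t2]) [u2, t1] [u3, t2] D A2"
    if "vcomp_aux C W (A4, u1, u2, \<alpha>1, \<beta>1) (A5, u3, u4, \<alpha>2, \<beta>2) (D, t1, t2, \<rho>)" for D t1 t2 \<rho>
  proof -
    show t: "wpath [t1] D A4" "mor [t2] D A5" using that by (auto simp: wpath_def)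
    show "icell ([u2, t1], \<rho>, [u3, t2]) [u2, t1] [u3, t2] D A2"
      using that mor_appendI[OF wpath_mor[OF t(1)] c(2)] mor_appendI[OF t(2) e(1)]
      by (auto simp: icell_iff in_hom2_def)
  qed
  define R R' where "R = ([u2, t1], \<rho>, [u3, t2])" and "R' = ([u2, t1'], \<rho>', [u3, t2'])"
  note k = cells[OF s, folded R_def] and k' = cells[OF s', folded R'_def]
  note tm = wpath_mor[OF k(1)] and tm' = wpath_mor[OF k'(1)]
  obtain z z' Z E0 where z: "wpath z Z D" and z': "mor z' Z D'" and E0: "icell E0 ([t1] @ z) ([t1'] @ z') Z A4"
    using wpath_square[OF k'(1) tm] .
  note zm = wpath_mor[OF z]
  have R: "icell R ([u2] @ [t1]) ([u3] @ [t2]) D A2" "icell R' ([u2] @ [t1']) ([u3] @ [t2']) D' A2"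
    using k(3) k'(3) by simp_all
  have w2: "wpath0 [w2] A2 T" using c(4) by (simp add: wpath0_def)
  have wu3: "wpath ([w2] @ [u3]) A5 T" using e(7) by simp
  \<comment> \<open>Lifting along \<open>[u3]\<close> with \<open>[w2]\<close> in the role of
    \<open>h\<close>.\<close>
  obtain r G Z' where r: "wpath r Z' Z" and G: "icell G ([t2] @ z @ r) ([t2'] @ z' @ r) Z' A5"
    and RG: "icsq (z @ r) (z' @ r) [u2] (E0 \<rhd> r) R R' [u3] G"
    using csq_lift[OF zm z' R E0 mor_mor0[OF c(2)] mor_mor0[OF e(1)] w2 wu3 k(2) k'(2)] .
  note rm = wpath_mor[OF r]
  note zr = wpath_append[OF z r] and zr' = mor_appendI[OF rm z']
  note zrm = wpath_mor[OF zr]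
  define E where "E = E0 \<rhd> r"
  have E: "icell E ([t1] @ z @ r) ([t1'] @ z' @ r) Z' A4"
    unfolding E_def using icell_restrict[OF E0 rm] .
  note RG = RG[folded E_def]
  have A: "icsq (z @ r) (z' @ r) [w1, u1] E ((a2 \<rhd> [t2]) \<odot> ([w2] \<lhd> R) \<odot> (a1 \<rhd> [t1]))
      ((a2 \<rhd> [t2']) \<odot> ([w2] \<lhd> R') \<odot> (a1 \<rhd> [t1'])) [w3, u4] G"
  proof (rule icsq_comp[OF icsq_comp])
    show "icsq (z @ r) (z' @ r) [w1, u1] E (a1 \<rhd> [t1]) (a1 \<rhd> [t1']) [w2, u2] E"
      using icsq_nat[OF c(8) E tm tm' zrm zr'] .
    show "icsq (z @ r) (z' @ r) [w2, u2] E ([w2] \<lhd> R) ([w2] \<lhd> R') [w2, u3] G"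
      using icsq_lwhisk[OF RG icell_cell[OF R(1)] mor_mor0[OF wpath_mor[OF c(4)]]] by simp
    show "icsq (z @ r) (z' @ r) [w2, u3] G (a2 \<rhd> [t2]) (a2 \<rhd> [t2']) [w3, u4] G"
      using icsq_nat[OF e(8) G k(2) k'(2) zrm zr'] .
  qed
  have B: "csq (z @ r) (z' @ r) [f1, u1] E ((b2 \<rhd> [t2]) \<odot> ([f2] \<lhd> R) \<odot> (b1 \<rhd> [t1]))
      ((b2 \<rhd> [t2']) \<odot> ([f2] \<lhd> R') \<odot> (b1 \<rhd> [t1'])) [f3, u4] G"
  proof (rule csq_comp[OF csq_comp])
    show "csq (z @ r) (z' @ r) [f1, u1] E (b1 \<rhd> [t1]) (b1 \<rhd> [t1']) [f2, u2] E"
      using csq_nat[OF c(9) E tm tm' zrm zr'] .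
    show "csq (z @ r) (z' @ r) [f2, u2] E ([f2] \<lhd> R) ([f2] \<lhd> R') [f2, u3] G"
      using csq_lwhisk[OF icsq_csq[OF RG] icell_cell[OF R(1)] mor_mor0[OF c(6)]] by simp
    show "csq (z @ r) (z' @ r) [f2, u3] G (b2 \<rhd> [t2]) (b2 \<rhd> [t2']) [f3, u4] G"
      using csq_nat[OF e(9) G k(2) k'(2) zrm zr'] .
  qed
  have uE: "icell ([u1] \<lhd> E) ([u1, t1] @ z @ r) ([u1, t1'] @ z' @ r) Z' A1"
    and uG: "icell ([u4] \<lhd> G) ([u4, t2] @ z @ r) ([u4, t2'] @ z' @ r) Z' A3"
    using icell_slwhisk(1)[OF E mor_mor0[OF c(1)]] icell_slwhisk(1)[OF G mor_mor0[OF e(2)]] by simp_all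
  \<comment> \<open>\<open>E\<close> and \<open>G\<close> compare only the auxiliary legs, but the
    legs of the composite are \<open>u1 \<star> t1\<close> and \<open>u4 \<star> t2\<close>. So
    \<open>u1\<close> and \<open>u4\<close> are moved into the comparison.\<close>
  have shift: "csq (z @ r) (z' @ r) [v] ([u1] \<lhd> E) X X' [v'] ([u4] \<lhd> G)"
    if X: "csq (z @ r) (z' @ r) [v, u1] E X X' [v', u4] G" and v: "mor [v] A1 Q" "mor [v'] A3 Q" for v v' X X' Q
  proof -
    have vu: "mor [v, u1] A4 Q" using mor_appendI[OF c(1) v(1)] by simp
    obtain Q' where X': "cell X ([v, u1] @ [t1]) ([v', u4] @ [t2]) D Q'"
      using csq_cells[OF X E G zrm zr'] .
    then have "mor ([v, u1] @ [t1]) D Q'" by (simp add: cell_def)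
    then have "Q' = Q" using mor_unique mor_appendI[OF tm vu] by blast
    with X' have X': "cell X ([v, u1] @ [t1]) ([v', u4] @ [t2]) D Q" by simp
    have "csq (z @ r) (z' @ r) ([v] @ [u1]) E X X' ([v'] @ [u4]) G" using X by simp
    from csq_shift[OF this mor_mor0[OF c(1)] mor_mor0[OF e(2)] mor_mor0[OF v(1)] mor_mor0[OF v(2)] E G X']
    show ?thesis .
  qed
  have "icsq (z @ r) (z' @ r) [w1] ([u1] \<lhd> E) ((a2 \<rhd> [t2]) \<odot> ([w2] \<lhd> R) \<odot> (a1 \<rhd> [t1]))
      ((a2 \<rhd> [t2']) \<odot> ([w2] \<lhd> R') \<odot> (a1 \<rhd> [t1'])) [w3] ([u4] \<lhd> G)"
    using A shift[OF icsq_csq[OF A] wpath_mor[OF c(3)] wpath_mor[OF e(4)]] by (simp add: icsq_def)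
  note fin = frac2_class_eq[OF F(1,3) zr zr' _ _ _ _ uE uG this shift[OF B c(5) e(6)]]
  have p: "mor [u1, t1] D A1" "mor [u4, t2] D A3" "mor [u1, t1'] D' A1" "mor [u4, t2'] D' A3"
    using mor_appendI[OF tm c(1)] mor_appendI[OF k(2) e(2)] mor_appendI[OF tm' c(1)] mor_appendI[OF k'(2) e(2)]
    by simp_all
  have "wpath [w1, u1, t1] D (Cod C w1)" "wpath [w1, u1, t1'] D' (Cod C w1)"
    using wpath_append[OF c(7) k(1)] wpath_append[OF c(7) k'(1)] by (simp_all add: T_def)
  from fin[OF p this] show ?thesis
    by (simp only: vcomp_rep.simps path.simps R_def R'_def defs)
qed

lemma choice_cells:
  assumes ch: "is_choiceC C W ch" and f: "f \<in> Arr C" and v: "v \<in> W" and fv: "Cod C f = Cod C v"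
    and eq: "ch f v = (D, w', f', \<rho>)"
  shows "wpath [w'] D (Dom C f)" "mor [f'] D (Dom C v)" "icell ([f, w'], \<rho>, [v, f']) [f, w'] [v, f'] D (Cod C f)"
proof -
  have "BF3_square C W f v (D, w', f', \<rho>)"
    using ch f v fv eq unfolding is_choiceC_def by metis
  then show "wpath [w'] D (Dom C f)" "mor [f'] D (Dom C v)" "icell ([f, w'], \<rho>, [v, f']) [f, w'] [v, f'] D (Cod C f)"
    using f v W_Arr fv by (auto simp: wpath_def icell_iff in_hom1_def in_hom2_def)
qed

lemma frac_comp_arr:
  assumes ch: "is_choiceC C W ch" and F: "F \<in> frac_arr C W" and G: "G \<in> frac_arr C W"
    and FG: "frac_cod C F = frac_dom C G"
  shows "frac_comp C ch G F \<in> frac_arr C W"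
proof -
  obtain A w f where F': "F = (A, w, f)" by (cases F)
  obtain B v g where G': "G = (B, v, g)" by (cases G)
  have h: "w \<in> W" "w \<in> Arr C" "f \<in> Arr C" "Dom C w = A" "Dom C f = A" "v \<in> W" "v \<in> Arr C" "g \<in> Arr C" "Dom C v = B" "Dom C g = B"
    using F G W_Arr by (auto simp: F' G' frac_arr_def)
  obtain D w' f' \<rho> where eq: "ch f v = (D, w', f', \<rho>)" by (cases "ch f v")
  note c = choice_cells[OF ch h(3) h(6) _ eq]
  have "Cod C f = Cod C v" using FG by (simp add: F' G')
  note c = c[OF this]
  have w'A: "wpath [w'] D A" using c(1) h by simp
  have "wpath [w] A (Cod C w)" using h by (simp add: wpath_def in_hom1_def)
  from wpath_append[OF this w'A] have "w \<star> w' \<in> W" by (simp add: wpath_def)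
  moreover have "w' \<in> Arr C" "Dom C w' = D" "Cod C w' = A" "f' \<in> Arr C" "Dom C f' = D" "Cod C f' = B"
    using w'A c(2) h by (auto simp: wpath_def in_hom1_def)
  ultimately show ?thesis
    using h by (simp_all add: F' G' eq frac_arr_def)
qed

text \<open>The only pair of legs that (BF3) can compare directly is \<open>[t1, t3]\<close> with
  \<open>[t1', t3']\<close>. From there the comparison spreads through \<open>\<phi>\<close> to
  \<open>[t2, t4]\<close>, through \<open>\<sigma>1\<close> to \<open>[h1, t3]\<close> and through
  \<open>\<sigma>2\<close> to \<open>[h2, t4]\<close>. Only then can the two cells
  \<open>\<delta>\<close> be compared, as each is determined by an equation containing all the
  others.\<close>

lemma precomp_class_eq:
  assumes ch: "is_choiceC C W ch"
    and F: "(A', w, f) \<in> frac_arr C W" and G: "(B1, v1, g1) \<in> frac_arr C W" "(B2, v2, g2) \<in> frac_arr C W"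
    and fv: "Cod C f = Cod C v1"
    and d: "is_frac2 C W (B1, v1, g1) (B2, v2, g2) (B3, u1, u2, \<alpha>, \<beta>)"
    and s: "precomp_aux C W ch (A', w, f) (B1, v1, g1) (B2, v2, g2) (B3, u1, u2, \<alpha>, \<beta>)
      (D3, D4, D5, t1, t2, h1, h2, \<sigma>1, \<sigma>2, t3, t4, \<phi>, \<delta>)"
    and s': "precomp_aux C W ch (A', w, f) (B1, v1, g1) (B2, v2, g2) (B3, u1, u2, \<alpha>, \<beta>)
      (D3', D4', D5', t1', t2', h1', h2', \<sigma>1', \<sigma>2', t3', t4', \<phi>', \<delta>')"
  shows "frac2_class C W (frac_comp C ch (B1, v1, g1) (A', w, f)) (frac_comp C ch (B2, v2, g2) (A', w, f))
      (precomp_rep C ch (A', w, f) (B1, v1, g1) (B2, v2, g2) (B3, u1, u2, \<alpha>, \<beta>)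
        (D3, D4, D5, t1, t2, h1, h2, \<sigma>1, \<sigma>2, t3, t4, \<phi>, \<delta>))
    = frac2_class C W (frac_comp C ch (B1, v1, g1) (A', w, f)) (frac_comp C ch (B2, v2, g2) (A', w, f))
      (precomp_rep C ch (A', w, f) (B1, v1, g1) (B2, v2, g2) (B3, u1, u2, \<alpha>, \<beta>)
        (D3', D4', D5', t1', t2', h1', h2', \<sigma>1', \<sigma>2', t3', t4', \<phi>', \<delta>'))"
proof -
  define T S Q where "T = Cod C v1" and "S = Cod C g1" and "Q = Cod C w"
  define a b where "a = ([v1, u1], \<alpha>, [v2, u2])" and "b = ([g1, u1], \<beta>, [g2, u2])"
  note c = frac2_cells[OF G d, folded T_def S_def a_def b_def]
  have w: "wpath [w] A' Q" and f: "mor [f] A' T" "f \<in> Arr C" "Dom C f = A'" "Cod C f = T"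
    using F W_Arr fv by (auto simp: frac_arr_def wpath_def in_hom1_def Q_def T_def)
  have v: "v1 \<in> W" "v2 \<in> W" "Dom C v1 = B1" "Dom C v2 = B2" "Cod C v2 = T"
    using G c(4) by (auto simp: frac_arr_def wpath_def in_hom1_def)
  obtain D1 w1 f1 \<rho>1 where ch1: "ch f v1 = (D1, w1, f1, \<rho>1)" by (cases "ch f v1")
  obtain D2 w2 f2 \<rho>2 where ch2: "ch f v2 = (D2, w2, f2, \<rho>2)" by (cases "ch f v2")
  define P1 P2 where "P1 = ([f, w1], \<rho>1, [v1, f1])" and "P2 = ([f, w2], \<rho>2, [v2, f2])"
  have e1: "wpath [w1] D1 A'" "mor [f1] D1 B1" "icell P1 [f, w1] [v1, f1] D1 T"
    using choice_cells[OF ch f(2) v(1) fv ch1] f v by (simp_all add: P1_def)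
  have e2: "wpath [w2] D2 A'" "mor [f2] D2 B2" "icell P2 [f, w2] [v2, f2] D2 T"
    using choice_cells[OF ch f(2) v(2) _ ch2] f v by (simp_all add: P2_def)
  have cells: "wpath [t1] D3 D1" "wpath [t2] D4 D2" "mor [h1] D3 B3" "mor [h2] D4 B3"
      "wpath [t3] D5 D3" "mor [t4] D5 D4"
      "icell ([f1, t1], \<sigma>1, [u1, h1]) [f1, t1] [u1, h1] D3 B1"
      "icell ([f2, t2], \<sigma>2, [u2, h2]) [f2, t2] [u2, h2] D4 B2"
      "icell ([w1, t1, t3], \<phi>, [w2, t2, t4]) [w1, t1, t3] [w2, t2, t4] D5 A'"
      "icell ([h1, t3], \<delta>, [h2, t4]) [h1, t3] [h2, t4] D5 B3"
      "[v1, u1] \<lhd> ([h1, t3], \<delta>, [h2, t4])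
        = (sinv C a \<rhd> [h2, t4])
          \<odot> ([v2] \<lhd> ([f2, t2], \<sigma>2, [u2, h2]) \<rhd> [t4])
          \<odot> (P2 \<rhd> [t2, t4])
          \<odot> ([f] \<lhd> ([w1, t1, t3], \<phi>, [w2, t2, t4]))
          \<odot> (sinv C P1 \<rhd> [t1, t3])
          \<odot> ([v1] \<lhd> sinv C ([f1, t1], \<sigma>1, [u1, h1]) \<rhd> [t3])" (is ?eq1)
    if s: "precomp_aux C W ch (A', w, f) (B1, v1, g1) (B2, v2, g2) (B3, u1, u2, \<alpha>, \<beta>)
      (D3, D4, D5, t1, t2, h1, h2, \<sigma>1, \<sigma>2, t3, t4, \<phi>, \<delta>)"
    for D3 D4 D5 t1 t2 h1 h2 \<sigma>1 \<sigma>2 t3 t4 \<phi> \<delta>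
  proof -
    note s = s[unfolded precomp_aux.simps ch1 ch2 prod.case, folded a_def P1_def P2_def]
    show t: "wpath [t1] D3 D1" "wpath [t2] D4 D2" and h: "mor [h1] D3 B3" "mor [h2] D4 B3"
      and t': "wpath [t3] D5 D3" "mor [t4] D5 D4"
      using s by (auto simp: wpath_def)
    have t3: "mor [t3] D5 D3" "mor [t1] D3 D1" "mor [t2] D4 D2" using t t' by (auto simp: wpath_def)
    have m: "mor [f1, t1] D3 B1" "mor [u1, h1] D3 B1" "mor [f2, t2] D4 B2" "mor [u2, h2] D4 B2"
        "mor [w1, t1, t3] D5 A'" "mor [w2, t2, t4] D5 A'" "mor [h1, t3] D5 B3" "mor [h2, t4] D5 B3"
      using t3 h t'(2) c(1,2) e1(1,2) e2(1,2) by (auto simp: in_hom1_def wpath_def)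
    show "icell ([f1, t1], \<sigma>1, [u1, h1]) [f1, t1] [u1, h1] D3 B1"
      "icell ([f2, t2], \<sigma>2, [u2, h2]) [f2, t2] [u2, h2] D4 B2"
      "icell ([w1, t1, t3], \<phi>, [w2, t2, t4]) [w1, t1, t3] [w2, t2, t4] D5 A'"
      "icell ([h1, t3], \<delta>, [h2, t4]) [h1, t3] [h2, t4] D5 B3"
      using s m by (simp_all add: icell_iff in_hom2_def)
    show ?eq1
      using s by blast
  qed
  define S1 S2 X Y where "S1 = ([f1, t1], \<sigma>1, [u1, h1])" and "S2 = ([f2, t2], \<sigma>2, [u2, h2])"
    and "X = ([w1, t1, t3], \<phi>, [w2, t2, t4])" and "Y = ([h1, t3], \<delta>, [h2, t4])"
  define S1' S2' X' Y' where "S1' = ([f1, t1'], \<sigma>1', [u1, h1'])" and "S2' = ([f2, t2'], \<sigma>2', [u2, h2'])"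
    and "X' = ([w1, t1', t3'], \<phi>', [w2, t2', t4'])" and "Y' = ([h1', t3'], \<delta>', [h2', t4'])"
  note k = cells[OF s, folded S1_def S2_def X_def Y_def]
    and k' = cells[OF s', folded S1'_def S2'_def X'_def Y'_def]
  have der: "wpath [t1, t3] D5 D1" "mor [t2, t4] D5 D2" "mor [h1, t3] D5 B3" "mor [h2, t4] D5 B3"
      "icell (S1 \<rhd> [t3]) ([f1] @ [t1, t3]) ([u1] @ [h1, t3]) D5 B1" "sinv C (S1 \<rhd> [t3]) = sinv C S1 \<rhd> [t3]"
      "icell (S2 \<rhd> [t4]) ([f2] @ [t2, t4]) ([u2] @ [h2, t4]) D5 B2" "sinv C (S2 \<rhd> [t4]) = sinv C S2 \<rhd> [t4]"
    if "wpath [t1] D3 D1" "wpath [t2] D4 D2" "mor [h1] D3 B3" "mor [h2] D4 B3" "wpath [t3] D5 D3" "mor [t4] D5 D4"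
      "icell S1 [f1, t1] [u1, h1] D3 B1" "icell S2 [f2, t2] [u2, h2] D4 B2"
    for D3 D4 D5 t1 t2 h1 h2 S1 S2 t3 t4
    using wpath_append[OF that(1,5)] mor_appendI[OF that(6) wpath_mor[OF that(2)]]
      mor_appendI[OF wpath_mor[OF that(5)] that(3)] mor_appendI[OF that(6,4)]
      icell_srwhisk[OF that(7) wpath_mor[OF that(5)]] icell_srwhisk[OF that(8,6)] by simp_all
  note m = der[OF k(1-8)] and m' = der[OF k'(1-8)]
  have X: "icell X ([w1] @ [t1, t3]) ([w2] @ [t2, t4]) D5 A'" "icell X' ([w1] @ [t1', t3']) ([w2] @ [t2', t4']) D5' A'"
    using k(9) k'(9) by simp_all
  have Y: "cell Y ([] @ [h1, t3]) ([] @ [h2, t4]) D5 B3" "cell Y' ([] @ [h1', t3']) ([] @ [h2', t4']) D5' B3"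
    using k(10) k'(10) by (simp_all add: icell_cell)
  have vm: "mor [v1] B1 T" "mor [v2] B2 T" using c(3,4) wpath_mor by blast+
  have wm: "mor [w1] D1 A'" "mor [w2] D2 A'" using e1(1) e2(1) wpath_mor by blast+
  have w0: "wpath0 [] A' A'" "wpath0 [v1] B1 T" "wpath0 [v2] B2 T"
    using c(3,4) by (simp_all add: wpath0_def)
  have w2': "wpath ([] @ [w2]) D2 A'" using e2(1) by simp
  \<comment> \<open>The composite of \<open>v2\<close> and \<open>u2\<close> is in \<open>W\<close>
    by (BF5) along the invertible \<open>\<alpha>\<close>.\<close>
  have vu: "wpath ([v1] @ [u1]) B3 T" "wpath ([v2] @ [u2]) B3 T"
    using c(7) wpath_icell[OF c(8)] by simp_all
  have vum: "wpath [v1, u1] B3 T" "mor [g1, u1] B3 S"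
    using c(7) mor_appendI[OF c(1,5)] by simp_all

  \<comment> \<open>In the names of the comparisons the last digit counts the refinements made so
    far. \<open>E1\<close> and \<open>E2\<close> compare the legs into \<open>D1\<close> and
    \<open>D2\<close>, while \<open>K1\<close> and \<open>K2\<close> compare those into
    \<open>B3\<close>.\<close>
  obtain z0 z0' Z0 E10 where z0: "wpath z0 Z0 D5" and z0': "mor z0' Z0 D5'"
    and E10: "icell E10 ([t1, t3] @ z0) ([t1', t3'] @ z0') Z0 D1"
    using wpath_square[OF m'(1) wpath_mor[OF m(1)]] .
  note z0m = wpath_mor[OF z0]
  \<comment> \<open>Through \<open>\<phi>\<close> and along \<open>w2\<close>, which belongs to
    \<open>W\<close> as part of a choice in \<open>C(W)\<close>, so the list in front may be
    empty.\<close>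
  obtain r1 E21 Z1 where r1: "wpath r1 Z1 Z0" and E21: "icell E21 ([t2, t4] @ z0 @ r1) ([t2', t4'] @ z0' @ r1) Z1 D2"
    and X1: "icsq (z0 @ r1) (z0' @ r1) [w1] (E10 \<rhd> r1) X X' [w2] E21"
    using csq_lift[OF z0m z0' X E10 mor_mor0[OF wm(1)] mor_mor0[OF wm(2)] w0(1) w2' m(2) m'(2)] .
  define z1 z1' E11 where "z1 = z0 @ r1" and "z1' = z0' @ r1" and "E11 = E10 \<rhd> r1"
  have z1: "wpath z1 Z1 D5" and z1': "mor z1' Z1 D5'" and E11: "icell E11 ([t1, t3] @ z1) ([t1', t3'] @ z1') Z1 D1"
    unfolding z1_def z1'_def E11_def
    using wpath_append[OF z0 r1] mor_appendI[OF wpath_mor[OF r1] z0'] icell_restrict[OF E10 wpath_mor[OF r1]] by blast+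
  note E21 = E21[folded z1_def z1'_def] and X1 = X1[folded z1_def z1'_def E11_def]
  note z1m = wpath_mor[OF z1]

  \<comment> \<open>Through \<open>\<sigma>1\<close> and along \<open>u1\<close>, with
    \<open>v1\<close> in front because \<open>u1\<close> alone need not be in \<open>W\<close>. The
    lift along \<open>u2\<close> below uses \<open>v2\<close> in the same way.\<close>
  obtain r2 K12 Z2 where r2: "wpath r2 Z2 Z1" and K12: "icell K12 ([h1, t3] @ z1 @ r2) ([h1', t3'] @ z1' @ r2) Z2 B3"
    and S12: "icsq (z1 @ r2) (z1' @ r2) [f1] (E11 \<rhd> r2) (S1 \<rhd> [t3]) (S1' \<rhd> [t3']) [u1] K12"
    using csq_lift[OF z1m z1' m(5) m'(5) E11 mor_mor0[OF e1(2)] mor_mor0[OF c(1)] w0(2) vu(1) m(3) m'(3)] .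
  define z2 z2' E12 E22 where "z2 = z1 @ r2" and "z2' = z1' @ r2" and "E12 = E11 \<rhd> r2" and "E22 = E21 \<rhd> r2"
  have z2: "wpath z2 Z2 D5" and z2': "mor z2' Z2 D5'" and E12: "icell E12 ([t1, t3] @ z2) ([t1', t3'] @ z2') Z2 D1"
    and E22: "icell E22 ([t2, t4] @ z2) ([t2', t4'] @ z2') Z2 D2"
    and X2: "icsq z2 z2' [w1] E12 X X' [w2] E22"
    unfolding z2_def z2'_def E12_def E22_def
    using wpath_append[OF z1 r2] mor_appendI[OF wpath_mor[OF r2] z1'] icell_restrict[OF E11 wpath_mor[OF r2]]
      icell_restrict[OF E21 wpath_mor[OF r2]] icsq_restrict[OF X1 wpath_mor[OF r2] z1m] by blast+
  note K12 = K12[folded z2_def z2'_def] and S12 = S12[folded z2_def z2'_def E12_def]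
  note z2m = wpath_mor[OF z2]

  obtain r3 K23 Z3 where r3: "wpath r3 Z3 Z2" and K23: "icell K23 ([h2, t4] @ z2 @ r3) ([h2', t4'] @ z2' @ r3) Z3 B3"
    and S23: "icsq (z2 @ r3) (z2' @ r3) [f2] (E22 \<rhd> r3) (S2 \<rhd> [t4]) (S2' \<rhd> [t4']) [u2] K23"
    using csq_lift[OF z2m z2' m(7) m'(7) E22 mor_mor0[OF e2(2)] mor_mor0[OF c(2)] w0(3) vu(2) m(4) m'(4)] .
  define z3 z3' E13 E23 K13 where "z3 = z2 @ r3" and "z3' = z2' @ r3" and "E13 = E12 \<rhd> r3" and "E23 = E22 \<rhd> r3"
    and "K13 = K12 \<rhd> r3"
  have z3: "wpath z3 Z3 D5" and z3': "mor z3' Z3 D5'" and E13: "icell E13 ([t1, t3] @ z3) ([t1', t3'] @ z3') Z3 D1"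
    and E23: "icell E23 ([t2, t4] @ z3) ([t2', t4'] @ z3') Z3 D2"
    and K13: "icell K13 ([h1, t3] @ z3) ([h1', t3'] @ z3') Z3 B3"
    and X3: "icsq z3 z3' [w1] E13 X X' [w2] E23"
    and S13: "icsq z3 z3' [f1] E13 (S1 \<rhd> [t3]) (S1' \<rhd> [t3']) [u1] K13"
    unfolding z3_def z3'_def E13_def E23_def K13_def
    using wpath_append[OF z2 r3] mor_appendI[OF wpath_mor[OF r3] z2'] icell_restrict[OF E12 wpath_mor[OF r3]]
      icell_restrict[OF E22 wpath_mor[OF r3]] icell_restrict[OF K12 wpath_mor[OF r3]]
      icsq_restrict[OF X2 wpath_mor[OF r3] z2m] icsq_restrict[OF S12 wpath_mor[OF r3] z2m] by blast+
  note K23 = K23[folded z3_def z3'_def] and S23 = S23[folded z3_def z3'_def E23_def]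
  note z3m = wpath_mor[OF z3]
  note t13 = wpath_mor[OF m(1)] wpath_mor[OF m'(1)]

  \<comment> \<open>The right-hand side of the equation for \<open>\<delta>\<close> is compared
    factor by factor. The comparisons run from \<open>K13\<close> through \<open>E13\<close> and
    \<open>E23\<close> to \<open>K23\<close>.\<close>
  have Y3: "csq z3 z3' [v1, u1] K13 ([v1, u1] \<lhd> Y) ([v1, u1] \<lhd> Y') [v1, u1] K23"
    unfolding k(11) k'(11)
  proof (rule csq_comp[OF csq_comp[OF csq_comp[OF csq_comp[OF csq_comp]]]])
    show "csq z3 z3' [v1, u1] K13 ([v1] \<lhd> sinv C S1 \<rhd> [t3]) ([v1] \<lhd> sinv C S1' \<rhd> [t3']) [v1, f1] E13"
      using csq_lwhisk[OF icsq_csq[OF icsq_inv[OF S13]] icell_cell[OF icell_sinv[OF m(5)]] mor_mor0[OF vm(1)]]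
      unfolding m(6) m'(6) by (simp only: append_Cons append_Nil)
    show "csq z3 z3' [v1, f1] E13 (sinv C P1 \<rhd> [t1, t3]) (sinv C P1 \<rhd> [t1', t3']) [f, w1] E13"
      using csq_nat[OF icell_cell[OF icell_sinv[OF e1(3)]] E13 t13 z3m z3'] .
    show "csq z3 z3' [f, w1] E13 ([f] \<lhd> X) ([f] \<lhd> X') [f, w2] E23"
      using csq_lwhisk[OF icsq_csq[OF X3] icell_cell[OF X(1)] mor_mor0[OF f(1)]] by (simp only: append_Cons append_Nil)
    show "csq z3 z3' [f, w2] E23 (P2 \<rhd> [t2, t4]) (P2 \<rhd> [t2', t4']) [v2, f2] E23"
      using csq_nat[OF icell_cell[OF e2(3)] E23 m(2) m'(2) z3m z3'] .
    show "csq z3 z3' [v2, f2] E23 ([v2] \<lhd> S2 \<rhd> [t4]) ([v2] \<lhd> S2' \<rhd> [t4']) [v2, u2] K23"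
      using csq_lwhisk[OF icsq_csq[OF S23] icell_cell[OF m(7)] mor_mor0[OF vm(2)]] by (simp only: append_Cons append_Nil)
    show "csq z3 z3' [v2, u2] K23 (sinv C a \<rhd> [h2, t4]) (sinv C a \<rhd> [h2', t4']) [v1, u1] K23"
      using csq_nat[OF icell_cell[OF icell_sinv[OF c(8)]] K23 m(4) m'(4) z3m z3'] .
  qed
  have n0: "mor0 [] B3 B3" by simp
  have Y3': "csq z3 z3' ([v1, u1] @ []) K13 ([v1, u1] \<lhd> Y) ([v1, u1] \<lhd> Y') ([v1, u1] @ []) K23" using Y3 by simp
  \<comment> \<open>The composite of \<open>v1\<close> and \<open>u1\<close> is in \<open>W\<close>,
    so the front \<open>[v1, u1]\<close> is cancelled and the cells \<open>\<delta>\<close>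
    themselves are compatible.\<close>
  obtain r4 Z4 where r4: "wpath r4 Z4 Z3"
    and Y4: "csq (z3 @ r4) (z3' @ r4) [] (K13 \<rhd> r4) Y Y' [] (K23 \<rhd> r4)"
    using csq_cancel[OF Y3' z3m z3' Y K13 K23 n0 n0 vum(1)] .
  note rm = wpath_mor[OF r4]
  define z z' E1 E2 K1 K2 where "z = z3 @ r4" and "z' = z3' @ r4" and "E1 = E13 \<rhd> r4" and "E2 = E23 \<rhd> r4"
    and "K1 = K13 \<rhd> r4" and "K2 = K23 \<rhd> r4"
  have z: "wpath z Z4 D5" and z': "mor z' Z4 D5'" and E1: "icell E1 ([t1, t3] @ z) ([t1', t3'] @ z') Z4 D1"
    and E2: "icell E2 ([t2, t4] @ z) ([t2', t4'] @ z') Z4 D2"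
    and K1: "icell K1 ([h1, t3] @ z) ([h1', t3'] @ z') Z4 B3"
    and K2: "icell K2 ([h2, t4] @ z) ([h2', t4'] @ z') Z4 B3"
    and Xz: "icsq z z' [w1] E1 X X' [w2] E2"
    and S1z: "icsq z z' [f1] E1 (S1 \<rhd> [t3]) (S1' \<rhd> [t3']) [u1] K1"
    and S2z: "icsq z z' [f2] E2 (S2 \<rhd> [t4]) (S2' \<rhd> [t4']) [u2] K2"
    unfolding z_def z'_def E1_def E2_def K1_def K2_def
    using wpath_append[OF z3 r4] mor_appendI[OF rm z3'] icell_restrict[OF E13 rm]
      icell_restrict[OF E23 rm] icell_restrict[OF K13 rm] icell_restrict[OF K23 rm]
      icsq_restrict[OF X3 rm z3m] icsq_restrict[OF S13 rm z3m] icsq_restrict[OF S23 rm z3m] by blast+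
  note Yz = Y4[folded z_def z'_def K1_def K2_def]
  note zm = wpath_mor[OF z]

  have ww: "mor [w, w1] D1 Q" "mor [w, w2] D2 Q" and gf: "mor [g1, f1] D1 S" "mor [g2, f2] D2 S"
    using mor_appendI[OF wm(1) wpath_mor[OF w]] mor_appendI[OF wm(2) wpath_mor[OF w]]
      mor_appendI[OF e1(2) c(5)] mor_appendI[OF e2(2) c(6)] by simp_all
  have paths: "path C [w, w1] = w \<star> w1" "path C [w, w2] = w \<star> w2" "path C [g1, f1] = g1 \<star> f1" "path C [g2, f2] = g2 \<star> f2"
    by simp_all
  have A: "icsq z z' [w \<star> w1] E1
      ((join C [w, w2] \<rhd> [t2, t4]) \<odot> ([w] \<lhd> X) \<odot> (split C [w, w1] \<rhd> [t1, t3]))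
      ((join C [w, w2] \<rhd> [t2', t4']) \<odot> ([w] \<lhd> X') \<odot> (split C [w, w1] \<rhd> [t1', t3'])) [w \<star> w2] E2"
  proof (rule icsq_comp[OF icsq_comp])
    show "icsq z z' [w \<star> w1] E1 (split C [w, w1] \<rhd> [t1, t3]) (split C [w, w1] \<rhd> [t1', t3']) [w, w1] E1"
      using icsq_nat[OF icell_split[OF ww(1), unfolded paths] E1 t13 zm z'] .
    show "icsq z z' [w, w1] E1 ([w] \<lhd> X) ([w] \<lhd> X') [w, w2] E2"
      using icsq_lwhisk[OF Xz icell_cell[OF X(1)] mor_mor0[OF wpath_mor[OF w]]] by (simp only: append_Cons append_Nil)
    show "icsq z z' [w, w2] E2 (join C [w, w2] \<rhd> [t2, t4]) (join C [w, w2] \<rhd> [t2', t4']) [w \<star> w2] E2"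
      using icsq_nat[OF icell_join[OF ww(2), unfolded paths] E2 m(2) m'(2) zm z'] .
  qed
  \<comment> \<open>The chain of comparisons is \<open>E1\<close>, \<open>K1\<close>,
    \<open>K2\<close>, \<open>E2\<close>; the change from \<open>K1\<close> to \<open>K2\<close> is
    the square for \<open>\<delta>\<close> just obtained.\<close>
  have B: "csq z z' [g1 \<star> f1] E1
      ((join C [g2, f2] \<rhd> [t2, t4]) \<odot> ([g2] \<lhd> sinv C S2 \<rhd> [t4]) \<odot> (b \<rhd> [h2, t4])
          \<odot> ([g1, u1] \<lhd> Y) \<odot> ([g1] \<lhd> S1 \<rhd> [t3]) \<odot> (split C [g1, f1] \<rhd> [t1, t3]))
      ((join C [g2, f2] \<rhd> [t2', t4']) \<odot> ([g2] \<lhd> sinv C S2' \<rhd> [t4']) \<odot> (b \<rhd> [h2', t4'])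
          \<odot> ([g1, u1] \<lhd> Y') \<odot> ([g1] \<lhd> S1' \<rhd> [t3']) \<odot> (split C [g1, f1] \<rhd> [t1', t3'])) [g2 \<star> f2] E2"
  proof (rule csq_comp[OF csq_comp[OF csq_comp[OF csq_comp[OF csq_comp]]]])
    show "csq z z' [g1 \<star> f1] E1 (split C [g1, f1] \<rhd> [t1, t3]) (split C [g1, f1] \<rhd> [t1', t3']) [g1, f1] E1"
      using csq_nat[OF icell_cell[OF icell_split[OF gf(1), unfolded paths]] E1 t13 zm z'] .
    show "csq z z' [g1, f1] E1 ([g1] \<lhd> S1 \<rhd> [t3]) ([g1] \<lhd> S1' \<rhd> [t3']) [g1, u1] K1"
      using csq_lwhisk[OF icsq_csq[OF S1z] icell_cell[OF m(5)] mor_mor0[OF c(5)]] by (simp only: append_Cons append_Nil)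
    show "csq z z' [g1, u1] K1 ([g1, u1] \<lhd> Y) ([g1, u1] \<lhd> Y') [g1, u1] K2"
      using csq_lwhisk[OF Yz Y(1) mor_mor0[OF vum(2)]] by (simp only: append_Nil2)
    show "csq z z' [g1, u1] K2 (b \<rhd> [h2, t4]) (b \<rhd> [h2', t4']) [g2, u2] K2"
      using csq_nat[OF c(9) K2 m(4) m'(4) zm z'] .
    show "csq z z' [g2, u2] K2 ([g2] \<lhd> sinv C S2 \<rhd> [t4]) ([g2] \<lhd> sinv C S2' \<rhd> [t4']) [g2, f2] E2"
      using csq_lwhisk[OF icsq_csq[OF icsq_inv[OF S2z]] icell_cell[OF icell_sinv[OF m(7)]] mor_mor0[OF c(6)]]
      unfolding m(8) m'(8) by (simp only: append_Cons append_Nil)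
    show "csq z z' [g2, f2] E2 (join C [g2, f2] \<rhd> [t2, t4]) (join C [g2, f2] \<rhd> [t2', t4']) [g2 \<star> f2] E2"
      using csq_nat[OF icell_cell[OF icell_join[OF gf(2), unfolded paths]] E2 m(2) m'(2) zm z'] .
  qed
  have arr: "(D1, w \<star> w1, g1 \<star> f1) \<in> frac_arr C W" "(D2, w \<star> w2, g2 \<star> f2) \<in> frac_arr C W"
    using frac_comp_arr[OF ch F G(1)] frac_comp_arr[OF ch F G(2)] ch1 ch2 fv v(5) f(4) by simp_all
  have "w \<star> w1 \<in> W" using arr(1) by (simp add: frac_arr_def)
  then have "wpath [w \<star> w1] D1 (Cod C (w \<star> w1))" using arr(1) W_Arr by (auto simp: frac_arr_def wpath_def in_hom1_def)
  from wpath_append[OF this m(1)] wpath_append[OF this m'(1)]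
  have "wpath ((w \<star> w1) # [t1, t3]) D5 (Cod C (w \<star> w1))" "wpath ((w \<star> w1) # [t1', t3']) D5' (Cod C (w \<star> w1))"
    by simp_all
  from frac2_class_eq[OF arr z z' t13(1) m(2) t13(2) m'(2) E1 E2 A B this] show ?thesis
    by (simp only: precomp_rep.simps frac_comp.simps path.simps ch1 ch2 prod.case
        S1_def S2_def X_def Y_def S1'_def S2'_def X'_def Y'_def b_def)
qed

text \<open>The comparison starts at the legs \<open>[u3, u7]\<close> into \<open>A3\<close>, which
  are in \<open>W\<close>, and spreads outwards through \<open>\<eta>3\<close>,
  \<open>\<eta>1\<close> and \<open>\<eta>2\<close>. The lifted cell \<open>\<lambda>\<close> comes
  last; since \<open>\<beta>\<close> is arbitrary, it is only a \<open>cell\<close> and its square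
  only a \<open>csq\<close>.\<close>

lemma postcomp_class_eq:
  assumes ch: "is_choiceC C W ch"
    and G: "(B', u, g) \<in> frac_arr C W" and F: "(A1, w1, f1) \<in> frac_arr C W" "(A2, w2, f2) \<in> frac_arr C W"
    and fu: "Cod C f1 = Cod C u"
    and d: "is_frac2 C W (A1, w1, f1) (A2, w2, f2) (A3, v1, v2, \<alpha>, \<beta>)"
    and s: "postcomp_aux C W ch (B', u, g) (A1, w1, f1) (A2, w2, f2) (A3, v1, v2, \<alpha>, \<beta>)
      (D3, D4, D5, u3, u4, u5, u6, \<eta>1, \<eta>2, u7, u8, \<eta>3, l)"
    and s': "postcomp_aux C W ch (B', u, g) (A1, w1, f1) (A2, w2, f2) (A3, v1, v2, \<alpha>, \<beta>)
      (D3', D4', D5', u3', u4', u5', u6', \<eta>1', \<eta>2', u7', u8', \<eta>3', l')"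
  shows "frac2_class C W (frac_comp C ch (B', u, g) (A1, w1, f1)) (frac_comp C ch (B', u, g) (A2, w2, f2))
      (postcomp_rep C ch (B', u, g) (A1, w1, f1) (A2, w2, f2) (A3, v1, v2, \<alpha>, \<beta>)
        (D3, D4, D5, u3, u4, u5, u6, \<eta>1, \<eta>2, u7, u8, \<eta>3, l))
    = frac2_class C W (frac_comp C ch (B', u, g) (A1, w1, f1)) (frac_comp C ch (B', u, g) (A2, w2, f2))
      (postcomp_rep C ch (B', u, g) (A1, w1, f1) (A2, w2, f2) (A3, v1, v2, \<alpha>, \<beta>)
        (D3', D4', D5', u3', u4', u5', u6', \<eta>1', \<eta>2', u7', u8', \<eta>3', l'))"
proof -
  define T S Q where "T = Cod C w1" and "S = Cod C f1" and "Q = Cod C g"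
  define a b where "a = ([w1, v1], \<alpha>, [w2, v2])" and "b = ([f1, v1], \<beta>, [f2, v2])"
  note c = frac2_cells[OF F d, folded T_def S_def a_def b_def]
  have u: "u \<in> W" "Cod C u = S" "Dom C u = B'" "wpath [u] B' S" and g: "mor [g] B' Q"
    using G W_Arr fu by (auto simp: frac_arr_def wpath_def in_hom1_def Q_def S_def)
  have f: "f1 \<in> Arr C" "f2 \<in> Arr C" "Dom C f1 = A1" "Dom C f2 = A2" "Cod C f1 = S" "Cod C f2 = S"
    using c(5,6) by (auto simp: in_hom1_def)
  obtain D1 u1 h1 \<rho>1 where ch1: "ch f1 u = (D1, u1, h1, \<rho>1)" by (cases "ch f1 u")
  obtain D2 u2 h2 \<rho>2 where ch2: "ch f2 u = (D2, u2, h2, \<rho>2)" by (cases "ch f2 u")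
  define P1 P2 where "P1 = ([f1, u1], \<rho>1, [u, h1])" and "P2 = ([f2, u2], \<rho>2, [u, h2])"
  have e1: "wpath [u1] D1 A1" "mor [h1] D1 B'" "icell P1 [f1, u1] [u, h1] D1 S"
    using choice_cells[OF ch f(1) u(1) _ ch1] f u by (simp_all add: P1_def)
  have e2: "wpath [u2] D2 A2" "mor [h2] D2 B'" "icell P2 [f2, u2] [u, h2] D2 S"
    using choice_cells[OF ch f(2) u(1) _ ch2] f u by (simp_all add: P2_def)
  have cells: "wpath [u3] D3 A3" "wpath [u5] D4 A3" "mor [u4] D3 D1" "mor [u6] D4 D2"
      "wpath [u7] D5 D3" "mor [u8] D5 D4"
      "icell ([v1, u3], \<eta>1, [u1, u4]) [v1, u3] [u1, u4] D3 A1"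
      "icell ([v2, u5], \<eta>2, [u2, u6]) [v2, u5] [u2, u6] D4 A2"
      "icell ([u3, u7], \<eta>3, [u5, u8]) [u3, u7] [u5, u8] D5 A3"
      "cell ([h1, u4, u7], l, [h2, u6, u8]) [h1, u4, u7] [h2, u6, u8] D5 B'"
      "[u] \<lhd> ([h1, u4, u7], l, [h2, u6, u8])
        = (P2 \<rhd> [u6, u8])
          \<odot> ([f2] \<lhd> ([v2, u5], \<eta>2, [u2, u6]) \<rhd> [u8])
          \<odot> ([f2, v2] \<lhd> ([u3, u7], \<eta>3, [u5, u8]))
          \<odot> (b \<rhd> [u3, u7])
          \<odot> ([f1] \<lhd> sinv C ([v1, u3], \<eta>1, [u1, u4]) \<rhd> [u7])
          \<odot> (sinv C P1 \<rhd> [u4, u7])" (is ?eq1)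
    if s: "postcomp_aux C W ch (B', u, g) (A1, w1, f1) (A2, w2, f2) (A3, v1, v2, \<alpha>, \<beta>)
      (D3, D4, D5, u3, u4, u5, u6, \<eta>1, \<eta>2, u7, u8, \<eta>3, l)"
    for D3 D4 D5 u3 u4 u5 u6 \<eta>1 \<eta>2 u7 u8 \<eta>3 l
  proof -
    note s = s[unfolded postcomp_aux.simps ch1 ch2 prod.case, folded b_def P1_def P2_def]
    show t: "wpath [u3] D3 A3" "wpath [u5] D4 A3" and h: "mor [u4] D3 D1" "mor [u6] D4 D2"
      and t': "wpath [u7] D5 D3" "mor [u8] D5 D4"
      using s by (auto simp: wpath_def)
    have m: "mor [v1, u3] D3 A1" "mor [u1, u4] D3 A1" "mor [v2, u5] D4 A2" "mor [u2, u6] D4 A2"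
        "mor [u3, u7] D5 A3" "mor [u5, u8] D5 A3" "mor [h1, u4, u7] D5 B'" "mor [h2, u6, u8] D5 B'"
      using t h t' c(1,2) e1(1,2) e2(1,2) by (auto simp: in_hom1_def wpath_def)
    show "icell ([v1, u3], \<eta>1, [u1, u4]) [v1, u3] [u1, u4] D3 A1"
      "icell ([v2, u5], \<eta>2, [u2, u6]) [v2, u5] [u2, u6] D4 A2"
      "icell ([u3, u7], \<eta>3, [u5, u8]) [u3, u7] [u5, u8] D5 A3"
      "cell ([h1, u4, u7], l, [h2, u6, u8]) [h1, u4, u7] [h2, u6, u8] D5 B'"
      using s m by (simp_all add: icell_iff cell_iff in_hom2_def)
    show ?eq1
      using s by blast
  qed
  define S1 S2 X Y where "S1 = ([v1, u3], \<eta>1, [u1, u4])" and "S2 = ([v2, u5], \<eta>2, [u2, u6])"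
    and "X = ([u3, u7], \<eta>3, [u5, u8])" and "Y = ([h1, u4, u7], l, [h2, u6, u8])"
  define S1' S2' X' Y' where "S1' = ([v1, u3'], \<eta>1', [u1, u4'])" and "S2' = ([v2, u5'], \<eta>2', [u2, u6'])"
    and "X' = ([u3', u7'], \<eta>3', [u5', u8'])" and "Y' = ([h1, u4', u7'], l', [h2, u6', u8'])"
  note k = cells[OF s, folded S1_def S2_def X_def Y_def]
    and k' = cells[OF s', folded S1'_def S2'_def X'_def Y'_def]
  have der: "wpath [u3, u7] D5 A3" "mor [u5, u8] D5 A3" "mor [u4, u7] D5 D1" "mor [u6, u8] D5 D2"
      "icell (S1 \<rhd> [u7]) ([v1] @ [u3, u7]) ([u1] @ [u4, u7]) D5 A1" "sinv C (S1 \<rhd> [u7]) = sinv C S1 \<rhd> [u7]"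
      "icell (S2 \<rhd> [u8]) ([v2] @ [u5, u8]) ([u2] @ [u6, u8]) D5 A2"
    if "wpath [u3] D3 A3" "wpath [u5] D4 A3" "mor [u4] D3 D1" "mor [u6] D4 D2" "wpath [u7] D5 D3" "mor [u8] D5 D4"
      "icell S1 [v1, u3] [u1, u4] D3 A1" "icell S2 [v2, u5] [u2, u6] D4 A2"
    for D3 D4 D5 u3 u4 u5 u6 u7 u8 S1 S2
    using wpath_append[OF that(1,5)] mor_appendI[OF that(6) wpath_mor[OF that(2)]]
      mor_appendI[OF wpath_mor[OF that(5)] that(3)] mor_appendI[OF that(6,4)]
      icell_srwhisk[OF that(7) wpath_mor[OF that(5)]] icell_srwhisk(1)[OF that(8,6)] by simp_all
  note m = der[OF k(1-8)] and m' = der[OF k'(1-8)]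
  have X: "icell X ([] @ [u3, u7]) ([] @ [u5, u8]) D5 A3" "icell X' ([] @ [u3', u7']) ([] @ [u5', u8']) D5' A3"
    using k(9) k'(9) by simp_all
  have Y: "cell Y ([h1] @ [u4, u7]) ([h2] @ [u6, u8]) D5 B'" "cell Y' ([h1] @ [u4', u7']) ([h2] @ [u6', u8']) D5' B'"
    using k(10) k'(10) by simp_all
  have um: "mor [u] B' S" "mor [u1] D1 A1" "mor [u2] D2 A2" "mor [w1] A1 T" "mor [w2] A2 T"
    using u(4) e1(1) e2(1) c(3,4) wpath_mor by blast+
  have w0: "wpath0 [] A1 A1" "wpath0 [] A2 A2" by (simp_all add: wpath0_def)
  have u12: "wpath ([] @ [u1]) D1 A1" "wpath ([] @ [u2]) D2 A2" using e1(1) e2(1) by simp_all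
  have fv: "mor [f2, v2] A3 S" "mor [w2, v2] A3 T"
    using mor_appendI[OF c(2,6)] mor_appendI[OF c(2) um(5)] by simp_all
  have n0: "mor0 [] A3 A3" by simp

  obtain z0 z0' Z0 K10 where z0: "wpath z0 Z0 D5" and z0': "mor z0' Z0 D5'"
    and K10: "icell K10 ([u3, u7] @ z0) ([u3', u7'] @ z0') Z0 A3"
    using wpath_square[OF m'(1) wpath_mor[OF m(1)]] .
  note z0m = wpath_mor[OF z0]
  \<comment> \<open>\<open>\<eta>3\<close> runs between legs into the same object \<open>A3\<close>,
    with nothing in front of them to strip off, so this transport needs no refinement.\<close>
  obtain K20 where K20: "icell K20 ([u5, u8] @ z0) ([u5', u8'] @ z0') Z0 A3"
    and X0: "icsq z0 z0' [] K10 X X' [] K20"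
    using csq_push[OF z0m z0' X[unfolded append_Nil[of "[u5, u8]"] append_Nil[of "[u5', u8']"]] K10 n0] .
  \<comment> \<open>The morphisms \<open>u1\<close> and \<open>u2\<close> come from
    \<open>C(W)\<close> and are in \<open>W\<close>, so lifting along them needs nothing in
    front.\<close>
  obtain r1 E11 Z1 where r1: "wpath r1 Z1 Z0" and E11: "icell E11 ([u4, u7] @ z0 @ r1) ([u4', u7'] @ z0' @ r1) Z1 D1"
    and S11: "icsq (z0 @ r1) (z0' @ r1) [v1] (K10 \<rhd> r1) (S1 \<rhd> [u7]) (S1' \<rhd> [u7']) [u1] E11"
    using csq_lift[OF z0m z0' m(5) m'(5) K10 mor_mor0[OF c(1)] mor_mor0[OF um(2)] w0(1) u12(1) m(3) m'(3)] .
  define z1 z1' K11 K21 where "z1 = z0 @ r1" and "z1' = z0' @ r1" and "K11 = K10 \<rhd> r1" and "K21 = K20 \<rhd> r1"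
  have z1: "wpath z1 Z1 D5" and z1': "mor z1' Z1 D5'" and K11: "icell K11 ([u3, u7] @ z1) ([u3', u7'] @ z1') Z1 A3"
    and K21: "icell K21 ([u5, u8] @ z1) ([u5', u8'] @ z1') Z1 A3" and X1: "icsq z1 z1' [] K11 X X' [] K21"
    unfolding z1_def z1'_def K11_def K21_def
    using wpath_append[OF z0 r1] mor_appendI[OF wpath_mor[OF r1] z0'] icell_restrict[OF K10 wpath_mor[OF r1]]
      icell_restrict[OF K20 wpath_mor[OF r1]] icsq_restrict[OF X0 wpath_mor[OF r1] z0m] by blast+
  note E11 = E11[folded z1_def z1'_def] and S11 = S11[folded z1_def z1'_def K11_def]
  note z1m = wpath_mor[OF z1]

  obtain r2 E22 Z2 where r2: "wpath r2 Z2 Z1" and E22: "icell E22 ([u6, u8] @ z1 @ r2) ([u6', u8'] @ z1' @ r2) Z2 D2"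
    and S22: "icsq (z1 @ r2) (z1' @ r2) [v2] (K21 \<rhd> r2) (S2 \<rhd> [u8]) (S2' \<rhd> [u8']) [u2] E22"
    using csq_lift[OF z1m z1' m(7) m'(7) K21 mor_mor0[OF c(2)] mor_mor0[OF um(3)] w0(2) u12(2) m(4) m'(4)] .
  define z2 z2' K12 K22 E12 where "z2 = z1 @ r2" and "z2' = z1' @ r2" and "K12 = K11 \<rhd> r2" and "K22 = K21 \<rhd> r2"
    and "E12 = E11 \<rhd> r2"
  have z2: "wpath z2 Z2 D5" and z2': "mor z2' Z2 D5'" and K12: "icell K12 ([u3, u7] @ z2) ([u3', u7'] @ z2') Z2 A3"
    and K22: "icell K22 ([u5, u8] @ z2) ([u5', u8'] @ z2') Z2 A3"
    and E12: "icell E12 ([u4, u7] @ z2) ([u4', u7'] @ z2') Z2 D1"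
    and X2: "icsq z2 z2' [] K12 X X' [] K22"
    and S12: "icsq z2 z2' [v1] K12 (S1 \<rhd> [u7]) (S1' \<rhd> [u7']) [u1] E12"
    unfolding z2_def z2'_def K12_def K22_def E12_def
    using wpath_append[OF z1 r2] mor_appendI[OF wpath_mor[OF r2] z1'] icell_restrict[OF K11 wpath_mor[OF r2]]
      icell_restrict[OF K21 wpath_mor[OF r2]] icell_restrict[OF E11 wpath_mor[OF r2]]
      icsq_restrict[OF X1 wpath_mor[OF r2] z1m] icsq_restrict[OF S11 wpath_mor[OF r2] z1m] by blast+
  note E22 = E22[folded z2_def z2'_def] and S22 = S22[folded z2_def z2'_def K22_def]
  note z2m = wpath_mor[OF z2]
  note m1 = wpath_mor[OF m(1)] wpath_mor[OF m'(1)]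

  \<comment> \<open>The chain for the equation of \<open>\<lambda>\<close> runs from
    \<open>E12\<close> through \<open>K12\<close> and \<open>K22\<close> to \<open>E22\<close>; then
    \<open>u\<close>, which is in \<open>W\<close>, is cancelled.\<close>
  have Y2: "csq z2 z2' [u, h1] E12 ([u] \<lhd> Y) ([u] \<lhd> Y') [u, h2] E22"
    unfolding k(11) k'(11)
  proof (rule csq_comp[OF csq_comp[OF csq_comp[OF csq_comp[OF csq_comp]]]])
    show "csq z2 z2' [u, h1] E12 (sinv C P1 \<rhd> [u4, u7]) (sinv C P1 \<rhd> [u4', u7']) [f1, u1] E12"
      using csq_nat[OF icell_cell[OF icell_sinv[OF e1(3)]] E12 m(3) m'(3) z2m z2'] .
    show "csq z2 z2' [f1, u1] E12 ([f1] \<lhd> sinv C S1 \<rhd> [u7]) ([f1] \<lhd> sinv C S1' \<rhd> [u7']) [f1, v1] K12"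
      using csq_lwhisk[OF icsq_csq[OF icsq_inv[OF S12]] icell_cell[OF icell_sinv[OF m(5)]] mor_mor0[OF c(5)]]
      unfolding m(6) m'(6) by (simp only: append_Cons append_Nil)
    show "csq z2 z2' [f1, v1] K12 (b \<rhd> [u3, u7]) (b \<rhd> [u3', u7']) [f2, v2] K12"
      using csq_nat[OF c(9) K12 m1 z2m z2'] .
    show "csq z2 z2' [f2, v2] K12 ([f2, v2] \<lhd> X) ([f2, v2] \<lhd> X') [f2, v2] K22"
      using csq_lwhisk[OF icsq_csq[OF X2] icell_cell[OF X(1)] mor_mor0[OF fv(1)]] by (simp only: append_Nil2)
    show "csq z2 z2' [f2, v2] K22 ([f2] \<lhd> S2 \<rhd> [u8]) ([f2] \<lhd> S2' \<rhd> [u8']) [f2, u2] E22"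
      using csq_lwhisk[OF icsq_csq[OF S22] icell_cell[OF m(7)] mor_mor0[OF c(6)]] by (simp only: append_Cons append_Nil)
    show "csq z2 z2' [f2, u2] E22 (P2 \<rhd> [u6, u8]) (P2 \<rhd> [u6', u8']) [u, h2] E22"
      using csq_nat[OF icell_cell[OF e2(3)] E22 m(4) m'(4) z2m z2'] .
  qed
  have Y2': "csq z2 z2' ([u] @ [h1]) E12 ([u] \<lhd> Y) ([u] \<lhd> Y') ([u] @ [h2]) E22" using Y2 by simp
  obtain r3 Z3 where r3: "wpath r3 Z3 Z2"
    and Y3: "csq (z2 @ r3) (z2' @ r3) [h1] (E12 \<rhd> r3) Y Y' [h2] (E22 \<rhd> r3)"
    using csq_cancel[OF Y2' z2m z2' Y E12 E22 mor_mor0[OF e1(2)] mor_mor0[OF e2(2)] u(4)] .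
  note rm = wpath_mor[OF r3]
  define z z' E1 E2 K1 K2 where "z = z2 @ r3" and "z' = z2' @ r3" and "E1 = E12 \<rhd> r3" and "E2 = E22 \<rhd> r3"
    and "K1 = K12 \<rhd> r3" and "K2 = K22 \<rhd> r3"
  have z: "wpath z Z3 D5" and z': "mor z' Z3 D5'" and E1: "icell E1 ([u4, u7] @ z) ([u4', u7'] @ z') Z3 D1"
    and E2: "icell E2 ([u6, u8] @ z) ([u6', u8'] @ z') Z3 D2"
    and K1: "icell K1 ([u3, u7] @ z) ([u3', u7'] @ z') Z3 A3"
    and Xz: "icsq z z' [] K1 X X' [] K2"
    and S1z: "icsq z z' [v1] K1 (S1 \<rhd> [u7]) (S1' \<rhd> [u7']) [u1] E1"
    and S2z: "icsq z z' [v2] K2 (S2 \<rhd> [u8]) (S2' \<rhd> [u8']) [u2] E2"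
    unfolding z_def z'_def E1_def E2_def K1_def K2_def
    using wpath_append[OF z2 r3] mor_appendI[OF rm z2'] icell_restrict[OF E12 rm]
      icell_restrict[OF E22 rm] icell_restrict[OF K12 rm]
      icsq_restrict[OF X2 rm z2m] icsq_restrict[OF S12 rm z2m] icsq_restrict[OF S22 rm z2m] by blast+
  note Yz = Y3[folded z_def z'_def E1_def E2_def]
  note zm = wpath_mor[OF z]

  have wu: "mor [w1, u1] D1 T" "mor [w2, u2] D2 T" and gh: "mor [g, h1] D1 Q" "mor [g, h2] D2 Q"
    using mor_appendI[OF um(2,4)] mor_appendI[OF um(3,5)] mor_appendI[OF e1(2) g] mor_appendI[OF e2(2) g]
    by simp_all
  have paths: "path C [w1, u1] = w1 \<star> u1" "path C [w2, u2] = w2 \<star> u2" "path C [g, h1] = g \<star> h1" "path C [g, h2] = g \<star> h2"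
    by simp_all
  have A: "icsq z z' [w1 \<star> u1] E1
      ((join C [w2, u2] \<rhd> [u6, u8]) \<odot> ([w2] \<lhd> S2 \<rhd> [u8]) \<odot> ([w2, v2] \<lhd> X) \<odot> (a \<rhd> [u3, u7])
          \<odot> ([w1] \<lhd> sinv C S1 \<rhd> [u7]) \<odot> (split C [w1, u1] \<rhd> [u4, u7]))
      ((join C [w2, u2] \<rhd> [u6', u8']) \<odot> ([w2] \<lhd> S2' \<rhd> [u8']) \<odot> ([w2, v2] \<lhd> X') \<odot> (a \<rhd> [u3', u7'])
          \<odot> ([w1] \<lhd> sinv C S1' \<rhd> [u7']) \<odot> (split C [w1, u1] \<rhd> [u4', u7'])) [w2 \<star> u2] E2"
  proof (rule icsq_comp[OF icsq_comp[OF icsq_comp[OF icsq_comp[OF icsq_comp]]]])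
    show "icsq z z' [w1 \<star> u1] E1 (split C [w1, u1] \<rhd> [u4, u7]) (split C [w1, u1] \<rhd> [u4', u7']) [w1, u1] E1"
      using icsq_nat[OF icell_split[OF wu(1), unfolded paths] E1 m(3) m'(3) zm z'] .
    show "icsq z z' [w1, u1] E1 ([w1] \<lhd> sinv C S1 \<rhd> [u7]) ([w1] \<lhd> sinv C S1' \<rhd> [u7']) [w1, v1] K1"
      using icsq_lwhisk[OF icsq_inv[OF S1z] icell_cell[OF icell_sinv[OF m(5)]] mor_mor0[OF um(4)]]
      unfolding m(6) m'(6) by (simp only: append_Cons append_Nil)
    show "icsq z z' [w1, v1] K1 (a \<rhd> [u3, u7]) (a \<rhd> [u3', u7']) [w2, v2] K1"
      using icsq_nat[OF c(8) K1 m1 zm z'] .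
    show "icsq z z' [w2, v2] K1 ([w2, v2] \<lhd> X) ([w2, v2] \<lhd> X') [w2, v2] K2"
      using icsq_lwhisk[OF Xz icell_cell[OF X(1)] mor_mor0[OF fv(2)]] by (simp only: append_Nil2)
    show "icsq z z' [w2, v2] K2 ([w2] \<lhd> S2 \<rhd> [u8]) ([w2] \<lhd> S2' \<rhd> [u8']) [w2, u2] E2"
      using icsq_lwhisk[OF S2z icell_cell[OF m(7)] mor_mor0[OF um(5)]] by (simp only: append_Cons append_Nil)
    show "icsq z z' [w2, u2] E2 (join C [w2, u2] \<rhd> [u6, u8]) (join C [w2, u2] \<rhd> [u6', u8']) [w2 \<star> u2] E2"
      using icsq_nat[OF icell_join[OF wu(2), unfolded paths] E2 m(4) m'(4) zm z'] .
  qed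
  have B: "csq z z' [g \<star> h1] E1
      ((join C [g, h2] \<rhd> [u6, u8]) \<odot> ([g] \<lhd> Y) \<odot> (split C [g, h1] \<rhd> [u4, u7]))
      ((join C [g, h2] \<rhd> [u6', u8']) \<odot> ([g] \<lhd> Y') \<odot> (split C [g, h1] \<rhd> [u4', u7'])) [g \<star> h2] E2"
  proof (rule csq_comp[OF csq_comp])
    show "csq z z' [g \<star> h1] E1 (split C [g, h1] \<rhd> [u4, u7]) (split C [g, h1] \<rhd> [u4', u7']) [g, h1] E1"
      using csq_nat[OF icell_cell[OF icell_split[OF gh(1), unfolded paths]] E1 m(3) m'(3) zm z'] .
    show "csq z z' [g, h1] E1 ([g] \<lhd> Y) ([g] \<lhd> Y') [g, h2] E2"
      using csq_lwhisk[OF Yz Y(1) mor_mor0[OF g]] by (simp only: append_Cons append_Nil)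
    show "csq z z' [g, h2] E2 (join C [g, h2] \<rhd> [u6, u8]) (join C [g, h2] \<rhd> [u6', u8']) [g \<star> h2] E2"
      using csq_nat[OF icell_cell[OF icell_join[OF gh(2), unfolded paths]] E2 m(4) m'(4) zm z'] .
  qed
  have arr: "(D1, w1 \<star> u1, g \<star> h1) \<in> frac_arr C W" "(D2, w2 \<star> u2, g \<star> h2) \<in> frac_arr C W"
    using frac_comp_arr[OF ch F(1) G] frac_comp_arr[OF ch F(2) G] ch1 ch2 u f by simp_all
  have "w1 \<star> u1 \<in> W" using arr(1) by (simp add: frac_arr_def)
  then have wp: "wpath [w1 \<star> u1] D1 T" using wu(1) path_simps[OF wu(1)]
    by (simp add: wpath_def in_hom1_def)
  \<comment> \<open>The leg \<open>u4\<close> need not be in \<open>W\<close>. But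
    \<open>[w1, v1]\<close> followed by \<open>[u3, u7]\<close> is, and (BF5) along
    \<open>\<eta>1\<close> carries this over to \<open>[w1, u1]\<close> followed by
    \<open>[u4, u7]\<close>; \<open>split\<close> adjusts the brackets.\<close>
  have W1: "wpath ((w1 \<star> u1) # p) D T"
    if p: "wpath q D A3" "icell X (v1 # q) (u1 # p) D A1" "mor p D D1" for p q D X
  proof -
    have "wpath ([w1, v1] @ q) D T" using wpath_append[OF c(7) p(1)] .
    moreover have "icell ([w1] \<lhd> X) ([w1, v1] @ q) ([w1, u1] @ p) D T"
      using icell_slwhisk(1)[OF p(2) mor_mor0[OF um(4)]] by simp
    ultimately have "wpath ([w1, u1] @ p) D T" using wpath_icell by blast
    moreover have "icell (split C [w1, u1] \<rhd> p) ([w1 \<star> u1] @ p) ([w1, u1] @ p) D T"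
      using icell_srwhisk(1)[OF icell_split[OF wu(1)] p(3)] by simp
    ultimately have "wpath ([w1 \<star> u1] @ p) D T" using wpath_icell by blast
    then show ?thesis by simp
  qed
  have "Cod C (w1 \<star> u1) = T" using wp by (simp add: wpath_def in_hom1_def)
  then have "wpath ((w1 \<star> u1) # [u4, u7]) D5 (Cod C (w1 \<star> u1))" "wpath ((w1 \<star> u1) # [u4', u7']) D5' (Cod C (w1 \<star> u1))"
    using W1[OF m(1) _ m(3)] W1[OF m'(1) _ m'(3)] m(5) m'(5) by simp_all
  from frac2_class_eq[OF arr z z' m(3,4) m'(3,4) E1 E2 A B this] show ?thesis
    by (simp only: postcomp_rep.simps frac_comp.simps path.simps ch1 ch2 prod.case
        S1_def S2_def X_def Y_def S1'_def S2'_def X'_def Y'_def a_def)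
qed

text \<open>Neither \<open>u4\<close> nor \<open>u5\<close> is required to be in \<open>W\<close>,
  only the composite of \<open>u\<close>, \<open>u1\<close>, \<open>u2\<close> and
  \<open>u4\<close>. So (BF3) is applied to that whole composite and the result is lifted along
  \<open>[u, u1, u2]\<close>. The cells \<open>\<omega>\<close> are compared before the cells
  \<open>\<rho>\<close>, because \<open>\<omega>\<close> occurs in the equation that determines
  \<open>\<rho>\<close>.\<close>

lemma assoc_class_eq:
  assumes ch: "is_choiceC C W ch"
    and H: "(H0, w, h) \<in> frac_arr C W" and G: "(G0, v, g) \<in> frac_arr C W" and F: "(F0, u, f) \<in> frac_arr C W"
    and fv: "Cod C f = Cod C v" and gw: "Cod C g = Cod C w"
    and s: "assoc_aux C W ch (H0, w, h) (G0, v, g) (F0, u, f) (A4, u4, u5, \<gamma>, \<omega>, \<rho>)"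
    and s': "assoc_aux C W ch (H0, w, h) (G0, v, g) (F0, u, f) (A4', u4', u5', \<gamma>', \<omega>', \<rho>')"
  shows "frac2_class C W (frac_comp C ch (H0, w, h) (frac_comp C ch (G0, v, g) (F0, u, f)))
      (frac_comp C ch (frac_comp C ch (H0, w, h) (G0, v, g)) (F0, u, f))
      (assoc_rep C ch (H0, w, h) (G0, v, g) (F0, u, f) (A4, u4, u5, \<gamma>, \<omega>, \<rho>))
    = frac2_class C W (frac_comp C ch (H0, w, h) (frac_comp C ch (G0, v, g) (F0, u, f)))
      (frac_comp C ch (frac_comp C ch (H0, w, h) (G0, v, g)) (F0, u, f))
      (assoc_rep C ch (H0, w, h) (G0, v, g) (F0, u, f) (A4', u4', u5', \<gamma>', \<omega>', \<rho>'))"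
proof -
  define T S Q P where "T = Cod C v" and "S = Cod C w" and "Q = Cod C h" and "P = Cod C u"
  have u: "wpath [u] F0 P" and f: "mor [f] F0 T" "f \<in> Arr C" "Dom C f = F0" "Cod C f = T"
    and v: "v \<in> W" "Dom C v = G0" "Cod C v = T" "wpath [v] G0 T"
    and g: "mor [g] G0 S" "g \<in> Arr C" "Dom C g = G0" "Cod C g = S"
    and w: "w \<in> W" "Dom C w = H0" "Cod C w = S" "wpath [w] H0 S" and h: "mor [h] H0 Q"
    using F G H W_Arr fv gw by (auto simp: frac_arr_def wpath_def in_hom1_def T_def S_def Q_def P_def)
  obtain A1 u1 f1 \<delta> where ch1: "ch f v = (A1, u1, f1, \<delta>)" by (cases "ch f v")
  obtain A2 u2 l \<sigma> where ch2: "ch (g \<star> f1) w = (A2, u2, l, \<sigma>)" by (cases "ch (g \<star> f1) w")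
  obtain B2 v1 g1 \<xi> where ch3: "ch g w = (B2, v1, g1, \<xi>)" by (cases "ch g w")
  obtain A3 u3 f2 \<eta> where ch4: "ch f (v \<star> v1) = (A3, u3, f2, \<eta>)" by (cases "ch f (v \<star> v1)")
  define De Si Xi Et where "De = ([f, u1], \<delta>, [v, f1])" and "Si = ([g \<star> f1, u2], \<sigma>, [w, l])"
    and "Xi = ([g, v1], \<xi>, [w, g1])" and "Et = ([f, u3], \<eta>, [v \<star> v1, f2])"
  have e1: "wpath [u1] A1 F0" "mor [f1] A1 G0" "icell De [f, u1] [v, f1] A1 T"
    using choice_cells[OF ch f(2) v(1) _ ch1] f v by (simp_all add: De_def)
  have gf: "mor [g, f1] A1 S" using mor_appendI[OF e1(2) g(1)] by simp
  have "wpath [u2] A2 A1 \<and> mor [l] A2 H0 \<and> icell Si [g \<star> f1, u2] [w, l] A2 S"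
    using choice_cells[OF ch _ w(1) _ ch2] path_simps[OF gf] w by (simp add: Si_def)
  then have e2: "wpath [u2] A2 A1" "mor [l] A2 H0" "icell Si [g \<star> f1, u2] [w, l] A2 S" by auto
  have e3: "wpath [v1] B2 G0" "mor [g1] B2 H0" "icell Xi [g, v1] [w, g1] B2 S"
    using choice_cells[OF ch g(2) w(1) _ ch3] g w by (simp_all add: Xi_def)
  have vv: "wpath [v, v1] B2 T" using wpath_append[OF v(4) e3(1)] by simp
  note vvm = wpath_mor[OF vv]
  have "v \<star> v1 \<in> W" using vv by (simp add: wpath_def)
  then have "wpath [u3] A3 F0 \<and> mor [f2] A3 B2 \<and> icell Et [f, u3] [v \<star> v1, f2] A3 T"
    using choice_cells[OF ch f(2) _ _ ch4] path_simps[OF vvm] f by (simp add: Et_def)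
  then have e4: "wpath [u3] A3 F0" "mor [f2] A3 B2" "icell Et [f, u3] [v \<star> v1, f2] A3 T" by auto
  have cells: "mor [u4] A4 A2" "mor [u5] A4 A3" "wpath [u, u1, u2, u4] A4 P"
      "icell ([u1, u2, u4], \<gamma>, [u3, u5]) [u1, u2, u4] [u3, u5] A4 F0"
      "icell ([f1, u2, u4], \<omega>, [v1, f2, u5]) [f1, u2, u4] [v1, f2, u5] A4 G0"
      "icell ([l, u4], \<rho>, [g1, f2, u5]) [l, u4] [g1, f2, u5] A4 H0"
      "[v] \<lhd> ([f1, u2, u4], \<omega>, [v1, f2, u5])
        = (split C [v, v1] \<rhd> [f2, u5])
          \<odot> (Et \<rhd> [u5])
          \<odot> ([f] \<lhd> ([u1, u2, u4], \<gamma>, [u3, u5]))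
          \<odot> (sinv C De \<rhd> [u2, u4])" (is ?eq1)
      "[w] \<lhd> ([l, u4], \<rho>, [g1, f2, u5])
        = (Xi \<rhd> [f2, u5])
          \<odot> ([g] \<lhd> ([f1, u2, u4], \<omega>, [v1, f2, u5]))
          \<odot> (split C [g, f1] \<rhd> [u2, u4])
          \<odot> (sinv C Si \<rhd> [u4])" (is ?eq2)
    if s: "assoc_aux C W ch (H0, w, h) (G0, v, g) (F0, u, f) (A4, u4, u5, \<gamma>, \<omega>, \<rho>)"
    for A4 u4 u5 \<gamma> \<omega> \<rho>
  proof -
    note s = s[unfolded assoc_aux.simps ch1 ch2 ch3 ch4 prod.case, folded De_def Si_def Xi_def Et_def]
    show t: "mor [u4] A4 A2" "mor [u5] A4 A3" using s by auto
    have m: "mor [u, u1, u2, u4] A4 P" "mor [u1, u2, u4] A4 F0" "mor [u3, u5] A4 F0" "mor [f1, u2, u4] A4 G0" "mor [v1, f2, u5] A4 G0"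
        "mor [l, u4] A4 H0" "mor [g1, f2, u5] A4 H0"
      using t u e1(1,2) e2(1,2) e3(1,2) e4(1,2) by (auto simp: in_hom1_def wpath_def)
    show "wpath [u, u1, u2, u4] A4 P" using m s by (simp add: wpath_def)
    show "icell ([u1, u2, u4], \<gamma>, [u3, u5]) [u1, u2, u4] [u3, u5] A4 F0"
      "icell ([f1, u2, u4], \<omega>, [v1, f2, u5]) [f1, u2, u4] [v1, f2, u5] A4 G0"
      "icell ([l, u4], \<rho>, [g1, f2, u5]) [l, u4] [g1, f2, u5] A4 H0"
      using s m by (simp_all add: icell_iff in_hom2_def)
    show ?eq1
      ?eq2
      using s by blast+
  qed
  define X Y V where "X = ([u1, u2, u4], \<gamma>, [u3, u5])" and "Y = ([f1, u2, u4], \<omega>, [v1, f2, u5])"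
    and "V = ([l, u4], \<rho>, [g1, f2, u5])"
  define X' Y' V' where "X' = ([u1, u2, u4'], \<gamma>', [u3, u5'])" and "Y' = ([f1, u2, u4'], \<omega>', [v1, f2, u5'])"
    and "V' = ([l, u4'], \<rho>', [g1, f2, u5'])"
  note k = cells[OF s, folded X_def Y_def V_def] and k' = cells[OF s', folded X'_def Y'_def V'_def]
  have X: "icell X ([u1, u2] @ [u4]) ([u3] @ [u5]) A4 F0" "icell X' ([u1, u2] @ [u4']) ([u3] @ [u5']) A4' F0"
    using k(4) k'(4) by simp_all
  have Y: "icell Y ([f1, u2] @ [u4]) ([v1, f2] @ [u5]) A4 G0" "icell Y' ([f1, u2] @ [u4']) ([v1, f2] @ [u5']) A4' G0"
    using k(5) k'(5) by simp_all
  have V: "icell V ([l] @ [u4]) ([g1, f2] @ [u5]) A4 H0" "icell V' ([l] @ [u4']) ([g1, f2] @ [u5']) A4' H0"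
    using k(6) k'(6) by simp_all
  have lm: "mor [u] F0 P" "mor [u1] A1 F0" "mor [u2] A2 A1" "mor [u3] A3 F0" "mor [v] G0 T" "mor [v1] B2 G0" "mor [w] H0 S"
    using u e1(1) e2(1) e4(1) v(4) e3(1) w(4) wpath_mor by blast+
  have pm: "mor0 [] A3 A3" "mor0 [] A2 A2" "mor0 [u2] A2 A1" "mor0 [f2] A3 B2"
    "mor0 [u1, u2] A2 F0" "mor0 [f1, u2] A2 G0" "mor0 [v1, f2] A3 G0" "mor0 [g1, f2] A3 H0"
    using mor_mor0[OF lm(3)] mor_mor0[OF e4(2)] mor_mor0[OF mor_appendI[OF lm(3,2)]] mor_mor0[OF mor_appendI[OF lm(3) e1(2)]]
      mor_mor0[OF mor_appendI[OF e4(2) lm(6)]] mor_mor0[OF mor_appendI[OF e4(2) e3(2)]] by simp_all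
  have u24: "mor ([u2] @ [u4]) A4 A1" "mor ([u2] @ [u4']) A4' A1" and f25: "mor ([f2] @ [u5]) A4 B2" "mor ([f2] @ [u5']) A4' B2"
    using mor_appendI[OF k(1) lm(3)] mor_appendI[OF k'(1) lm(3)] mor_appendI[OF k(2) e4(2)] mor_appendI[OF k'(2) e4(2)] .
  have k1: "mor ([] @ [u4]) A4 A2" "mor ([] @ [u4']) A4' A2" and k2: "mor ([] @ [u5]) A4 A3" "mor ([] @ [u5']) A4' A3"
    using k(1,2) k'(1,2) by simp_all
  have w0: "wpath0 [] F0 F0" and u3': "wpath ([] @ [u3]) A3 F0" using e4(1) by (simp_all add: wpath0_def)
  have uuu: "wpath [u, u1, u2] A2 P"
    using wpath_append[OF u wpath_append[OF e1(1) e2(1)]] by simp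

  obtain y y' Y0 N where y: "wpath y Y0 A4" and y': "mor y' Y0 A4'"
    and N: "icell N ([u, u1, u2, u4] @ y) ([u, u1, u2, u4'] @ y') Y0 P"
    using wpath_square[OF k'(3) wpath_mor[OF k(3)]] .
  \<comment> \<open>The common front \<open>[u, u1, u2]\<close> is in \<open>W\<close> as a
    composite of \<open>u\<close> with legs chosen in \<open>C(W)\<close>, so \<open>N\<close> lifts
    to a comparison of \<open>u4\<close> and \<open>u4'\<close>.\<close>
  have "icell N ([u, u1, u2] @ [u4] @ y) ([u, u1, u2] @ [u4'] @ y') Y0 P" using N by simp
  then obtain r0 E10 Z0 where r0: "wpath r0 Z0 Y0" and E10': "icell E10 (([u4] @ y) @ r0) (([u4'] @ y') @ r0) Z0 A2"
    using wpath_lift[OF uuu mor_appendI[OF wpath_mor[OF y] k(1)] mor_appendI[OF y' k'(1)]] by blast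
  define z0 z0' where "z0 = y @ r0" and "z0' = y' @ r0"
  have z0: "wpath z0 Z0 A4" and z0': "mor z0' Z0 A4'" and E10: "icell E10 ([u4] @ z0) ([u4'] @ z0') Z0 A2"
    unfolding z0_def z0'_def
    using wpath_append[OF y r0] mor_appendI[OF wpath_mor[OF r0] y'] E10'[unfolded append.assoc] by blast+
  note z0m = wpath_mor[OF z0]
  \<comment> \<open>Through \<open>\<gamma>\<close> and along \<open>u3\<close> in \<open>W\<close>;
    this compares \<open>u5\<close> and \<open>u5'\<close>.\<close>
  obtain r1 E21 Z1 where r1: "wpath r1 Z1 Z0" and E21: "icell E21 ([u5] @ z0 @ r1) ([u5'] @ z0' @ r1) Z1 A3"
    and X1: "icsq (z0 @ r1) (z0' @ r1) [u1, u2] (E10 \<rhd> r1) X X' [u3] E21"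
    using csq_lift[OF z0m z0' X E10 pm(5) mor_mor0[OF lm(4)] w0 u3' k(2) k'(2)] .
  define z1 z1' E11 where "z1 = z0 @ r1" and "z1' = z0' @ r1" and "E11 = E10 \<rhd> r1"
  have z1: "wpath z1 Z1 A4" and z1': "mor z1' Z1 A4'" and E11: "icell E11 ([u4] @ z1) ([u4'] @ z1') Z1 A2"
    unfolding z1_def z1'_def E11_def
    using wpath_append[OF z0 r1] mor_appendI[OF wpath_mor[OF r1] z0'] icell_restrict[OF E10 wpath_mor[OF r1]] by blast+
  note E21 = E21[folded z1_def z1'_def] and X1 = X1[folded z1_def z1'_def E11_def]
  note z1m = wpath_mor[OF z1]

  \<comment> \<open>\<open>u2\<close> and \<open>f2\<close> stand between the fixed cells and the
    compared legs; this is the common segment of \<open>csq_natp\<close>.\<close>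
  have Y1: "csq z1 z1' [v, f1, u2] E11 ([v] \<lhd> Y) ([v] \<lhd> Y') [v, v1, f2] E21"
    unfolding k(7) k'(7)
  proof (rule csq_comp[OF csq_comp[OF csq_comp]])
    show "csq z1 z1' [v, f1, u2] E11 (sinv C De \<rhd> [u2, u4]) (sinv C De \<rhd> [u2, u4']) [f, u1, u2] E11"
      using csq_natp[OF icell_cell[OF icell_sinv[OF e1(3)]] pm(3) E11 u24 z1m z1'] by (simp only: append_Cons append_Nil)
    show "csq z1 z1' [f, u1, u2] E11 ([f] \<lhd> X) ([f] \<lhd> X') [f, u3] E21"
      using csq_lwhisk[OF icsq_csq[OF X1] icell_cell[OF X(1)] mor_mor0[OF f(1)]] by (simp only: append_Cons append_Nil)
    show "csq z1 z1' [f, u3] E21 (Et \<rhd> [u5]) (Et \<rhd> [u5']) [v \<star> v1, f2] E21"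
      using csq_nat[OF icell_cell[OF e4(3)] E21 k(2) k'(2) z1m z1'] .
    show "csq z1 z1' [v \<star> v1, f2] E21 (split C [v, v1] \<rhd> [f2, u5]) (split C [v, v1] \<rhd> [f2, u5']) [v, v1, f2] E21"
      using csq_natp[OF icell_cell[OF icell_split[OF vvm]] pm(4) E21 f25 z1m z1']
      by (simp only: append_Cons append_Nil path.simps)
  qed
  have Y1': "csq z1 z1' ([v] @ [f1, u2]) E11 ([v] \<lhd> Y) ([v] \<lhd> Y') ([v] @ [v1, f2]) E21" using Y1 by simp
  obtain r2 Z2 where r2: "wpath r2 Z2 Z1"
    and Y2: "csq (z1 @ r2) (z1' @ r2) [f1, u2] (E11 \<rhd> r2) Y Y' [v1, f2] (E21 \<rhd> r2)"
    using csq_cancel[OF Y1' z1m z1' icell_cell[OF Y(1)] icell_cell[OF Y(2)] E11 E21 pm(6,7) v(4)] .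
  define z2 z2' E12 E22 where "z2 = z1 @ r2" and "z2' = z1' @ r2" and "E12 = E11 \<rhd> r2" and "E22 = E21 \<rhd> r2"
  have z2: "wpath z2 Z2 A4" and z2': "mor z2' Z2 A4'" and E12: "icell E12 ([u4] @ z2) ([u4'] @ z2') Z2 A2"
    and E22: "icell E22 ([u5] @ z2) ([u5'] @ z2') Z2 A3" and X2: "icsq z2 z2' [u1, u2] E12 X X' [u3] E22"
    unfolding z2_def z2'_def E12_def E22_def
    using wpath_append[OF z1 r2] mor_appendI[OF wpath_mor[OF r2] z1'] icell_restrict[OF E11 wpath_mor[OF r2]]
      icell_restrict[OF E21 wpath_mor[OF r2]] icsq_restrict[OF X1 wpath_mor[OF r2] z1m] by blast+
  note Y2 = Y2[folded z2_def z2'_def E12_def E22_def]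
  note z2m = wpath_mor[OF z2]

  \<comment> \<open>The third factor uses the square for \<open>\<omega>\<close> obtained by
    cancelling \<open>v\<close>.\<close>
  have V2: "csq z2 z2' [w, l] E12 ([w] \<lhd> V) ([w] \<lhd> V') [w, g1, f2] E22"
    unfolding k(8) k'(8)
  proof (rule csq_comp[OF csq_comp[OF csq_comp]])
    show "csq z2 z2' [w, l] E12 (sinv C Si \<rhd> [u4]) (sinv C Si \<rhd> [u4']) [g \<star> f1, u2] E12"
      using csq_nat[OF icell_cell[OF icell_sinv[OF e2(3)]] E12 k(1) k'(1) z2m z2'] .
    show "csq z2 z2' [g \<star> f1, u2] E12 (split C [g, f1] \<rhd> [u2, u4]) (split C [g, f1] \<rhd> [u2, u4']) [g, f1, u2] E12"
      using csq_natp[OF icell_cell[OF icell_split[OF gf]] pm(3) E12 u24 z2m z2']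
      by (simp only: append_Cons append_Nil path.simps)
    show "csq z2 z2' [g, f1, u2] E12 ([g] \<lhd> Y) ([g] \<lhd> Y') [g, v1, f2] E22"
      using csq_lwhisk[OF Y2 icell_cell[OF Y(1)] mor_mor0[OF g(1)]] by (simp only: append_Cons append_Nil)
    show "csq z2 z2' [g, v1, f2] E22 (Xi \<rhd> [f2, u5]) (Xi \<rhd> [f2, u5']) [w, g1, f2] E22"
      using csq_natp[OF icell_cell[OF e3(3)] pm(4) E22 f25 z2m z2'] by (simp only: append_Cons append_Nil)
  qed
  have V2': "csq z2 z2' ([w] @ [l]) E12 ([w] \<lhd> V) ([w] \<lhd> V') ([w] @ [g1, f2]) E22" using V2 by simp
  obtain r3 Z3 where r3: "wpath r3 Z3 Z2"
    and V3: "csq (z2 @ r3) (z2' @ r3) [l] (E12 \<rhd> r3) V V' [g1, f2] (E22 \<rhd> r3)"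
    using csq_cancel[OF V2' z2m z2' icell_cell[OF V(1)] icell_cell[OF V(2)] E12 E22 mor_mor0[OF e2(2)] pm(8) w(4)] .
  note rm = wpath_mor[OF r3]
  define z z' E1 E2 where "z = z2 @ r3" and "z' = z2' @ r3" and "E1 = E12 \<rhd> r3" and "E2 = E22 \<rhd> r3"
  have z: "wpath z Z3 A4" and z': "mor z' Z3 A4'" and E1: "icell E1 ([u4] @ z) ([u4'] @ z') Z3 A2"
    and E2: "icell E2 ([u5] @ z) ([u5'] @ z') Z3 A3" and Xz: "icsq z z' [u1, u2] E1 X X' [u3] E2"
    unfolding z_def z'_def E1_def E2_def
    using wpath_append[OF z2 r3] mor_appendI[OF rm z2'] icell_restrict[OF E12 rm]
      icell_restrict[OF E22 rm] icsq_restrict[OF X2 rm z2m] by blast+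
  note Vz = V3[folded z_def z'_def E1_def E2_def]
  note zm = wpath_mor[OF z]

  have uu: "mor [u, u1] A1 P" "mor [u, u3] A3 P" and hh: "mor [h, l] A2 Q" "mor [h, g1] B2 Q"
    using mor_appendI[OF lm(2,1)] mor_appendI[OF lm(4,1)] mor_appendI[OF e2(2) h] mor_appendI[OF e3(2) h] by simp_all
  have uuu2: "mor [u \<star> u1, u2] A2 P" and hgf: "mor [h \<star> g1, f2] A3 Q"
    using mor_ConsI[OF lm(3), of "u \<star> u1" P] mor_ConsI[OF e4(2), of "h \<star> g1" Q] path_simps[OF uu(1)] path_simps[OF hh(2)]
    by (simp_all add: in_hom1_def)
  have A: "icsq z z' [(u \<star> u1) \<star> u2] E1
      ((join C [u, u3] \<rhd> [u5]) \<odot> ([u] \<lhd> X) \<odot> (split C [u, u1] \<rhd> [u2, u4]) \<odot> (split C [u \<star> u1, u2] \<rhd> [u4]))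
      ((join C [u, u3] \<rhd> [u5']) \<odot> ([u] \<lhd> X') \<odot> (split C [u, u1] \<rhd> [u2, u4']) \<odot> (split C [u \<star> u1, u2] \<rhd> [u4']))
      [u \<star> u3] E2"
  proof (rule icsq_comp[OF icsq_comp[OF icsq_comp]])
    show "icsq z z' [(u \<star> u1) \<star> u2] E1 (split C [u \<star> u1, u2] \<rhd> [u4]) (split C [u \<star> u1, u2] \<rhd> [u4']) [u \<star> u1, u2] E1"
      using icsq_nat[OF icell_split[OF uuu2] E1 k(1) k'(1) zm z'] by (simp only: path.simps)
    show "icsq z z' [u \<star> u1, u2] E1 (split C [u, u1] \<rhd> [u2, u4]) (split C [u, u1] \<rhd> [u2, u4']) [u, u1, u2] E1"
      using icsq_natp[OF icell_split[OF uu(1)] pm(3) E1 u24 zm z'] by (simp only: append_Cons append_Nil path.simps)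
    show "icsq z z' [u, u1, u2] E1 ([u] \<lhd> X) ([u] \<lhd> X') [u, u3] E2"
      using icsq_lwhisk[OF Xz icell_cell[OF X(1)] mor_mor0[OF lm(1)]] by (simp only: append_Cons append_Nil)
    show "icsq z z' [u, u3] E2 (join C [u, u3] \<rhd> [u5]) (join C [u, u3] \<rhd> [u5']) [u \<star> u3] E2"
      using icsq_nat[OF icell_join[OF uu(2)] E2 k(2) k'(2) zm z'] by (simp only: path.simps)
  qed
  have B: "csq z z' [h \<star> l] E1
      ((join C [h \<star> g1, f2] \<rhd> [u5]) \<odot> (join C [h, g1] \<rhd> [f2, u5]) \<odot> ([h] \<lhd> V) \<odot> (split C [h, l] \<rhd> [u4]))
      ((join C [h \<star> g1, f2] \<rhd> [u5']) \<odot> (join C [h, g1] \<rhd> [f2, u5']) \<odot> ([h] \<lhd> V') \<odot> (split C [h, l] \<rhd> [u4']))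
      [(h \<star> g1) \<star> f2] E2"
  proof (rule csq_comp[OF csq_comp[OF csq_comp]])
    show "csq z z' [h \<star> l] E1 (split C [h, l] \<rhd> [u4]) (split C [h, l] \<rhd> [u4']) [h, l] E1"
      using csq_nat[OF icell_cell[OF icell_split[OF hh(1)]] E1 k(1) k'(1) zm z'] by (simp only: path.simps)
    show "csq z z' [h, l] E1 ([h] \<lhd> V) ([h] \<lhd> V') [h, g1, f2] E2"
      using csq_lwhisk[OF Vz icell_cell[OF V(1)] mor_mor0[OF h]] by (simp only: append_Cons append_Nil)
    show "csq z z' [h, g1, f2] E2 (join C [h, g1] \<rhd> [f2, u5]) (join C [h, g1] \<rhd> [f2, u5']) [h \<star> g1, f2] E2"
      using csq_natp[OF icell_cell[OF icell_join[OF hh(2)]] pm(4) E2 f25 zm z'] by (simp only: append_Cons append_Nil path.simps)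
    show "csq z z' [h \<star> g1, f2] E2 (join C [h \<star> g1, f2] \<rhd> [u5]) (join C [h \<star> g1, f2] \<rhd> [u5']) [(h \<star> g1) \<star> f2] E2"
      using csq_nat[OF icell_cell[OF icell_join[OF hgf]] E2 k(2) k'(2) zm z'] by (simp only: path.simps)
  qed
  have arr0: "(A1, u \<star> u1, g \<star> f1) \<in> frac_arr C W" "(B2, v \<star> v1, h \<star> g1) \<in> frac_arr C W"
    using frac_comp_arr[OF ch F G] frac_comp_arr[OF ch G H] ch1 ch3 f(4) v(3) g(4) w(3) by simp_all
  have arr: "(A2, (u \<star> u1) \<star> u2, h \<star> l) \<in> frac_arr C W" "(A3, u \<star> u3, (h \<star> g1) \<star> f2) \<in> frac_arr C W"
    using frac_comp_arr[OF ch arr0(1) H] frac_comp_arr[OF ch F arr0(2)] ch2 ch4 f(4) w(3)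
      path_simps[OF gf] path_simps[OF vvm] by simp_all
  have "(u \<star> u1) \<star> u2 \<in> W" using arr(1) by (simp add: frac_arr_def)
  then have wp: "wpath [(u \<star> u1) \<star> u2] A2 P" using path_simps[OF uuu2] by (simp add: wpath_def in_hom1_def)
  then have cod: "Cod C ((u \<star> u1) \<star> u2) = P" by (simp add: wpath_def in_hom1_def)
  \<comment> \<open>The hypothesis concerns the right-bracketed composite, while the first leg of
    the source is \<open>(u \<star> u1) \<star> u2\<close>. Two uses of (BF5) along
    \<open>split\<close> cells change the bracketing.\<close>
  have W1: "wpath (((u \<star> u1) \<star> u2) # [x]) D P" if x: "mor [x] D A2" "wpath [u, u1, u2, x] D P" for x D
  proof -
    have "icell (split C [u, u1] \<rhd> [u2, x]) [u \<star> u1, u2, x] [u, u1, u2, x] D P"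
      using icell_srwhisk(1)[OF icell_split[OF uu(1)], of "[u2, x]" D] mor_appendI[OF x(1) lm(3)] by simp
    with x(2) have "wpath [u \<star> u1, u2, x] D P" using wpath_icell by blast
    moreover have "icell (split C [u \<star> u1, u2] \<rhd> [x]) [(u \<star> u1) \<star> u2, x] [u \<star> u1, u2, x] D P"
      using icell_srwhisk(1)[OF icell_split[OF uuu2] x(1)] by simp
    ultimately show ?thesis using wpath_icell by blast
  qed
  from frac2_class_eq[OF arr z z' k(1,2) k'(1,2) E1 E2 A B, unfolded cod, OF W1[OF k(1,3)] W1[OF k'(1,3)]]
  show ?thesis
    by (simp only: assoc_rep.simps frac_comp.simps path.simps ch1 ch2 ch3 ch4 prod.case
        X_def Y_def V_def X'_def Y'_def V'_def)
qed

section \<open>From representatives to classes and to the bicategory\<close>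

lemma frac2_class_subset: "frac2_class C W F1 F2 d \<subseteq> frac2_data C W F1 F2"
  by (auto simp: frac2_class_def frac2_rel_def frac2_data_def)

lemma frac_cellD:
  assumes "(F1, F2, X) \<in> frac_cell C W"
  shows "F1 \<in> frac_arr C W" "F2 \<in> frac_arr C W" "frac_dom C F1 = frac_dom C F2" "frac_cod C F1 = frac_cod C F2"
    "X \<subseteq> frac2_data C W F1 F2"
  using assms by (auto simp: frac_cell_def quotient_def frac2_rel_def frac2_data_def)

lemma is_selectionD:
  assumes "is_selection C W ch S"
  shows "F1 \<in> frac_arr C W \<Longrightarrow> F2 \<in> frac_arr C W \<Longrightarrow> F3 \<in> frac_arr C W
      \<Longrightarrow> d1 \<in> frac2_data C W F1 F2 \<Longrightarrow> d2 \<in> frac2_data C W F2 F3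
      \<Longrightarrow> vcomp_aux C W d1 d2 (sel_vcomp S F1 F2 F3 d1 d2)"
    and "F \<in> frac_arr C W \<Longrightarrow> G1 \<in> frac_arr C W \<Longrightarrow> G2 \<in> frac_arr C W
      \<Longrightarrow> d \<in> frac2_data C W G1 G2 \<Longrightarrow> frac_cod C F = frac_dom C G1
      \<Longrightarrow> precomp_aux C W ch F G1 G2 d (sel_precomp S F G1 G2 d)"
    and "G \<in> frac_arr C W \<Longrightarrow> F1 \<in> frac_arr C W \<Longrightarrow> F2 \<in> frac_arr C W
      \<Longrightarrow> d \<in> frac2_data C W F1 F2 \<Longrightarrow> frac_cod C F1 = frac_dom C G
      \<Longrightarrow> postcomp_aux C W ch G F1 F2 d (sel_postcomp S G F1 F2 d)"
    and "H \<in> frac_arr C W \<Longrightarrow> G \<in> frac_arr C W \<Longrightarrow> F \<in> frac_arr C W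
      \<Longrightarrow> frac_cod C F = frac_dom C G \<Longrightarrow> frac_cod C G = frac_dom C H
      \<Longrightarrow> assoc_aux C W ch H G F (sel_assoc S H G F)"
  using assms by (simp_all add: is_selection_def)

text \<open>Both sides are unions over the same pairs of representatives, so they are compared term
  by term; the selections differ only in the auxiliary data attached to each pair.\<close>

lemma class_vcomp_eq:
  assumes S: "is_selection C W ch S" "is_selection C W ch S'"
    and F: "F1 \<in> frac_arr C W" "F2 \<in> frac_arr C W" "F3 \<in> frac_arr C W"
    and X: "X \<subseteq> frac2_data C W F1 F2" and Y: "Y \<subseteq> frac2_data C W F2 F3"
  shows "class_vcomp C W S F1 F2 F3 Y X = class_vcomp C W S' F1 F2 F3 Y X"
  unfolding class_vcomp_def
proof (intro SUP_cong refl)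
  fix d1 d2 assume "d2 \<in> Y" "d1 \<in> X"
  with X Y have d: "d1 \<in> frac2_data C W F1 F2" "d2 \<in> frac2_data C W F2 F3" by auto
  have *: "frac2_class C W F1 F3 (vcomp_rep C F1 F2 F3 d1 d2 s) = frac2_class C W F1 F3 (vcomp_rep C F1 F2 F3 d1 d2 s')"
    if "vcomp_aux C W d1 d2 s" "vcomp_aux C W d1 d2 s'" for s s'
    using F d that unfolding frac2_data_def mem_Collect_eq
    by (cases F1; cases F2; cases F3; cases d1; cases d2; cases s; cases s') (hypsubst, rule vcomp_class_eq; assumption)
  show "frac2_class C W F1 F3 (vcomp_rep C F1 F2 F3 d1 d2 (sel_vcomp S F1 F2 F3 d1 d2))
      = frac2_class C W F1 F3 (vcomp_rep C F1 F2 F3 d1 d2 (sel_vcomp S' F1 F2 F3 d1 d2))"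
    by (rule * is_selectionD(1)[OF S(1) F d] is_selectionD(1)[OF S(2) F d])+
qed

lemma class_precomp_eq:
  assumes ch: "is_choiceC C W ch" and S: "is_selection C W ch S" "is_selection C W ch S'"
    and F: "F \<in> frac_arr C W" "G1 \<in> frac_arr C W" "G2 \<in> frac_arr C W" and FG: "frac_cod C F = frac_dom C G1"
    and Y: "Y \<subseteq> frac2_data C W G1 G2"
  shows "class_precomp C W ch S F G1 G2 Y = class_precomp C W ch S' F G1 G2 Y"
  unfolding class_precomp_def
proof (intro SUP_cong refl)
  fix d assume "d \<in> Y"
  with Y have d: "d \<in> frac2_data C W G1 G2" by auto
  have *: "frac2_class C W (frac_comp C ch G1 F) (frac_comp C ch G2 F) (precomp_rep C ch F G1 G2 d s)
      = frac2_class C W (frac_comp C ch G1 F) (frac_comp C ch G2 F) (precomp_rep C ch F G1 G2 d s')"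
    if "precomp_aux C W ch F G1 G2 d s" "precomp_aux C W ch F G1 G2 d s'" for s s'
  proof -
    obtain x1 x2 x3 x4 x5 x6 r where s: "s = (x1, x2, x3, x4, x5, x6, r)" by (cases s)
    obtain x7 x8 x9 x10 x11 x12 x13 where r: "r = (x7, x8, x9, x10, x11, x12, x13)" by (cases r)
    obtain y1 y2 y3 y4 y5 y6 r' where s': "s' = (y1, y2, y3, y4, y5, y6, r')" by (cases s')
    obtain y7 y8 y9 y10 y11 y12 y13 where r': "r' = (y7, y8, y9, y10, y11, y12, y13)" by (cases r')
    show ?thesis
      using F d that FG ch unfolding frac2_data_def mem_Collect_eq s r s' r'
      by (cases F; cases G1; cases G2; cases d)
        (hypsubst, unfold frac_dom.simps frac_cod.simps, rule precomp_class_eq; assumption)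
  qed
  show "frac2_class C W (frac_comp C ch G1 F) (frac_comp C ch G2 F)
        (precomp_rep C ch F G1 G2 d (sel_precomp S F G1 G2 d))
      = frac2_class C W (frac_comp C ch G1 F) (frac_comp C ch G2 F)
        (precomp_rep C ch F G1 G2 d (sel_precomp S' F G1 G2 d))"
    by (rule * is_selectionD(2)[OF S(1) F d FG] is_selectionD(2)[OF S(2) F d FG])+
qed

lemma class_postcomp_eq:
  assumes ch: "is_choiceC C W ch" and S: "is_selection C W ch S" "is_selection C W ch S'"
    and F: "G \<in> frac_arr C W" "F1 \<in> frac_arr C W" "F2 \<in> frac_arr C W" and FG: "frac_cod C F1 = frac_dom C G"
    and X: "X \<subseteq> frac2_data C W F1 F2"
  shows "class_postcomp C W ch S G F1 F2 X = class_postcomp C W ch S' G F1 F2 X"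
  unfolding class_postcomp_def
proof (intro SUP_cong refl)
  fix d assume "d \<in> X"
  with X have d: "d \<in> frac2_data C W F1 F2" by auto
  have *: "frac2_class C W (frac_comp C ch G F1) (frac_comp C ch G F2) (postcomp_rep C ch G F1 F2 d s)
      = frac2_class C W (frac_comp C ch G F1) (frac_comp C ch G F2) (postcomp_rep C ch G F1 F2 d s')"
    if "postcomp_aux C W ch G F1 F2 d s" "postcomp_aux C W ch G F1 F2 d s'" for s s'
  proof -
    obtain x1 x2 x3 x4 x5 x6 r where s: "s = (x1, x2, x3, x4, x5, x6, r)" by (cases s)
    obtain x7 x8 x9 x10 x11 x12 x13 where r: "r = (x7, x8, x9, x10, x11, x12, x13)" by (cases r)
    obtain y1 y2 y3 y4 y5 y6 r' where s': "s' = (y1, y2, y3, y4, y5, y6, r')" by (cases s')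
    obtain y7 y8 y9 y10 y11 y12 y13 where r': "r' = (y7, y8, y9, y10, y11, y12, y13)" by (cases r')
    show ?thesis
      using F d that FG ch unfolding frac2_data_def mem_Collect_eq s r s' r'
      by (cases G; cases F1; cases F2; cases d)
        (hypsubst, unfold frac_dom.simps frac_cod.simps, rule postcomp_class_eq; assumption)
  qed
  show "frac2_class C W (frac_comp C ch G F1) (frac_comp C ch G F2)
        (postcomp_rep C ch G F1 F2 d (sel_postcomp S G F1 F2 d))
      = frac2_class C W (frac_comp C ch G F1) (frac_comp C ch G F2)
        (postcomp_rep C ch G F1 F2 d (sel_postcomp S' G F1 F2 d))"
    by (rule * is_selectionD(3)[OF S(1) F d FG] is_selectionD(3)[OF S(2) F d FG])+
qed

lemma class_assoc_eq:
  assumes ch: "is_choiceC C W ch" and S: "is_selection C W ch S" "is_selection C W ch S'"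
    and F: "H \<in> frac_arr C W" "G \<in> frac_arr C W" "F \<in> frac_arr C W"
    "frac_cod C F = frac_dom C G" "frac_cod C G = frac_dom C H"
  shows "class_assoc C W ch S H G F = class_assoc C W ch S' H G F"
proof -
  have *: "frac2_class C W (frac_comp C ch H (frac_comp C ch G F)) (frac_comp C ch (frac_comp C ch H G) F)
        (assoc_rep C ch H G F s)
      = frac2_class C W (frac_comp C ch H (frac_comp C ch G F)) (frac_comp C ch (frac_comp C ch H G) F)
        (assoc_rep C ch H G F s')"
    if "assoc_aux C W ch H G F s" "assoc_aux C W ch H G F s'" for s s'
    using F that ch
    by (cases H; cases G; cases F; cases s; cases s')
      (hypsubst, unfold frac_dom.simps frac_cod.simps, rule assoc_class_eq; assumption)
  show ?thesis
    unfolding class_assoc_def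
    by (rule * is_selectionD(4)[OF S(1) F] is_selectionD(4)[OF S(2) F])+
qed

text \<open>A horizontal composite is a vertical one of two whiskered 2-morphisms. The whiskered
  classes already agree for the two selections, and then the vertical comparison applies to
  them.\<close>

lemma class_hcomp_eq:
  assumes ch: "is_choiceC C W ch" and S: "is_selection C W ch S" "is_selection C W ch S'"
    and X: "(F1, F2, X) \<in> frac_cell C W" and Y: "(G1, G2, Y) \<in> frac_cell C W"
    and FG: "frac_cod C F1 = frac_dom C G1"
  shows "class_hcomp C W ch S G1 G2 F1 F2 Y X = class_hcomp C W ch S' G1 G2 F1 F2 Y X"
proof -
  note x = frac_cellD[OF X] and y = frac_cellD[OF Y]
  have FG': "frac_cod C F2 = frac_dom C G1" "frac_cod C F2 = frac_dom C G2" using FG x y by auto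
  have pre: "class_precomp C W ch S F2 G1 G2 Y = class_precomp C W ch S' F2 G1 G2 Y"
    by (rule class_precomp_eq[OF ch S x(2) y(1,2) FG'(1) y(5)])
  have post: "class_postcomp C W ch S G1 F1 F2 X = class_postcomp C W ch S' G1 F1 F2 X"
    by (rule class_postcomp_eq[OF ch S y(1) x(1,2) FG x(5)])
  \<comment> \<open>A class consists of valid data by definition of the relation, so the
    intermediate results are admissible arguments of the vertical composition.\<close>
  have "class_precomp C W ch S' F2 G1 G2 Y \<subseteq> frac2_data C W (frac_comp C ch G1 F2) (frac_comp C ch G2 F2)"
    unfolding class_precomp_def using frac2_class_subset by blast
  moreover have "class_postcomp C W ch S' G1 F1 F2 X \<subseteq> frac2_data C W (frac_comp C ch G1 F1) (frac_comp C ch G1 F2)"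
    unfolding class_postcomp_def using frac2_class_subset by blast
  moreover have "frac_comp C ch G1 F1 \<in> frac_arr C W" "frac_comp C ch G1 F2 \<in> frac_arr C W" "frac_comp C ch G2 F2 \<in> frac_arr C W"
    using frac_comp_arr[OF ch] x y FG FG' by blast+
  ultimately show ?thesis
    unfolding class_hcomp_def pre post by (intro class_vcomp_eq[OF S])
qed

text \<open>Only \<open>VComp\<close>, \<open>HComp\<close> and \<open>Assoc\<close> mention the
  selection. Their guards provide the typing hypotheses of the comparisons, and outside the guards
  both sides are \<open>undefined\<close>.\<close>

lemma fractions_of_selection_eq:
  assumes ch: "is_choiceC C W ch" and S: "is_selection C W ch S" "is_selection C W ch S'"
  shows "fractions_of_selection C W ch S = fractions_of_selection C W ch S'"
proof -
  have v: "class_vcomp C W S F1 F2 F3 Y X = class_vcomp C W S' F1 F2 F3 Y X"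
    if "(F1, F2, X) \<in> frac_cell C W" "(F2, F3, Y) \<in> frac_cell C W" for F1 F2 F3 X Y
    using class_vcomp_eq[OF S] frac_cellD[OF that(1)] frac_cellD[OF that(2)] by blast
  show ?thesis
    unfolding fractions_of_selection_def
    by (auto simp: fun_eq_iff v class_hcomp_eq[OF ch S] class_assoc_eq[OF ch S])
qed

end

theorem theorem1p2:
  fixes C :: "('o, 'a, 'c) bicat"
    and W :: "'a set"
    and R :: "('o, 'a, 'c) selection_rule"
    and ch :: "('o, 'a, 'c) choiceC"
    and d d' :: "('o, 'a, 'c) choiceD"
  assumes "bicategory C"
    and "W \<subseteq> Arr C"
    and "BF C W"
    and "is_selection_rule C W R"
    and "is_choiceC C W ch"
    and "is_choiceD C W d"
    and "is_choiceD C W d'"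
  shows "bicat_of_fractions C W R ch d = bicat_of_fractions C W R ch d'"
proof -
  interpret fractions C W
    using assms(1-3) by (simp add: fractions_def fractions_axioms_def)
  \<comment> \<open>All that matters about \<open>d\<close> and \<open>d'\<close> is that the rule
    turns each of them into admissible data over the same \<open>ch\<close>.\<close>
  have "is_selection C W ch (R ch d)" "is_selection C W ch (R ch d')"
    using assms(4-7) unfolding is_selection_rule_def by blast+
  then show ?thesis
    unfolding bicat_of_fractions_def by (rule fractions_of_selection_eq[OF assms(5)])
qed

end
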